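(* Let $\Lambda$ be a hereditary algebra which is finite dimensional over a field and let $(E_1,\dots,E_n)$ be a complete exceptional sequence over $\Lambda$. Then every object $E_k$ ($1\le k\le n$) is either relatively projective or relatively injective (or both).
   Context: $n$ is the number of isomorphism classes of simple $\Lambda$-modules; modules are finite dimensional; $\mathrm{Ext}=\mathrm{Ext}^1_\Lambda$ and $\mathrm{Hom}=\mathrm{Hom}_\Lambda$. A module $E$ is exceptional if $\mathrm{Ext}(E,E)=0$ and $\mathrm{End}(E)$ is a division algebra. For a module $M$, $M^\perp$ is the full subcategory of modules $X$ with $\mathrm{Hom}(M,X)=0=\mathrm{Ext}(M,X)$, and ${}^\perp M$ is the full subcategory of modules $X$ with $\mathrm{Hom}(X,M)=0=\mathrm{Ext}(X,M)$. An exceptional sequence is a sequence of exceptional modules $(E_1,\dots,E_r)$ with $E_i\in E_j^\perp$ for all $i<j$; it is complete if it has length $r=n$. For a complete exceptional sequence put $\mathcal{A}_k=(E_{k+1}\oplus\cdots\oplus E_n)^\perp$ and $\mathcal{B}_k={}^\perp(E_1\oplus\cdots\oplus E_{k-1})$ (with $\mathcal{A}_n$ and $\mathcal{B}_1$ the whole module category); these are exactly embedded, extension-closed abelian subcategories. $E_k$ is relatively projective if it is a projective object of $\mathcal{A}_k$, and relatively injective if it is an injective object of $\mathcal{B}_k$. *)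

theory Defs
  imports Complex_Main "HOL-Library.Function_Algebras"
begin

locale fd_algebra = vector_space sc
  for sc :: "'k::field \<Rightarrow> 'a::ring_1 \<Rightarrow> 'a" +
  assumes mult_scale_left: "sc c x * y = sc c (x * y)"
    and mult_scale_right: "x * sc c y = sc c (x * y)"
    and finite_dim: "\<exists>B. finite B \<and> span B = UNIV"

text \<open>
  Left modules: an additive subgroup \<open>carr M\<close> of an ambient abelian group together with an action
  of the ring. The values of \<open>act M a\<close> outside \<open>carr M\<close> are irrelevant. The ground field acts
  through \<open>c \<cdot> x = act M (sc c 1) x\<close>.
\<close>

datatype ('a, 'v) lmodule = LModule (carr: "'v set") (act: "'a \<Rightarrow> 'v \<Rightarrow> 'v")

definition is_lmodule :: "('a::ring_1, 'v::ab_group_add) lmodule \<Rightarrow> bool" where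
  "is_lmodule M \<longleftrightarrow>
     0 \<in> carr M \<and>
     (\<forall>x\<in>carr M. \<forall>y\<in>carr M. x + y \<in> carr M) \<and>
     (\<forall>x\<in>carr M. - x \<in> carr M) \<and>
     (\<forall>a. \<forall>x\<in>carr M. act M a x \<in> carr M) \<and>
     (\<forall>a. \<forall>x\<in>carr M. \<forall>y\<in>carr M. act M a (x + y) = act M a x + act M a y) \<and>
     (\<forall>a b. \<forall>x\<in>carr M. act M (a + b) x = act M a x + act M b x) \<and>
     (\<forall>a b. \<forall>x\<in>carr M. act M (a * b) x = act M a (act M b x)) \<and>
     (\<forall>x\<in>carr M. act M 1 x = x)"

definition fd_module ::
  "('k::field \<Rightarrow> 'a::ring_1 \<Rightarrow> 'a) \<Rightarrow> ('a, 'v::ab_group_add) lmodule \<Rightarrow> bool" where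
  "fd_module sc M \<longleftrightarrow> is_lmodule M \<and>
     (\<exists>B\<subseteq>carr M. finite B \<and> (\<forall>x\<in>carr M. \<exists>c. x = (\<Sum>b\<in>B. act M (sc (c b) 1) b)))"

definition submodule :: "'v::ab_group_add set \<Rightarrow> ('a::ring_1, 'v) lmodule \<Rightarrow> bool" where
  "submodule U M \<longleftrightarrow> U \<subseteq> carr M \<and> is_lmodule (LModule U (act M))"

text \<open>
  Homomorphisms are normalised to be zero off the carrier of the source, so that equality of
  homomorphisms is equality of functions and \<open>Hom M N = {0}\<close> says that there is only the zero map.
\<close>

definition Hom ::
  "('a::ring_1, 'v::ab_group_add) lmodule \<Rightarrow> ('a, 'w::ab_group_add) lmodule \<Rightarrow> ('v \<Rightarrow> 'w) set" where
  "Hom M N = {f.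
     (\<forall>x\<in>carr M. f x \<in> carr N) \<and>
     (\<forall>x. x \<notin> carr M \<longrightarrow> f x = 0) \<and>
     (\<forall>x\<in>carr M. \<forall>y\<in>carr M. f (x + y) = f x + f y) \<and>
     (\<forall>a. \<forall>x\<in>carr M. f (act M a x) = act N a (f x))}"

definition id_hom :: "('a::ring_1, 'v::ab_group_add) lmodule \<Rightarrow> 'v \<Rightarrow> 'v" where
  "id_hom M = (\<lambda>x. if x \<in> carr M then x else 0)"

definition isomorphic ::
  "('a::ring_1, 'v::ab_group_add) lmodule \<Rightarrow> ('a, 'w::ab_group_add) lmodule \<Rightarrow> bool" where
  "isomorphic M N \<longleftrightarrow> (\<exists>f\<in>Hom M N. \<exists>g\<in>Hom N M. g \<circ> f = id_hom M \<and> f \<circ> g = id_hom N)"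

text \<open>
  HOL cannot quantify over types inside a definition. Whenever modules are quantified over below,
  they range over modules carried by subsets of \<^typ>\<open>nat \<Rightarrow> 'k\<close>. No isomorphism class is lost:
  see \<open>fd_module_isomorphic_std\<close>.
\<close>

type_synonym ('a, 'k) std_module = "('a, nat \<Rightarrow> 'k) lmodule"

lemma fd_module_isomorphic_std:
  fixes sc :: "'k::field \<Rightarrow> 'a::ring_1 \<Rightarrow> 'a" and M :: "('a, 'v::ab_group_add) lmodule"
  assumes "fd_algebra sc" and "fd_module sc M"
  shows "\<exists>N :: ('a, 'k) std_module. fd_module sc N \<and> isomorphic M N"
proof -
  interpret fd_algebra sc by fact
  define s where "s c x = act M (sc c 1) x" for c x
  have M: "is_lmodule M" using assms(2) by (simp add: fd_module_def)
  have M0: "0 \<in> carr M" and Madd: "\<And>x y. x \<in> carr M \<Longrightarrow> y \<in> carr M \<Longrightarrow> x + y \<in> carr M"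
    and Mneg: "\<And>x. x \<in> carr M \<Longrightarrow> - x \<in> carr M"
    and Mact: "\<And>a x. x \<in> carr M \<Longrightarrow> act M a x \<in> carr M"
    and act_add: "\<And>a x y. x \<in> carr M \<Longrightarrow> y \<in> carr M \<Longrightarrow> act M a (x + y) = act M a x + act M a y"
    and add_act: "\<And>a b x. x \<in> carr M \<Longrightarrow> act M (a + b) x = act M a x + act M b x"
    and act_mult: "\<And>a b x. x \<in> carr M \<Longrightarrow> act M (a * b) x = act M a (act M b x)"
    and act_1: "\<And>x. x \<in> carr M \<Longrightarrow> act M 1 x = x"
    using M by (auto simp: is_lmodule_def)
  have act_0: "act M a 0 = 0" for a using act_add[OF M0 M0, of a] by simp
  have s_in: "s c x \<in> carr M" if "x \<in> carr M" for c x using that by (simp add: s_def Mact)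
  have s_add: "s (c + d) x = s c x + s d x" if "x \<in> carr M" for c d x
    using that by (simp add: s_def scale_left_distrib add_act)
  have s_addr: "s c (x + y) = s c x + s c y" if "x \<in> carr M" "y \<in> carr M" for c x y
    using that by (simp add: s_def act_add)
  have sc_mult: "sc c 1 * sc d 1 = sc (c * d) 1" for c d
    by (metis mult_scale_left mult_1_left scale_scale)
  have s_mult: "s (c * d) x = s c (s d x)" if "x \<in> carr M" for c d x
    using that by (simp add: s_def act_mult sc_mult[symmetric])
  have s_1: "s 1 x = x" if "x \<in> carr M" for x using that by (simp add: s_def act_1)
  have s_0: "s 0 x = 0" if "x \<in> carr M" for x using s_add[OF that, of 0 0] by simp
  have s_neg: "s (- c) x = - s c x" if "x \<in> carr M" for c x
    using s_add[OF that, of c "- c"] s_0[OF that] by (simp add: eq_neg_iff_add_eq_0 add.commute)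
  have s_act: "act M a (s c x) = s c (act M a x)" if "x \<in> carr M" for a c x
    using that by (simp add: s_def act_mult[symmetric] mult_scale_left mult_scale_right)
  have sum_in: "(\<Sum>i\<in>I. f i) \<in> carr M" if "\<And>i. i \<in> I \<Longrightarrow> f i \<in> carr M" for I :: "'z set" and f
    using that by (induction I rule: infinite_finite_induct) (auto simp: M0 Madd)
  have act_sum: "act M a (\<Sum>i\<in>I. f i) = (\<Sum>i\<in>I. act M a (f i))"
    if "\<And>i. i \<in> I \<Longrightarrow> f i \<in> carr M" for I :: "'z set" and f a
    using that
    by (induction I rule: infinite_finite_induct) (auto simp: act_0 act_add sum_in)

  define Sp where "Sp B \<longleftrightarrow> B \<subseteq> carr M \<and> finite B \<and> (\<forall>x\<in>carr M. \<exists>c. x = (\<Sum>b\<in>B. s (c b) b))" for B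
  have "\<exists>B. Sp B" using assms(2) by (auto simp: fd_module_def Sp_def s_def)
  then obtain B where B: "Sp B" and Bmin: "\<And>B'. Sp B' \<Longrightarrow> card B \<le> card B'"
    using ex_has_least_nat[of Sp _ card] by blast
  have BM: "B \<subseteq> carr M" and finB: "finite B"
    and span: "\<And>x. x \<in> carr M \<Longrightarrow> \<exists>c. x = (\<Sum>b\<in>B. s (c b) b)" using B by (auto simp: Sp_def)
  have indep: "e j = 0" if e: "(\<Sum>b\<in>B. s (e b) b) = 0" and j: "j \<in> B" for e j
  proof (rule ccontr)
    assume ej: "e j \<noteq> 0"
    have jM: "j \<in> carr M" using j BM by auto
    have "Sp (B - {j})"
      unfolding Sp_def
    proof (intro conjI ballI)
      fix x assume "x \<in> carr M"
      then obtain c where c: "x = (\<Sum>b\<in>B. s (c b) b)" using span by blast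
      let ?t = "- (c j / e j)"
      have "(\<Sum>b\<in>B. s (?t * e b) b) = (\<Sum>b\<in>B. s ?t (s (e b) b))"
        using BM by (intro sum.cong) (rule refl, rule s_mult, blast)
      also have "\<dots> = s ?t (\<Sum>b\<in>B. s (e b) b)"
        unfolding s_def using BM by (intro act_sum[symmetric]) (auto simp: Mact)
      also have "\<dots> = 0" unfolding e by (simp add: s_def act_0)
      finally have z: "(\<Sum>b\<in>B. s (?t * e b) b) = 0" .
      have "x = (\<Sum>b\<in>B. s (c b) b) + (\<Sum>b\<in>B. s (?t * e b) b)" using c z by simp
      also have "\<dots> = (\<Sum>b\<in>B. s (c b) b + s (?t * e b) b)" by (simp only: sum.distrib)
      also have "\<dots> = (\<Sum>b\<in>B. s (c b + ?t * e b) b)"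
        using BM by (intro sum.cong refl s_add[symmetric]) auto
      also have "\<dots> = s (c j + ?t * e j) j + (\<Sum>b\<in>B - {j}. s (c b + ?t * e b) b)"
        using finB j by (rule sum.remove)
      also have "c j + ?t * e j = 0" using ej by simp
      finally have "x = (\<Sum>b\<in>B - {j}. s (c b + ?t * e b) b)" using s_0[OF jM] by simp
      then show "\<exists>c. x = (\<Sum>b\<in>B - {j}. s (c b) b)"
        by (intro exI[of _ "\<lambda>b. c b + ?t * e b"])
    qed (use BM finB in auto)
    from Bmin[OF this] show False using finB j by (meson card_Diff1_less leD)
  qed

  define d where "d = card B"
  obtain b where b: "bij_betw b {..<d} B"
    using ex_bij_betw_nat_finite[OF finB] by (auto simp: d_def lessThan_atLeast0)
  have bM: "b i \<in> carr M" if "i < d" for i using b BM that by (auto simp: bij_betw_def)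
  define V where "V = {c :: nat \<Rightarrow> 'k. \<forall>i\<ge>d. c i = 0}"
  define \<phi> where "\<phi> c = (\<Sum>i<d. s (c i) (b i))" for c
  have \<phi>_in: "\<phi> c \<in> carr M" for c unfolding \<phi>_def by (intro sum_in s_in bM) auto
  have \<phi>_add: "\<phi> (c + c') = \<phi> c + \<phi> c'" for c c'
    unfolding \<phi>_def sum.distrib[symmetric] by (intro sum.cong) (auto simp: s_add bM)
  have \<phi>_0: "\<phi> 0 = 0" using \<phi>_add[of 0 0] by simp
  have \<phi>_neg: "\<phi> (- c) = - \<phi> c" for c
    using \<phi>_add[of c "- c"] \<phi>_0 by (simp add: eq_neg_iff_add_eq_0 add.commute)
  have \<phi>_ker: "c = 0" if "c \<in> V" "\<phi> c = 0" for c
  proof -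
    let ?e = "\<lambda>x. c (the_inv_into {..<d} b x)"
    have "(\<Sum>x\<in>B. s (?e x) x) = (\<Sum>i<d. s (?e (b i)) (b i))"
      by (rule sum.reindex_bij_betw[OF b, symmetric])
    also have "\<dots> = \<phi> c" unfolding \<phi>_def
      using b by (intro sum.cong) (auto simp: bij_betw_def the_inv_into_f_f)
    finally have "?e (b i) = 0" if "i < d" for i
      using indep[of ?e "b i"] \<open>\<phi> c = 0\<close> that b by (auto simp: bij_betw_def)
    then have "c i = 0" if "i < d" for i
      using that b by (auto simp: bij_betw_def the_inv_into_f_f)
    then show ?thesis using \<open>c \<in> V\<close> by (auto simp: V_def fun_eq_iff) (metis not_le)
  qed
  have \<phi>_surj: "\<exists>c\<in>V. \<phi> c = x" if "x \<in> carr M" for x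
  proof -
    obtain e where e: "x = (\<Sum>y\<in>B. s (e y) y)" using span \<open>x \<in> carr M\<close> by blast
    also have "\<dots> = (\<Sum>i<d. s (e (b i)) (b i))"
      by (rule sum.reindex_bij_betw[OF b, symmetric])
    also have "\<dots> = \<phi> (\<lambda>i. if i < d then e (b i) else 0)" by (simp add: \<phi>_def)
    finally show ?thesis
      by (intro bexI[of _ "\<lambda>i. if i < d then e (b i) else 0"]) (auto simp: V_def)
  qed
  have V0: "0 \<in> V" and Vadd: "\<And>c c'. c \<in> V \<Longrightarrow> c' \<in> V \<Longrightarrow> c + c' \<in> V"
    and Vneg: "\<And>c. c \<in> V \<Longrightarrow> - c \<in> V" by (auto simp: V_def)
  have \<phi>_inj: "c = c'" if "c \<in> V" "c' \<in> V" "\<phi> c = \<phi> c'" for c c'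
  proof -
    have "\<phi> (c + - c') = 0" using that(3) by (simp only: \<phi>_add \<phi>_neg) simp
    then have "c + - c' = 0" using that by (intro \<phi>_ker Vadd Vneg)
    then show ?thesis by simp
  qed
  define \<psi> where "\<psi> x = (if x \<in> carr M then THE c. c \<in> V \<and> \<phi> c = x else 0)" for x
  have \<psi>: "\<psi> x \<in> V \<and> \<phi> (\<psi> x) = x" if "x \<in> carr M" for x
  proof -
    have "\<exists>!c. c \<in> V \<and> \<phi> c = x" using \<phi>_surj[OF that] \<phi>_inj by blast
    from theI'[OF this] show ?thesis using that by (simp add: \<psi>_def)
  qed
  have \<psi>V: "\<psi> x \<in> V" and \<phi>\<psi>: "\<phi> (\<psi> x) = x" if "x \<in> carr M" for x using \<psi>[OF that] by auto
  have \<psi>\<phi>: "\<psi> (\<phi> c) = c" if "c \<in> V" for c using \<phi>_inj that \<psi>V \<phi>\<psi> \<phi>_in by blast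
  have \<psi>_add: "\<psi> (x + y) = \<psi> x + \<psi> y" if "x \<in> carr M" "y \<in> carr M" for x y
    by (rule \<phi>_inj) (use that in \<open>auto simp: \<psi>V Vadd Madd \<phi>\<psi> \<phi>_add\<close>)
  define N where "N = LModule V (\<lambda>a c. \<psi> (act M a (\<phi> c)))"
  have cN: "carr N = V" and aN: "act N a c = \<psi> (act M a (\<phi> c))" for a c by (auto simp: N_def)
  have N: "is_lmodule N"
    unfolding is_lmodule_def cN aN
    by (auto simp: V0 Vadd Vneg \<psi>V \<phi>_in Mact \<phi>_add act_add add_act \<psi>_add act_mult act_1 \<phi>\<psi> \<psi>\<phi>)
  have iso: "isomorphic M N"
    unfolding isomorphic_def
  proof (intro bexI conjI)
    show "\<psi> \<in> Hom M N"
      by (auto simp: Hom_def cN aN \<psi>V \<psi>_add \<phi>\<psi>) (simp add: \<psi>_def)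
    show "(\<lambda>c. if c \<in> V then \<phi> c else 0) \<in> Hom N M"
      by (auto simp: Hom_def cN aN \<phi>_in \<phi>_add Vadd \<psi>V \<phi>\<psi> Mact)
    show "(\<lambda>c. if c \<in> V then \<phi> c else 0) \<circ> \<psi> = id_hom M"
      using V0 \<phi>_0 by (auto simp: id_hom_def fun_eq_iff \<psi>V \<phi>\<psi>) (auto simp: \<psi>_def)
    have "\<psi> 0 = 0" using \<psi>_add[OF M0 M0] by simp
    then show "\<psi> \<circ> (\<lambda>c. if c \<in> V then \<phi> c else 0) = id_hom N"
      by (auto simp: id_hom_def fun_eq_iff cN \<psi>\<phi>)
  qed
  have \<psi>_inj: "inj_on \<psi> (carr M)" by (rule inj_on_inverseI[of _ \<phi>]) (rule \<phi>\<psi>)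
  have \<psi>_sum: "\<psi> (\<Sum>i\<in>I. f i) = (\<Sum>i\<in>I. \<psi> (f i))"
    if "\<And>i. i \<in> I \<Longrightarrow> f i \<in> carr M" for I :: "'v set" and f
  proof -
    have "\<psi> 0 = 0" using \<psi>_add[OF M0 M0] by simp
    then show ?thesis using that
      by (induction I rule: infinite_finite_induct) (auto simp: \<psi>_add sum_in)
  qed
  have "\<exists>c. x = (\<Sum>y\<in>\<psi> ` B. act N (sc (c y) 1) y)" if "x \<in> V" for x
  proof -
    obtain e where e: "\<phi> x = (\<Sum>y\<in>B. s (e y) y)" using span[OF \<phi>_in] by blast
    have "x = \<psi> (\<Sum>y\<in>B. s (e y) y)" using \<psi>\<phi>[OF that] e by simp
    also have "\<dots> = (\<Sum>y\<in>B. \<psi> (s (e y) y))" using BM by (intro \<psi>_sum s_in) auto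
    also have "\<dots> = (\<Sum>y\<in>B. act N (sc (e (\<phi> (\<psi> y))) 1) (\<psi> y))"
      using BM by (intro sum.cong) (auto simp: aN s_def \<phi>\<psi> subset_iff)
    also have "\<dots> = (\<Sum>y\<in>\<psi> ` B. act N (sc (e (\<phi> y)) 1) y)"
      by (subst sum.reindex) (auto intro: inj_on_subset[OF \<psi>_inj BM])
    finally show ?thesis by (intro exI[of _ "\<lambda>y. e (\<phi> y)"])
  qed
  then have "fd_module sc N"
    unfolding fd_module_def cN
    using N finB BM \<psi>V by (intro conjI exI[of _ "\<psi> ` B"]) auto
  with iso show ?thesis by blast
qed

definition mod_cat ::
  "('k::field \<Rightarrow> 'a::ring_1 \<Rightarrow> 'a) \<Rightarrow> ('a, 'v::ab_group_add) lmodule set" where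
  "mod_cat sc = {M. fd_module sc M}"

text \<open>
  \<open>Ext\<^sup>1\<close> in the sense of Yoneda: equivalence classes of short exact sequences
  \<open>0 \<rightarrow> N \<rightarrow> X \<rightarrow> M \<rightarrow> 0\<close>. Its zero element is the class of \<open>N \<oplus> M\<close>, which
  consists of the split sequences.
\<close>

definition extensions ::
  "('k::field \<Rightarrow> 'a::ring_1 \<Rightarrow> 'a) \<Rightarrow> ('a, 'v::ab_group_add) lmodule \<Rightarrow>
   ('a, 'w::ab_group_add) lmodule \<Rightarrow>
   (('a, 'k) std_module \<times> ('w \<Rightarrow> nat \<Rightarrow> 'k) \<times> ((nat \<Rightarrow> 'k) \<Rightarrow> 'v)) set" where
  "extensions sc M N = {(X, f, g).
     fd_module sc X \<and> f \<in> Hom N X \<and> g \<in> Hom X M \<and>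
     inj_on f (carr N) \<and> f ` carr N = {x \<in> carr X. g x = 0} \<and> g ` carr X = carr M}"

definition ext_equiv ::
  "('k::field \<Rightarrow> 'a::ring_1 \<Rightarrow> 'a) \<Rightarrow> ('a, 'v::ab_group_add) lmodule \<Rightarrow>
   ('a, 'w::ab_group_add) lmodule \<Rightarrow>
   (('a, 'k) std_module \<times> ('w \<Rightarrow> nat \<Rightarrow> 'k) \<times> ((nat \<Rightarrow> 'k) \<Rightarrow> 'v)) rel" where
  "ext_equiv sc M N = {((X, f, g), (X', f', g')).
     (X, f, g) \<in> extensions sc M N \<and> (X', f', g') \<in> extensions sc M N \<and>
     (\<exists>h\<in>Hom X X'. h \<circ> f = f' \<and> g' \<circ> h = g)}"

definition Ext ::
  "('k::field \<Rightarrow> 'a::ring_1 \<Rightarrow> 'a) \<Rightarrow> ('a, 'v::ab_group_add) lmodule \<Rightarrow>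
   ('a, 'w::ab_group_add) lmodule \<Rightarrow>
   (('a, 'k) std_module \<times> ('w \<Rightarrow> nat \<Rightarrow> 'k) \<times> ((nat \<Rightarrow> 'k) \<Rightarrow> 'v)) set set" where
  "Ext sc M N = extensions sc M N // ext_equiv sc M N"

definition Ext_zero ::
  "('k::field \<Rightarrow> 'a::ring_1 \<Rightarrow> 'a) \<Rightarrow> ('a, 'v::ab_group_add) lmodule \<Rightarrow>
   ('a, 'w::ab_group_add) lmodule \<Rightarrow>
   (('a, 'k) std_module \<times> ('w \<Rightarrow> nat \<Rightarrow> 'k) \<times> ((nat \<Rightarrow> 'k) \<Rightarrow> 'v)) set" where
  "Ext_zero sc M N = {(X, f, g) \<in> extensions sc M N. \<exists>s\<in>Hom M X. g \<circ> s = id_hom M}"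

text \<open>
  Projective and injective objects of a full subcategory \<open>\<A>\<close>, with epimorphisms and
  monomorphisms taken in \<open>\<A>\<close> itself. The object is not asked to live in the same type as the
  members of \<open>\<A>\<close>; membership in \<open>\<A>\<close> is stated separately.
\<close>

definition epi_in ::
  "('a::ring_1, 'v::ab_group_add) lmodule set \<Rightarrow> ('a, 'v) lmodule \<Rightarrow> ('a, 'v) lmodule \<Rightarrow>
   ('v \<Rightarrow> 'v) \<Rightarrow> bool" where
  "epi_in \<A> X Y g \<longleftrightarrow> g \<in> Hom X Y \<and>
     (\<forall>Z\<in>\<A>. \<forall>u\<in>Hom Y Z. \<forall>v\<in>Hom Y Z. u \<circ> g = v \<circ> g \<longrightarrow> u = v)"

definition mono_in ::
  "('a::ring_1, 'v::ab_group_add) lmodule set \<Rightarrow> ('a, 'v) lmodule \<Rightarrow> ('a, 'v) lmodule \<Rightarrow>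
   ('v \<Rightarrow> 'v) \<Rightarrow> bool" where
  "mono_in \<A> X Y g \<longleftrightarrow> g \<in> Hom X Y \<and>
     (\<forall>Z\<in>\<A>. \<forall>u\<in>Hom Z X. \<forall>v\<in>Hom Z X. g \<circ> u = g \<circ> v \<longrightarrow> u = v)"

definition projective_wrt ::
  "('a::ring_1, 'v::ab_group_add) lmodule set \<Rightarrow> ('a, 'w::ab_group_add) lmodule \<Rightarrow> bool" where
  "projective_wrt \<A> P \<longleftrightarrow>
     (\<forall>X\<in>\<A>. \<forall>Y\<in>\<A>. \<forall>g. epi_in \<A> X Y g \<longrightarrow> (\<forall>f\<in>Hom P Y. \<exists>h\<in>Hom P X. g \<circ> h = f))"

definition injective_wrt ::
  "('a::ring_1, 'v::ab_group_add) lmodule set \<Rightarrow> ('a, 'w::ab_group_add) lmodule \<Rightarrow> bool" where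
  "injective_wrt \<A> I \<longleftrightarrow>
     (\<forall>X\<in>\<A>. \<forall>Y\<in>\<A>. \<forall>g. mono_in \<A> X Y g \<longrightarrow> (\<forall>f\<in>Hom X I. \<exists>h\<in>Hom Y I. h \<circ> g = f))"

text \<open>
  Submodules of projective modules are projective. For finite dimensional algebras this may be
  tested on finite dimensional modules, and does not depend on the choice of left or right modules.
\<close>

definition hereditary :: "('k::field \<Rightarrow> 'a::ring_1 \<Rightarrow> 'a) \<Rightarrow> bool" where
  "hereditary sc \<longleftrightarrow>
     (\<forall>P\<in>(mod_cat sc :: ('a, 'k) std_module set). \<forall>U.
        projective_wrt (mod_cat sc :: ('a, 'k) std_module set) P \<longrightarrow> submodule U P \<longrightarrow>
        projective_wrt (mod_cat sc :: ('a, 'k) std_module set) (LModule U (act P)))"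

definition simple_module ::
  "('k::field \<Rightarrow> 'a::ring_1 \<Rightarrow> 'a) \<Rightarrow> ('a, 'v::ab_group_add) lmodule \<Rightarrow> bool" where
  "simple_module sc S \<longleftrightarrow> fd_module sc S \<and> carr S \<noteq> {0} \<and>
     (\<forall>U. submodule U S \<longrightarrow> U = {0} \<or> U = carr S)"

definition num_simples :: "('k::field \<Rightarrow> 'a::ring_1 \<Rightarrow> 'a) \<Rightarrow> nat" where
  "num_simples sc =
     card ({S :: ('a, 'k) std_module. simple_module sc S} //
           {(S, T). simple_module sc S \<and> simple_module sc T \<and> isomorphic S T})"

definition right_perp ::
  "('k::field \<Rightarrow> 'a::ring_1 \<Rightarrow> 'a) \<Rightarrow> ('a, 'v::ab_group_add) lmodule \<Rightarrow>
   ('a, 'w::ab_group_add) lmodule set" where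
  "right_perp sc M = {X \<in> mod_cat sc. Hom M X = {0} \<and> Ext sc M X = {Ext_zero sc M X}}"

definition left_perp ::
  "('k::field \<Rightarrow> 'a::ring_1 \<Rightarrow> 'a) \<Rightarrow> ('a, 'v::ab_group_add) lmodule \<Rightarrow>
   ('a, 'w::ab_group_add) lmodule set" where
  "left_perp sc M = {X \<in> mod_cat sc. Hom X M = {0} \<and> Ext sc X M = {Ext_zero sc X M}}"

text \<open>The direct sum of the \<open>E i\<close> over a finite index set \<open>I\<close>; it is the zero module if \<open>I\<close> is empty.\<close>

definition dsum ::
  "nat set \<Rightarrow> (nat \<Rightarrow> ('a::ring_1, 'v::ab_group_add) lmodule) \<Rightarrow> ('a, nat \<Rightarrow> 'v) lmodule" where
  "dsum I E = LModule {x. \<forall>i. if i \<in> I then x i \<in> carr (E i) else x i = 0}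
                      (\<lambda>a x i. if i \<in> I then act (E i) a (x i) else 0)"

definition end_division :: "('a::ring_1, 'v::ab_group_add) lmodule \<Rightarrow> bool" where
  "end_division M \<longleftrightarrow> Hom M M \<noteq> {0} \<and>
     (\<forall>f\<in>Hom M M. f \<noteq> 0 \<longrightarrow> (\<exists>g\<in>Hom M M. g \<circ> f = id_hom M \<and> f \<circ> g = id_hom M))"

definition exceptional ::
  "('k::field \<Rightarrow> 'a::ring_1 \<Rightarrow> 'a) \<Rightarrow> ('a, 'v::ab_group_add) lmodule \<Rightarrow> bool" where
  "exceptional sc M \<longleftrightarrow> fd_module sc M \<and> Ext sc M M = {Ext_zero sc M M} \<and> end_division M"

text \<open>Sequences \<open>(E 1, \<dots>, E r)\<close>; the values of \<open>E\<close> outside \<open>{1..r}\<close> are irrelevant.\<close>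

definition exceptional_seq ::
  "('k::field \<Rightarrow> 'a::ring_1 \<Rightarrow> 'a) \<Rightarrow> nat \<Rightarrow> (nat \<Rightarrow> ('a, 'v::ab_group_add) lmodule) \<Rightarrow> bool" where
  "exceptional_seq sc r E \<longleftrightarrow>
     (\<forall>i\<in>{1..r}. exceptional sc (E i)) \<and>
     (\<forall>i\<in>{1..r}. \<forall>j\<in>{1..r}. i < j \<longrightarrow> E i \<in> right_perp sc (E j))"

definition complete_exceptional_seq ::
  "('k::field \<Rightarrow> 'a::ring_1 \<Rightarrow> 'a) \<Rightarrow> nat \<Rightarrow> (nat \<Rightarrow> ('a, 'v::ab_group_add) lmodule) \<Rightarrow> bool" where
  "complete_exceptional_seq sc n E \<longleftrightarrow> exceptional_seq sc n E \<and> n = num_simples sc"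

definition A_cat ::
  "('k::field \<Rightarrow> 'a::ring_1 \<Rightarrow> 'a) \<Rightarrow> nat \<Rightarrow> (nat \<Rightarrow> ('a, 'v::ab_group_add) lmodule) \<Rightarrow> nat \<Rightarrow>
   ('a, 'w::ab_group_add) lmodule set" where
  "A_cat sc n E k = right_perp sc (dsum {k+1..n} E)"

definition B_cat ::
  "('k::field \<Rightarrow> 'a::ring_1 \<Rightarrow> 'a) \<Rightarrow> (nat \<Rightarrow> ('a, 'v::ab_group_add) lmodule) \<Rightarrow> nat \<Rightarrow>
   ('a, 'w::ab_group_add) lmodule set" where
  "B_cat sc E k = left_perp sc (dsum {1..<k} E)"

definition relatively_projective ::
  "('k::field \<Rightarrow> 'a::ring_1 \<Rightarrow> 'a) \<Rightarrow> nat \<Rightarrow> (nat \<Rightarrow> ('a, 'v::ab_group_add) lmodule) \<Rightarrow> nat \<Rightarrow> bool" where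
  "relatively_projective sc n E k \<longleftrightarrow>
     E k \<in> A_cat sc n E k \<and> projective_wrt (A_cat sc n E k :: ('a, 'k) std_module set) (E k)"

definition relatively_injective ::
  "('k::field \<Rightarrow> 'a::ring_1 \<Rightarrow> 'a) \<Rightarrow> (nat \<Rightarrow> ('a, 'v::ab_group_add) lmodule) \<Rightarrow> nat \<Rightarrow> bool" where
  "relatively_injective sc E k \<longleftrightarrow>
     E k \<in> B_cat sc E k \<and> injective_wrt (B_cat sc E k :: ('a, 'k) std_module set) (E k)"

end

theory Submission
  imports Defs
begin

text \<open>
  For modules \<open>M\<close> and \<open>N\<close> on coordinate spaces, the linear maps and the cocycles (derivations of
  the algebra with values in linear maps) form a complex \<open>Lin M N \<rightarrow> Coc M N\<close> with kernel \<open>Hom M N\<close>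
  and cokernel \<open>Ext M N\<close>. Linear maps are exact in both arguments, cocycles are left exact, and
  heredity makes them right exact as well (\<open>Coc_lift\<close>, \<open>Coc_extend\<close>). Hence there are six-term
  exact sequences in both arguments, and the Euler form \<open>dim (Lin M N) - dim (Coc M N)\<close> is
  additive on short exact sequences.

  Suppose that \<open>E k\<close> is not relatively projective: \<open>Ext (E k) X\<close> is nonzero for some \<open>X\<close> that is
  right perpendicular to \<open>E (k+1), \<dots>, E n\<close>. Factoring out images of homomorphisms from \<open>E k\<close> and
  then passing to non-split extensions of \<open>E k\<close> by the module as long as there are any leads to a
  module \<open>Z\<close> that is right perpendicular to \<open>E k, \<dots>, E n\<close> and has \<open>E k\<close> as a quotient
  (\<open>ex_perpendicular_cover\<close>). If \<open>Y\<close> is left perpendicular to \<open>E 1, \<dots>, E (k-1)\<close>, then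
  \<open>Ext Y Z = 0\<close> by \<open>perpendicular_halves\<close>, and \<open>Ext Y (E k) = 0\<close> because \<open>Ext Y\<close> is right exact.
  So \<open>E k\<close> is relatively injective.

  That completeness forces \<open>Hom Y Z = 0 = Ext Y Z\<close> for such \<open>Y\<close> and \<open>Z\<close> is shown by the same two
  reductions, now applied to \<open>Y\<close> and \<open>E n, \<dots>, E k\<close> in turn. They end with modules that are left
  perpendicular to \<open>E 1, \<dots>, E (k-1)\<close> and right perpendicular to \<open>E k, \<dots>, E n\<close>, and those are zero
  (\<open>perpendicular_zero\<close>): the \<open>n\<close> functions given by the Euler form with the \<open>E i\<close> vanish on such
  a module, and if it were nonzero they would be linearly independent together with the dimension;
  but additive functions are determined by their values on the \<open>n\<close> simple modules.
\<close>

section \<open>Finite dimensional linear algebra on subspaces\<close>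

text \<open>
  Linear maps between subspaces of vector spaces whose scalings \<open>s\<close> and \<open>t\<close> are given explicitly.
  Nothing is said about values off \<open>S\<close>, so that homomorphisms that are only linear on a carrier
  are covered.
\<close>

definition lin_map ::
  "('k::field \<Rightarrow> 'x::ab_group_add \<Rightarrow> 'x) \<Rightarrow> ('k \<Rightarrow> 'y::ab_group_add \<Rightarrow> 'y) \<Rightarrow> 'x set \<Rightarrow> 'y set \<Rightarrow>
   ('x \<Rightarrow> 'y) \<Rightarrow> bool" where
  "lin_map s t S T f \<longleftrightarrow> module.subspace s S \<and> module.subspace t T \<and> (\<forall>x\<in>S. f x \<in> T) \<and>
     (\<forall>x\<in>S. \<forall>y\<in>S. f (x + y) = f x + f y) \<and> (\<forall>c. \<forall>x\<in>S. f (s c x) = t c (f x))"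

text \<open>
  \<open>S\<close> lies in the span of a finite set, which need not be contained in \<open>S\<close>.
\<close>

definition finspan :: "('k::field \<Rightarrow> 'x::ab_group_add \<Rightarrow> 'x) \<Rightarrow> 'x set \<Rightarrow> bool" where
  "finspan s S \<longleftrightarrow> (\<exists>B. finite B \<and> S \<subseteq> module.span s B)"

text \<open>
  Short exact sequences \<open>0 \<rightarrow> S1 \<rightarrow> S2 \<rightarrow> S3 \<rightarrow> 0\<close> of subspaces of one vector space.
\<close>

definition short_exact ::
  "('k::field \<Rightarrow> 'x::ab_group_add \<Rightarrow> 'x) \<Rightarrow> 'x set \<Rightarrow> 'x set \<Rightarrow> 'x set \<Rightarrow> ('x \<Rightarrow> 'x) \<Rightarrow> ('x \<Rightarrow> 'x) \<Rightarrow> bool"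
  where
  "short_exact s S1 S2 S3 f g \<longleftrightarrow> lin_map s s S1 S2 f \<and> lin_map s s S2 S3 g \<and>
     (\<forall>x\<in>S1. f x = 0 \<longrightarrow> x = 0) \<and> (\<forall>x\<in>S1. g (f x) = 0) \<and>
     (\<forall>y\<in>S2. g y = 0 \<longrightarrow> (\<exists>x\<in>S1. f x = y)) \<and> (\<forall>z\<in>S3. \<exists>y\<in>S2. g y = z)"

lemma subspace_closed:
  assumes "vector_space s" "module.subspace s S"
  shows "0 \<in> S" "x \<in> S \<Longrightarrow> y \<in> S \<Longrightarrow> x + y \<in> S" "x \<in> S \<Longrightarrow> y \<in> S \<Longrightarrow> x - y \<in> S"
    "x \<in> S \<Longrightarrow> - x \<in> S" "x \<in> S \<Longrightarrow> s c x \<in> S"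
proof -
  interpret vector_space s by fact
  show "0 \<in> S" "x \<in> S \<Longrightarrow> y \<in> S \<Longrightarrow> x + y \<in> S" "x \<in> S \<Longrightarrow> y \<in> S \<Longrightarrow> x - y \<in> S"
    "x \<in> S \<Longrightarrow> - x \<in> S" "x \<in> S \<Longrightarrow> s c x \<in> S"
    using assms(2) by (auto simp: subspace_0 subspace_add subspace_diff subspace_neg subspace_scale)
qed

lemma lin_map_diff:
  assumes "vector_space s" "lin_map s t S T f"
  shows "f 0 = 0" "x \<in> S \<Longrightarrow> y \<in> S \<Longrightarrow> f (x - y) = f x - f y" "x \<in> S \<Longrightarrow> f (- x) = - f x"
proof -
  have S: "module.subspace s S" using assms(2) by (simp add: lin_map_def)
  note cl = subspace_closed[OF assms(1) S]
  have add: "\<And>x y. x \<in> S \<Longrightarrow> y \<in> S \<Longrightarrow> f (x + y) = f x + f y"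
    using assms(2) by (simp add: lin_map_def)
  show "f 0 = 0" using add[OF cl(1) cl(1)] by simp
  show "f (x - y) = f x - f y" if "x \<in> S" "y \<in> S" for x y
    using add[OF cl(3)[OF that] that(2)] by simp
  from this[of 0 x] show "x \<in> S \<Longrightarrow> f (- x) = - f x" using cl(1) \<open>f 0 = 0\<close> by simp
qed

lemma lin_map_extend:
  assumes "vector_space s" "vector_space t" "lin_map s t S T f"
  shows "\<exists>F. Vector_Spaces.linear s t F \<and> (\<forall>x\<in>S. F x = f x)"
proof -
  interpret vector_space_pair s t using assms by (simp add: vector_space_pair_def)
  have S: "vs1.subspace S" using assms(3) by (simp add: lin_map_def)
  obtain B where B: "B \<subseteq> S" "vs1.independent B" "S \<subseteq> vs1.span B"
    using vs1.maximal_independent_subset by blast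
  obtain F where F: "Vector_Spaces.linear s t F" "\<forall>x\<in>B. F x = f x"
    using linear_independent_extend[OF B(2)] by blast
  interpret F: Vector_Spaces.linear s t F by fact
  have "x \<in> S \<and> F x = f x" if "x \<in> vs1.span B" for x
    using that
  proof (induction rule: vs1.span_induct_alt)
    case base
    show ?case
      using lin_map_diff(1)[OF assms(1,3)] vs1.subspace_0[OF S] F.zero by simp
  next
    case (step c x y)
    have x: "x \<in> S" using step B by auto
    have "f (s c x + y) = t c (f x) + f y"
      using assms(3) x step vs1.subspace_scale[OF S x] by (simp add: lin_map_def)
    then show ?case
      using x step F vs1.subspace_scale[OF S x] by (simp add: F.add F.scale vs1.subspace_add[OF S])
  qed
  then show ?thesis using F(1) B(3) by blast
qed

lemma lin_map_right_inverse:
  assumes "vector_space s" "vector_space t" "lin_map s t S T f" "\<forall>z\<in>T. \<exists>y\<in>S. f y = z"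
  shows "\<exists>g. lin_map t s T S g \<and> (\<forall>z\<in>T. f (g z) = z)"
proof -
  interpret vector_space_pair s t using assms by (simp add: vector_space_pair_def)
  obtain F where F: "Vector_Spaces.linear s t F" "\<forall>x\<in>S. F x = f x"
    using lin_map_extend[OF assms(1-3)] by blast
  have S: "vs1.subspace S" using assms(3) by (simp add: lin_map_def)
  have im: "F ` S = T" using assms(3,4) F by (force simp: lin_map_def)
  obtain g where g: "range g \<subseteq> S" "Vector_Spaces.linear t s g" "\<forall>v\<in>T. F (g v) = v"
    using linear_exists_right_inverse_on[OF F(1) S] im by auto
  interpret g: Vector_Spaces.linear t s g by fact
  show ?thesis
    using g F(2) assms(3) by (intro exI[of _ g]) (auto simp: lin_map_def g.add g.scale
      image_subset_iff)
qed

lemma lin_map_left_inverse: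
  assumes "vector_space s" "vector_space t" "lin_map s t S T f" "\<forall>x\<in>S. f x = 0 \<longrightarrow> x = 0"
  shows "\<exists>g. lin_map t s T S g \<and> (\<forall>x\<in>S. g (f x) = x)"
proof -
  interpret vector_space_pair s t using assms by (simp add: vector_space_pair_def)
  obtain F where F: "Vector_Spaces.linear s t F" "\<forall>x\<in>S. F x = f x"
    using lin_map_extend[OF assms(1-3)] by blast
  interpret F: Vector_Spaces.linear s t F by fact
  have S: "vs1.subspace S" using assms(3) by (simp add: lin_map_def)
  have "inj_on F S"
  proof (rule inj_onI)
    fix x y assume *: "x \<in> S" "y \<in> S" "F x = F y"
    then have "f (x - y) = 0" using F lin_map_diff(2)[OF assms(1,3)] by simp
    then show "x = y" using assms(4) vs1.subspace_diff[OF S] * by fastforce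
  qed
  then obtain g where g: "range g \<subseteq> S" "Vector_Spaces.linear t s g" "\<forall>v\<in>S. g (F v) = v"
    using linear_exists_left_inverse_on[OF F(1) S] by blast
  interpret g: Vector_Spaces.linear t s g by fact
  show ?thesis
    using g F(2) assms(3) by (intro exI[of _ g]) (auto simp: lin_map_def g.add g.scale)
qed

lemma finspan_subset: "finspan s T \<Longrightarrow> S \<subseteq> T \<Longrightarrow> finspan s S"
  unfolding finspan_def by blast

lemma lin_map_kernel_subspace:
  assumes "vector_space s" "vector_space t" "lin_map s t S T f"
  shows "module.subspace s {x\<in>S. f x = 0}"
proof -
  interpret vector_space_pair s t using assms by (simp add: vector_space_pair_def)
  have S: "vs1.subspace S" using assms(3) by (simp add: lin_map_def)
  show ?thesis
    using S assms(3) lin_map_diff(1)[OF assms(1,3)] unfolding vs1.subspace_def lin_map_def by auto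
qed

lemma lin_map_image_subspace:
  assumes "vector_space s" "vector_space t" "lin_map s t S T f"
  shows "module.subspace t (f ` S)"
proof -
  interpret vector_space_pair s t using assms by (simp add: vector_space_pair_def)
  have S: "vs1.subspace S" using assms(3) by (simp add: lin_map_def)
  have add: "f x + f y = f (x + y)" if "x \<in> S" "y \<in> S" for x y
    using that assms(3) by (simp add: lin_map_def)
  have sc: "t c (f x) = f (s c x)" if "x \<in> S" for c x
    using that assms(3) by (simp add: lin_map_def)
  have "0 \<in> f ` S" using lin_map_diff(1)[OF assms(1,3)] vs1.subspace_0[OF S] by force
  then show ?thesis
    using vs1.subspace_add[OF S] vs1.subspace_scale[OF S]
    unfolding vs2.subspace_def by (auto simp: add sc)
qed

text \<open>
  Rank and nullity. The ambient vector spaces may be infinite dimensional.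
\<close>

lemma lin_map_finspan_dim:
  assumes "vector_space s" "vector_space t" "lin_map s t S T f"
  shows "finspan t (f ` S) \<Longrightarrow> finspan s {x\<in>S. f x = 0} \<Longrightarrow> finspan s S"
    and "finspan s S \<Longrightarrow> finspan t (f ` S)"
    and "finspan s S \<Longrightarrow>
      vector_space.dim s S = vector_space.dim s {x\<in>S. f x = 0} + vector_space.dim t (f ` S)"
proof -
  interpret vector_space_pair s t using assms by (simp add: vector_space_pair_def)
  have S: "vs1.subspace S" using assms(3) by (simp add: lin_map_def)
  obtain F where F: "Vector_Spaces.linear s t F" "\<forall>x\<in>S. F x = f x"
    using lin_map_extend[OF assms(1-3)] by blast
  interpret F: Vector_Spaces.linear s t F by fact
  have im: "f ` S = F ` S" using F by auto
  let ?K = "{x\<in>S. f x = 0}"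
  have K: "vs1.subspace ?K" by (rule lin_map_kernel_subspace[OF assms])
  \<comment> \<open>extend a basis of the kernel; the added vectors map to a basis of the image\<close>
  obtain B1 where B1: "B1 \<subseteq> ?K" "vs1.independent B1" "?K \<subseteq> vs1.span B1"
    using vs1.maximal_independent_subset by blast
  have B1S: "B1 \<subseteq> S" using B1 by auto
  obtain B where B: "B1 \<subseteq> B" "B \<subseteq> S" "vs1.independent B" "S \<subseteq> vs1.span B"
    using vs1.maximal_independent_subset_extend[OF B1S B1(2)] by blast
  let ?C = "B - B1"
  have spS: "vs1.span B = S" using B S vs1.span_minimal by blast
  have spK: "vs1.span B1 = ?K" using B1 K vs1.span_minimal by blast
  have indC: "vs1.independent ?C" using B(3) vs1.independent_mono by blast
  have inj: "inj_on F (vs1.span ?C)"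
  proof (rule F.inj_on_iff_eq_0[OF vs1.subspace_span, THEN iffD2], intro ballI impI)
    fix x assume x: "x \<in> vs1.span ?C" "F x = 0"
    have "x \<in> S" using x(1) spS vs1.span_mono[of ?C B] by auto
    then have "x \<in> vs1.span B1" using spK F x by auto
    then have "vs1.representation B x b = 0" for b
      using vs1.representation_extend[OF B(3)] x(1) B(1) vs1.representation_ne_zero
      by (metis Diff_iff Diff_subset)
    then show "x = 0"
      using vs1.sum_nonzero_representation_eq[OF B(3), of x] \<open>x \<in> S\<close> spS by simp
  qed
  have indFC: "vs2.independent (F ` ?C)" using F.independent_injective_image[OF indC inj] .
  have injC: "inj_on F ?C" using inj inj_on_subset vs1.span_superset by blast
  have spF: "f ` S \<subseteq> vs2.span (F ` ?C)"
  proof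
    fix z assume "z \<in> f ` S"
    then have "z \<in> F ` vs1.span B" using im spS by simp
    then have "z \<in> vs2.span (F ` B)" by (simp add: F.span_image)
    moreover have "F ` B \<subseteq> insert 0 (F ` ?C)" using B1 B F by auto
    ultimately show "z \<in> vs2.span (F ` ?C)"
      by (metis vs2.span_insert_0 vs2.span_mono subsetD)
  qed
  show "finspan s S" if "finspan t (f ` S)" "finspan s ?K"
  proof -
    have "finite B1" using that(2) B1 vs1.independent_span_bound unfolding finspan_def
      by (meson order_trans)
    moreover have "F ` ?C \<subseteq> f ` S" using im B by auto
    then have "finite (F ` ?C)"
      using that(1) indFC vs2.independent_span_bound unfolding finspan_def by (meson order_trans)
    then have "finite ?C" using injC finite_imageD by blast
    ultimately have "finite B" by (metis B(1) finite_Diff2)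
    then show ?thesis using B unfolding finspan_def by blast
  qed
  show "finspan t (f ` S)" "vs1.dim S = vs1.dim ?K + vs2.dim (f ` S)" if "finspan s S"
  proof -
    have fin: "finite B" using that B(2,3) vs1.independent_span_bound unfolding finspan_def
      by (meson order_trans)
    then show "finspan t (f ` S)"
      unfolding finspan_def by (intro exI[of _ "F ` ?C"] conjI finite_imageI finite_Diff spF)
    have "vs2.dim (f ` S) = card (F ` ?C)"
      using spF indFC B im by (intro vs2.dim_unique) auto
    also have "\<dots> = card ?C" using injC by (rule card_image)
    finally have "vs2.dim (f ` S) = card ?C" .
    moreover have "vs1.dim ?K = card B1" "vs1.dim S = card B"
      using B B1 by (auto intro: vs1.dim_unique)
    moreover have "card B = card B1 + card ?C"
      using fin B(1) by (simp add: card_Diff_subset finite_subset card_mono)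
    ultimately show "vs1.dim S = vs1.dim ?K + vs2.dim (f ` S)" by simp
  qed
qed

lemma dim_zero: "vector_space s \<Longrightarrow> vector_space.dim s {0} = 0"
  by (metis card.empty vector_space.dim_le_card finite.emptyI le_zero_eq module.span_empty
    order_refl
      module_iff_vector_space)

lemma dim_pos:
  assumes "vector_space s" "finspan s S" "x \<in> S" "x \<noteq> 0"
  shows "vector_space.dim s S > 0"
proof -
  interpret vector_space s by fact
  obtain B where B: "B \<subseteq> S" "independent B" "S \<subseteq> span B" "card B = dim S"
    using basis_exists by blast
  have "finite B" using assms(2) B independent_span_bound unfolding finspan_def
    by (meson order_trans)
  moreover have "B \<noteq> {}" using B assms by auto
  ultimately show ?thesis using B(4) by (metis card_gt_0_iff)
qed

lemma dim_mono_finspan: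
  assumes "vector_space s" "finspan s T" "S \<subseteq> T"
  shows "vector_space.dim s S \<le> vector_space.dim s T"
proof -
  interpret vector_space s by fact
  obtain B where B: "B \<subseteq> T" "independent B" "T \<subseteq> span B" "card B = dim T"
    using basis_exists by blast
  have "finite B" using assms(2) B independent_span_bound unfolding finspan_def
    by (meson order_trans)
  then show ?thesis using dim_le_card[of S B] B assms by auto
qed

lemma dim_short_exact:
  assumes "vector_space s" "finspan s S2" "short_exact s S1 S2 S3 f g"
  shows "vector_space.dim s S2 = vector_space.dim s S1 + vector_space.dim s S3"
proof -
  have f: "lin_map s s S1 S2 f" and g: "lin_map s s S2 S3 g" using assms
    by (auto simp: short_exact_def)
  have im: "f ` S1 = {y\<in>S2. g y = 0}" "g ` S2 = S3"
    using assms(3) by (force simp: short_exact_def lin_map_def)+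
  have "0 \<in> S1" using subspace_closed(1)[OF assms(1)] f by (simp add: lin_map_def)
  then have ker: "{x\<in>S1. f x = 0} = {0}"
    using assms(3) lin_map_diff(1)[OF assms(1) f] by (auto simp: short_exact_def)
  have "f ` S1 \<subseteq> S2" using f by (auto simp: lin_map_def)
  then have "finspan s (f ` S1)" using assms(2) finspan_subset by blast
  moreover have "finspan s {0}" unfolding finspan_def
    using module.span_empty[of s] assms(1) by (metis finite.emptyI module_iff_vector_space
      order_refl)
  ultimately have "finspan s S1"
    using lin_map_finspan_dim(1)[OF assms(1,1) f] ker by simp
  from lin_map_finspan_dim(3)[OF assms(1,1) f this]
    lin_map_finspan_dim(3)[OF assms(1,1) g assms(2)]
  show ?thesis using im ker dim_zero[OF assms(1)] by simp
qed

text \<open>Pointwise scaling of functions with values in a vector space.\<close>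

definition fsc :: "('k \<Rightarrow> 'y \<Rightarrow> 'y) \<Rightarrow> 'k \<Rightarrow> ('x \<Rightarrow> 'y) \<Rightarrow> 'x \<Rightarrow> 'y" where
  "fsc s c f = (\<lambda>x. s c (f x))"

lemma fsc_apply [simp]: "fsc s c f x = s c (f x)"
  by (simp add: fsc_def)

lemma vector_space_fsc:
  assumes "vector_space s"
  shows "vector_space (fsc s :: 'k::field \<Rightarrow> ('x \<Rightarrow> 'y::ab_group_add) \<Rightarrow> 'x \<Rightarrow> 'y)"
proof -
  interpret vector_space s by fact
  show ?thesis by unfold_locales (auto simp: fun_eq_iff scale_right_distrib scale_left_distrib)
qed

text \<open>
  A space of functions with values in a finite dimensional space is finite dimensional if its
  members are determined by their values at finitely many points.
\<close>

lemma finspan_evaluation: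
  fixes s :: "'k::field \<Rightarrow> 'y::ab_group_add \<Rightarrow> 'y" and V :: "('x \<Rightarrow> 'y) set"
  assumes s: "vector_space s" and "finite P" and W: "finspan s W" and V: "module.subspace (fsc s) V"
    and "\<forall>f\<in>V. \<forall>x. f x \<in> W" and "\<forall>f\<in>V. (\<forall>x\<in>P. f x = 0) \<longrightarrow> f = 0"
  shows "finspan (fsc s) V"
  using assms(2) V assms(5,6)
proof (induction P arbitrary: V rule: finite_induct)
  case empty
  note t = vector_space_fsc[OF s, where 'x='x]
  from empty have "V \<subseteq> {0}" by blast
  then show ?case unfolding finspan_def
    using module.span_empty[of "fsc s :: 'k \<Rightarrow> ('x \<Rightarrow> 'y) \<Rightarrow> 'x \<Rightarrow> 'y"] t
    by (metis finite.emptyI module_iff_vector_space)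
next
  case (insert p P)
  note t = vector_space_fsc[OF s, where 'x='x]
  interpret s: vector_space s by fact
  have lin: "lin_map (fsc s) s V UNIV (\<lambda>f. f p)"
    unfolding lin_map_def by (intro conjI insert.prems(1) s.subspace_UNIV) simp_all
  have "finspan (fsc s) {f\<in>V. f p = 0}"
    by (rule insert.IH[OF lin_map_kernel_subspace[OF t s lin]]) (use insert.prems in auto)
  moreover have "finspan s ((\<lambda>f. f p) ` V)"
    using W by (rule finspan_subset) (use insert.prems in auto)
  ultimately show ?case by (intro lin_map_finspan_dim(1)[OF t s lin])
qed

section \<open>Short exact sequences of two-term complexes\<close>

text \<open>
  Vanishing of the kernel and of the cokernel of a map \<open>\<delta> : S \<rightarrow> T\<close>.
\<close>

definition ker0 :: "'x::zero set \<Rightarrow> ('x \<Rightarrow> 'y::zero) \<Rightarrow> bool" where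
  "ker0 S \<delta> \<longleftrightarrow> (\<forall>x\<in>S. \<delta> x = 0 \<longrightarrow> x = 0)"

definition coker0 :: "'x set \<Rightarrow> 'y set \<Rightarrow> ('x \<Rightarrow> 'y) \<Rightarrow> bool" where
  "coker0 S T \<delta> \<longleftrightarrow> (\<forall>z\<in>T. \<exists>x\<in>S. \<delta> x = z)"

text \<open>
  A short exact sequence of two-term complexes \<open>\<delta>j : Lj \<rightarrow> Zj\<close>. The lemmas below are the
  consequences of the six-term exact sequence of kernels and cokernels that concern their
  vanishing. In \<open>ker0_j\<close> and \<open>coker0_j\<close> the kernel and the cokernel of \<open>\<delta>j\<close> vanish because its
  neighbours do.
\<close>

locale two_term_ses =
  fixes s :: "'k::field \<Rightarrow> 'x::ab_group_add \<Rightarrow> 'x" and t :: "'k \<Rightarrow> 'y::ab_group_add \<Rightarrow> 'y"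
    and L1 L2 L3 Z1 Z2 Z3 f g f' g' \<delta>1 \<delta>2 \<delta>3
  assumes s: "vector_space s" and t: "vector_space t"
    and L: "short_exact s L1 L2 L3 f g" and Z: "short_exact t Z1 Z2 Z3 f' g'"
    and d1: "lin_map s t L1 Z1 \<delta>1" and d2: "lin_map s t L2 Z2 \<delta>2" and d3: "lin_map s t L3 Z3 \<delta>3"
    and comm1: "\<And>x. x \<in> L1 \<Longrightarrow> \<delta>2 (f x) = f' (\<delta>1 x)"
    and comm2: "\<And>x. x \<in> L2 \<Longrightarrow> \<delta>3 (g x) = g' (\<delta>2 x)"
begin

lemma maps:
  "lin_map s s L1 L2 f" "lin_map s s L2 L3 g" "lin_map t t Z1 Z2 f'" "lin_map t t Z2 Z3 g'"
  using L Z by (auto simp: short_exact_def)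

lemma in_sets:
  "x \<in> L1 \<Longrightarrow> f x \<in> L2" "x \<in> L2 \<Longrightarrow> g x \<in> L3" "z \<in> Z1 \<Longrightarrow> f' z \<in> Z2" "z \<in> Z2 \<Longrightarrow> g' z \<in> Z3"
  "x \<in> L1 \<Longrightarrow> \<delta>1 x \<in> Z1" "x \<in> L2 \<Longrightarrow> \<delta>2 x \<in> Z2" "x \<in> L3 \<Longrightarrow> \<delta>3 x \<in> Z3"
  using maps d1 d2 d3 by (auto simp: lin_map_def)

lemmas zeros = lin_map_diff(1)[OF s maps(1)] lin_map_diff(1)[OF s maps(2)]
  lin_map_diff(1)[OF t maps(3)] lin_map_diff(1)[OF t maps(4)]
  lin_map_diff(1)[OF s d1] lin_map_diff(1)[OF s d2] lin_map_diff(1)[OF s d3]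

lemmas diffs = lin_map_diff(2)[OF s maps(1)] lin_map_diff(2)[OF s maps(2)]
  lin_map_diff(2)[OF t maps(3)] lin_map_diff(2)[OF t maps(4)]
  lin_map_diff(2)[OF s d1] lin_map_diff(2)[OF s d2] lin_map_diff(2)[OF s d3]

lemma adds:
  "x \<in> L2 \<Longrightarrow> y \<in> L2 \<Longrightarrow> \<delta>2 (x + y) = \<delta>2 x + \<delta>2 y"
  using d2 by (auto simp: lin_map_def)

lemma closed:
  "x \<in> L1 \<Longrightarrow> y \<in> L1 \<Longrightarrow> x - y \<in> L1" "x \<in> L2 \<Longrightarrow> y \<in> L2 \<Longrightarrow> x - y \<in> L2"
  "x \<in> L2 \<Longrightarrow> y \<in> L2 \<Longrightarrow> x + y \<in> L2" "z \<in> Z1 \<Longrightarrow> w \<in> Z1 \<Longrightarrow> z - w \<in> Z1" "z \<in> Z2 \<Longrightarrow> w \<in> Z2 \<Longrightarrow> z - w \<in> Z2"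
  using maps subspace_closed[OF s] subspace_closed[OF t] by (auto simp: lin_map_def)

lemma exact:
  "x \<in> L1 \<Longrightarrow> f x = 0 \<Longrightarrow> x = 0" "x \<in> L1 \<Longrightarrow> g (f x) = 0"
  "y \<in> L2 \<Longrightarrow> g y = 0 \<Longrightarrow> \<exists>x\<in>L1. f x = y" "v \<in> L3 \<Longrightarrow> \<exists>y\<in>L2. g y = v"
  "z \<in> Z1 \<Longrightarrow> f' z = 0 \<Longrightarrow> z = 0" "z \<in> Z1 \<Longrightarrow> g' (f' z) = 0"
  "w \<in> Z2 \<Longrightarrow> g' w = 0 \<Longrightarrow> \<exists>z\<in>Z1. f' z = w" "u \<in> Z3 \<Longrightarrow> \<exists>w\<in>Z2. g' w = u"
  using L Z by (auto simp: short_exact_def)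

lemma ker0_1: "ker0 L2 \<delta>2 \<Longrightarrow> ker0 L1 \<delta>1"
  unfolding ker0_def using comm1 zeros exact(1) in_sets(1) by metis

lemma ker0_2:
  assumes "ker0 L1 \<delta>1" "ker0 L3 \<delta>3"
  shows "ker0 L2 \<delta>2"
  unfolding ker0_def
proof (intro ballI impI)
  fix y assume y: "y \<in> L2" "\<delta>2 y = 0"
  then have "g y = 0" using assms(2) comm2 zeros in_sets unfolding ker0_def by metis
  then obtain x where x: "x \<in> L1" "f x = y" using exact(3) y by blast
  then have "\<delta>1 x = 0" using comm1[of x] y exact(5) in_sets by auto
  then show "y = 0" using assms(1) x zeros unfolding ker0_def by metis
qed

lemma ker_lift:
  assumes "coker0 L1 Z1 \<delta>1" "v \<in> L3" "\<delta>3 v = 0"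
  shows "\<exists>y\<in>L2. \<delta>2 y = 0 \<and> g y = v"
proof -
  obtain y where y: "y \<in> L2" "g y = v" using exact(4) assms by blast
  then have "g' (\<delta>2 y) = 0" using comm2[of y] assms by simp
  then obtain z where z: "z \<in> Z1" "f' z = \<delta>2 y" using exact(7) in_sets(6) y by blast
  then obtain x where x: "x \<in> L1" "\<delta>1 x = z" using assms(1) unfolding coker0_def by blast
  then have "\<delta>2 (y - f x) = 0" using y z comm1[of x] diffs(6) in_sets(1) by simp
  moreover have "g (y - f x) = v" using y x diffs(2) in_sets(1) exact(2) by simp
  ultimately show ?thesis using closed(2) y x in_sets(1) by blast
qed

lemma ker0_3: "ker0 L2 \<delta>2 \<Longrightarrow> coker0 L1 Z1 \<delta>1 \<Longrightarrow> ker0 L3 \<delta>3"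
  using ker_lift zeros(2) unfolding ker0_def by metis

lemma coker0_1:
  assumes "ker0 L3 \<delta>3" "coker0 L2 Z2 \<delta>2"
  shows "coker0 L1 Z1 \<delta>1"
  unfolding coker0_def
proof
  fix z assume z: "z \<in> Z1"
  obtain y where y: "y \<in> L2" "\<delta>2 y = f' z" using assms(2) z in_sets(3) unfolding coker0_def by blast
  then have "\<delta>3 (g y) = 0" using comm2 exact(6) z by simp
  then have "g y = 0" using assms(1) y in_sets(2) unfolding ker0_def by blast
  then obtain x where x: "x \<in> L1" "f x = y" using exact(3) y by blast
  then have "f' (\<delta>1 x - z) = 0" using comm1[of x] y diffs(3) in_sets(5) z by simp
  then have "\<delta>1 x = z" using exact(5)[OF closed(4)] x z in_sets(5) by force
  then show "\<exists>x\<in>L1. \<delta>1 x = z" using x by blast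
qed

lemma coker0_2:
  assumes "coker0 L1 Z1 \<delta>1" "coker0 L3 Z3 \<delta>3"
  shows "coker0 L2 Z2 \<delta>2"
  unfolding coker0_def
proof
  fix w assume w: "w \<in> Z2"
  obtain v where v: "v \<in> L3" "\<delta>3 v = g' w" using assms(2) w in_sets(4) unfolding coker0_def by blast
  then obtain y where y: "y \<in> L2" "g y = v" using exact(4) by blast
  then have "g' (w - \<delta>2 y) = 0" using comm2[of y] v diffs(4) w in_sets(6) by simp
  then obtain z where z: "z \<in> Z1" "f' z = w - \<delta>2 y" using exact(7) closed(5) w y in_sets(6) by blast
  obtain x where x: "x \<in> L1" "\<delta>1 x = z" using assms(1) z unfolding coker0_def by blast
  then have "\<delta>2 (f x + y) = w" using z y comm1 adds in_sets(1) by simp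
  then show "\<exists>y\<in>L2. \<delta>2 y = w" using closed(3) x y in_sets(1) by blast
qed

lemma coker0_3: "coker0 L2 Z2 \<delta>2 \<Longrightarrow> coker0 L3 Z3 \<delta>3"
  unfolding coker0_def using exact(8) comm2 in_sets(2) by metis

lemma euler_additive:
  assumes "finspan s L2" "finspan t Z2"
  shows "int (vector_space.dim s L2) - int (vector_space.dim t Z2) =
    (int (vector_space.dim s L1) - int (vector_space.dim t Z1)) +
    (int (vector_space.dim s L3) - int (vector_space.dim t Z3))"
  using dim_short_exact[OF s assms(1) L] dim_short_exact[OF t assms(2) Z] by simp

end

section \<open>Modules on coordinate spaces\<close>

text \<open>
  Coordinate vectors are functions on the natural numbers, scaled pointwise.
\<close>

definition ksc :: "'k::field \<Rightarrow> (nat \<Rightarrow> 'k) \<Rightarrow> nat \<Rightarrow> 'k" where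
  "ksc c x = (\<lambda>i. c * x i)"

interpretation kv: vector_space "ksc :: 'k::field \<Rightarrow> (nat \<Rightarrow> 'k) \<Rightarrow> nat \<Rightarrow> 'k"
  by unfold_locales (auto simp: ksc_def fun_eq_iff algebra_simps)

interpretation kv1: vector_space "fsc ksc :: 'k::field \<Rightarrow> ('x \<Rightarrow> nat \<Rightarrow> 'k) \<Rightarrow> 'x \<Rightarrow> nat \<Rightarrow> 'k"
  by (rule vector_space_fsc) (rule kv.vector_space_axioms)

interpretation kv2: vector_space
  "fsc (fsc ksc) :: 'k::field \<Rightarrow> ('a \<Rightarrow> 'x \<Rightarrow> nat \<Rightarrow> 'k) \<Rightarrow> 'a \<Rightarrow> 'x \<Rightarrow> nat \<Rightarrow> 'k"
  by (rule vector_space_fsc) (rule kv1.vector_space_axioms)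

lemmas vs = kv.vector_space_axioms kv1.vector_space_axioms kv2.vector_space_axioms

lemma HomD:
  assumes "f \<in> Hom M N"
  shows "x \<in> carr M \<Longrightarrow> f x \<in> carr N" "x \<notin> carr M \<Longrightarrow> f x = 0"
    "x \<in> carr M \<Longrightarrow> y \<in> carr M \<Longrightarrow> f (x + y) = f x + f y"
    "x \<in> carr M \<Longrightarrow> f (act M a x) = act N a (f x)"
  using assms by (auto simp: Hom_def)

lemma is_lmoduleD:
  assumes "is_lmodule M"
  shows "0 \<in> carr M" "x \<in> carr M \<Longrightarrow> y \<in> carr M \<Longrightarrow> x + y \<in> carr M" "x \<in> carr M \<Longrightarrow> - x \<in> carr M"
    "x \<in> carr M \<Longrightarrow> y \<in> carr M \<Longrightarrow> x - y \<in> carr M"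
    "x \<in> carr M \<Longrightarrow> act M a x \<in> carr M"
    "x \<in> carr M \<Longrightarrow> y \<in> carr M \<Longrightarrow> act M a (x + y) = act M a x + act M a y"
    "x \<in> carr M \<Longrightarrow> act M (a + b) x = act M a x + act M b x"
    "x \<in> carr M \<Longrightarrow> act M (a * b) x = act M a (act M b x)"
    "x \<in> carr M \<Longrightarrow> act M 1 x = x"
    "act M a 0 = 0" "x \<in> carr M \<Longrightarrow> act M a (- x) = - act M a x"
    "x \<in> carr M \<Longrightarrow> y \<in> carr M \<Longrightarrow> act M a (x - y) = act M a x - act M a y"
    "x \<in> carr M \<Longrightarrow> act M 0 x = 0"
proof -
  show 0: "0 \<in> carr M" and add: "x \<in> carr M \<Longrightarrow> y \<in> carr M \<Longrightarrow> x + y \<in> carr M"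
    and neg: "x \<in> carr M \<Longrightarrow> - x \<in> carr M" and "x \<in> carr M \<Longrightarrow> act M a x \<in> carr M"
    and act_add: "x \<in> carr M \<Longrightarrow> y \<in> carr M \<Longrightarrow> act M a (x + y) = act M a x + act M a y"
    and add_act: "x \<in> carr M \<Longrightarrow> act M (a + b) x = act M a x + act M b x"
    and "x \<in> carr M \<Longrightarrow> act M (a * b) x = act M a (act M b x)" "x \<in> carr M \<Longrightarrow> act M 1 x = x"
    for x y a b
    using assms by (auto simp: is_lmodule_def)
  show diff: "x - y \<in> carr M" if "x \<in> carr M" "y \<in> carr M" for x y
    using add[OF that(1) neg[OF that(2)]] by simp
  show "act M a 0 = 0" for a using act_add[OF 0 0, of a] by simp
  show act_diff: "act M a (x - y) = act M a x - act M a y" if "x \<in> carr M" "y \<in> carr M" for a x y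
    using act_add[OF diff[OF that] that(2), of a] by simp
  show "x \<in> carr M \<Longrightarrow> act M a (- x) = - act M a x" for a x
    using act_diff[OF 0, of x a] \<open>act M a 0 = 0\<close> by simp
  show "x \<in> carr M \<Longrightarrow> act M 0 x = 0" using add_act[of x 0 0] by simp
qed

lemma Hom_diff:
  assumes "is_lmodule M" "f \<in> Hom M N"
  shows "f 0 = 0" "x \<in> carr M \<Longrightarrow> y \<in> carr M \<Longrightarrow> f (x - y) = f x - f y" "x \<in> carr M \<Longrightarrow> f (- x) = - f x"
proof -
  note M = is_lmoduleD[OF assms(1)] and f = HomD[OF assms(2)]
  show f0: "f 0 = 0" using f(3)[OF M(1) M(1)] by simp
  show d: "f (x - y) = f x - f y" if "x \<in> carr M" "y \<in> carr M" for x y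
    using f(3)[OF M(4)[OF that] that(2)] by simp
  show "x \<in> carr M \<Longrightarrow> f (- x) = - f x" using d[OF M(1)] f0 by simp
qed

lemma Hom_comp:
  assumes "is_lmodule M" "is_lmodule N" "is_lmodule K" "f \<in> Hom M N" "g \<in> Hom N K"
  shows "g \<circ> f \<in> Hom M K"
  using assms Hom_diff(1)[OF assms(2,5)] is_lmoduleD[OF assms(1)] by (auto simp: Hom_def)

lemma zero_in_Hom: "is_lmodule N \<Longrightarrow> (0 :: 'v::ab_group_add \<Rightarrow> 'w::ab_group_add) \<in> Hom M N"
  by (auto simp: Hom_def is_lmoduleD)

lemma id_hom_in_Hom: "is_lmodule M \<Longrightarrow> id_hom M \<in> Hom M M"
  by (auto simp: Hom_def id_hom_def is_lmoduleD)

context fd_algebra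
begin

text \<open>
  Finite dimensional modules whose carrier is a subspace of \<^typ>\<open>nat \<Rightarrow> 'k\<close> on which the ground field
  acts by pointwise multiplication. Homomorphisms between them are linear for the ambient vector
  space, which makes dimensions of spaces of homomorphisms available. Every finite dimensional
  module is isomorphic to one of these (\<open>ex_coord\<close>).
\<close>

definition coord :: "('a, 'k) std_module \<Rightarrow> bool" where
  "coord M \<longleftrightarrow> is_lmodule M \<and> kv.subspace (carr M) \<and> finspan ksc (carr M) \<and>
     (\<forall>c. \<forall>x\<in>carr M. act M (sc c 1) x = ksc c x)"

lemma coordD:
  assumes "coord M"
  shows "is_lmodule M" "kv.subspace (carr M)" "finspan ksc (carr M)"
    "x \<in> carr M \<Longrightarrow> ksc c x \<in> carr M"
    "x \<in> carr M \<Longrightarrow> act M (sc c a) x = ksc c (act M a x)"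
    "x \<in> carr M \<Longrightarrow> act M a (ksc c x) = ksc c (act M a x)"
proof -
  show M: "is_lmodule M" "kv.subspace (carr M)" "finspan ksc (carr M)"
    using assms by (auto simp: coord_def)
  note m = is_lmoduleD[OF M(1)]
  have s: "\<And>c x. x \<in> carr M \<Longrightarrow> act M (sc c 1) x = ksc c x" using assms by (auto simp: coord_def)
  show "x \<in> carr M \<Longrightarrow> ksc c x \<in> carr M" for x c using s m by metis
  show "act M (sc c a) x = ksc c (act M a x)" if "x \<in> carr M" for x
    using m(8)[OF that, of "sc c 1" a] s m(5)[OF that] by (simp add: mult_scale_left)
  show "act M a (ksc c x) = ksc c (act M a x)" if "x \<in> carr M" for x
    using m(8)[OF that, of a "sc c 1"] m(8)[OF that, of "sc c 1" a] s m(5)[OF that] that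
    by (simp add: mult_scale_left mult_scale_right)
qed

lemmas coord_lmoduleD = is_lmoduleD[OF coordD(1)]
  and coord_Hom_diff = Hom_diff[OF coordD(1)]

lemma Hom_lin_map:
  assumes "coord M" "coord N" "f \<in> Hom M N"
  shows "lin_map ksc ksc (carr M) (carr N) f"
proof -
  have "f (ksc c x) = ksc c (f x)" if "x \<in> carr M" for c x
    using assms(1,2) HomD[OF assms(3)] that by (metis coord_def)
  then show ?thesis using HomD[OF assms(3)] coordD[OF assms(1)] coordD[OF assms(2)]
    by (auto simp: lin_map_def)
qed

text \<open>
  The complex \<open>Lin M N \<rightarrow> Coc M N\<close> of linear maps and of cocycles. A cocycle \<open>d\<close> is what makes
  \<open>a \<cdot> (x, y) = (a \<cdot> x + d a y, a \<cdot> y)\<close> an action on \<open>N \<times> M\<close>. The kernel of the complex is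
  \<open>Hom M N\<close>, its cokernel is \<open>Ext M N\<close>. All maps are zero off the carrier of \<open>M\<close>.
\<close>

definition Lin :: "('a, 'k) std_module \<Rightarrow> ('a, 'k) std_module \<Rightarrow> ((nat \<Rightarrow> 'k) \<Rightarrow> nat \<Rightarrow> 'k) set" where
  "Lin M N = {h. lin_map ksc ksc (carr M) (carr N) h \<and> (\<forall>x. x \<notin> carr M \<longrightarrow> h x = 0)}"

definition Coc :: "('a, 'k) std_module \<Rightarrow> ('a, 'k) std_module \<Rightarrow> ('a \<Rightarrow> (nat \<Rightarrow> 'k) \<Rightarrow> nat \<Rightarrow> 'k) set"
  where
  "Coc M N = {d. (\<forall>a. d a \<in> Lin M N) \<and> (\<forall>a b. d (a + b) = d a + d b) \<and>
     (\<forall>c a. d (sc c a) = fsc ksc c (d a)) \<and>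
     (\<forall>a b. \<forall>x\<in>carr M. d (a * b) x = act N a (d b x) + d a (act M b x))}"

definition coboundary :: "('a, 'k) std_module \<Rightarrow> ('a, 'k) std_module \<Rightarrow> ((nat \<Rightarrow> 'k) \<Rightarrow> nat \<Rightarrow> 'k) \<Rightarrow>
    'a \<Rightarrow> (nat \<Rightarrow> 'k) \<Rightarrow> nat \<Rightarrow> 'k" where
  "coboundary M N h = (\<lambda>a x. if x \<in> carr M then act N a (h x) - h (act M a x) else 0)"

lemma LinD:
  assumes "coord M" "h \<in> Lin M N"
  shows "x \<in> carr M \<Longrightarrow> h x \<in> carr N" "x \<notin> carr M \<Longrightarrow> h x = 0" "h 0 = 0"
    "x \<in> carr M \<Longrightarrow> y \<in> carr M \<Longrightarrow> h (x + y) = h x + h y"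
    "x \<in> carr M \<Longrightarrow> y \<in> carr M \<Longrightarrow> h (x - y) = h x - h y"
    "x \<in> carr M \<Longrightarrow> h (ksc c x) = ksc c (h x)"
    "lin_map ksc ksc (carr M) (carr N) h"
  using assms(2) lin_map_diff[OF vs(1), of ksc "carr M" "carr N" h]
    by (auto simp: Lin_def lin_map_def)

lemma LinI:
  assumes "coord M" "coord N" "\<And>x. x \<in> carr M \<Longrightarrow> h x \<in> carr N" "\<And>x. x \<notin> carr M \<Longrightarrow> h x = 0"
    "\<And>x y. x \<in> carr M \<Longrightarrow> y \<in> carr M \<Longrightarrow> h (x + y) = h x + h y"
    "\<And>c x. x \<in> carr M \<Longrightarrow> h (ksc c x) = ksc c (h x)"
  shows "h \<in> Lin M N"
  using assms coordD by (auto simp: Lin_def lin_map_def)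

lemma Lin_comp:
  assumes "coord M" "coord N" "coord K" "h \<in> Lin M N" "g \<in> Lin N K"
  shows "g \<circ> h \<in> Lin M K"
  using LinD[OF assms(1,4)] LinD[OF assms(2,5)] assms(1,3) by (intro LinI) auto

lemma CocD:
  assumes "d \<in> Coc M N"
  shows "d a \<in> Lin M N" "d (a + b) = d a + d b" "d (sc c a) = fsc ksc c (d a)"
    "x \<in> carr M \<Longrightarrow> d (a * b) x = act N a (d b x) + d a (act M b x)"
  using assms by (auto simp: Coc_def)

lemma CocI:
  assumes "\<And>a. d a \<in> Lin M N" "\<And>a b x. x \<in> carr M \<Longrightarrow> d (a + b) x = d a x + d b x"
    "\<And>c a x. x \<in> carr M \<Longrightarrow> d (sc c a) x = ksc c (d a x)"
    "\<And>a b x. x \<in> carr M \<Longrightarrow> d (a * b) x = act N a (d b x) + d a (act M b x)"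
  shows "d \<in> Coc M N"
proof -
  have z: "d a x = 0" if "x \<notin> carr M" for a x using assms(1) that by (auto simp: Lin_def)
  have "d (a + b) x = d a x + d b x" "d (sc c a) x = ksc c (d a x)" for a b c x
    using assms(2,3) z by (cases "x \<in> carr M"; simp)+
  then show ?thesis using assms by (auto simp: Coc_def fun_eq_iff)
qed

lemma Lin_subspace:
  assumes "coord M" "coord N"
  shows "kv1.subspace (Lin M N)"
  unfolding kv1.subspace_def
proof (intro conjI ballI allI)
  note M = coord_lmoduleD[OF assms(1)] coordD[OF assms(1)]
  note N = coord_lmoduleD[OF assms(2)] coordD[OF assms(2)]
  show "0 \<in> Lin M N" using assms N by (intro LinI) auto
  fix g assume g: "g \<in> Lin M N"
  note gD = LinD[OF assms(1) g]
  show "fsc ksc c g \<in> Lin M N" for c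
    using assms N gD by (intro LinI) (auto simp: kv.scale_right_distrib kv.scale_left_commute)
  fix h assume h: "h \<in> Lin M N"
  show "g + h \<in> Lin M N"
    using assms N gD LinD[OF assms(1) h] by (intro LinI) (auto simp: kv.scale_right_distrib)
qed

lemmas Lin_closed = subspace_closed[OF vs(2) Lin_subspace]

lemma Coc_subspace:
  assumes "coord M" "coord N"
  shows "kv2.subspace (Coc M N)"
  unfolding kv2.subspace_def
proof (intro conjI ballI allI)
  note M = coord_lmoduleD[OF assms(1)] coordD[OF assms(1)]
  note N = coord_lmoduleD[OF assms(2)] coordD[OF assms(2)]
  note cl = Lin_closed[OF assms]
  show "0 \<in> Coc M N" using cl(1) N by (intro CocI) auto
  fix g assume g: "g \<in> Coc M N"
  note gD = CocD[OF g] LinD[OF assms(1) CocD(1)[OF g]]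
  have *: "fsc (fsc ksc) c g a = fsc ksc c (g a)" for c a by (rule fsc_apply)
  show "fsc (fsc ksc) c g \<in> Coc M N" for c
    using gD N cl(5)[OF gD(1)]
    by (intro CocI) (auto simp: * kv.scale_right_distrib kv.scale_left_commute)
  fix h assume h: "h \<in> Coc M N"
  note hD = CocD[OF h] LinD[OF assms(1) CocD(1)[OF h]]
  show "g + h \<in> Coc M N"
    using gD hD N cl by (intro CocI) (auto simp: kv.scale_right_distrib)
qed

lemmas Coc_closed = subspace_closed[OF vs(3) Coc_subspace]

lemma Lin_finspan:
  assumes "coord M" "coord N"
  shows "finspan (fsc ksc) (Lin M N)"
proof -
  obtain B where B: "B \<subseteq> carr M" "kv.independent B" "carr M \<subseteq> kv.span B"
    using kv.maximal_independent_subset by blast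
  have "finite B"
    using coordD(3)[OF assms(1)] B kv.independent_span_bound unfolding finspan_def
      by (meson order_trans)
  moreover have "h = 0" if h: "h \<in> Lin M N" and z: "\<forall>x\<in>B. h x = 0" for h
  proof -
    note hD = LinD[OF assms(1) h]
    have "B \<subseteq> {x\<in>carr M. h x = 0}" using B z by auto
    moreover have "kv.subspace {x\<in>carr M. h x = 0}"
      by (rule lin_map_kernel_subspace[OF vs(1,1) hD(7)])
    ultimately have "carr M \<subseteq> {x\<in>carr M. h x = 0}" using kv.span_minimal B(3) by blast
    then show ?thesis using hD(2) by (auto simp: fun_eq_iff)
  qed
  moreover have "\<forall>h\<in>Lin M N. \<forall>x. h x \<in> carr N"
    using LinD[OF assms(1)] coord_lmoduleD(1)[OF assms(2)] by metis
  ultimately show ?thesis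
    using finspan_evaluation[OF vs(1) _ coordD(3)[OF assms(2)] Lin_subspace[OF assms], of B]
      by blast
qed

text \<open>
  A cocycle is determined by its values on a basis of the algebra.
\<close>

lemma Coc_finspan:
  assumes "coord M" "coord N"
  shows "finspan (fsc (fsc ksc)) (Coc M N)"
proof -
  obtain B where B: "finite B" "span B = UNIV" using finite_dim by blast
  have "d = 0" if d: "d \<in> Coc M N" and z: "\<forall>a\<in>B. d a = 0" for d
  proof -
    note dD = CocD[OF d]
    have d0: "d 0 = 0" using dD(2)[of 0 0] by simp
    have "subspace {a. d a = 0}"
      by (rule subspaceI; unfold mem_Collect_eq) (simp_all add: d0 dD(2,3) kv1.scale_zero_right)
    moreover have "B \<subseteq> {a. d a = 0}" using z by auto
    ultimately have "span B \<subseteq> {a. d a = 0}" by (rule span_minimal[rotated])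
    then have "d a = 0" for a using B(2) by auto
    then show ?thesis by (intro ext) simp
  qed
  moreover have "\<forall>d\<in>Coc M N. \<forall>a. d a \<in> Lin M N" using CocD by blast
  ultimately show ?thesis
    using finspan_evaluation[OF vs(2) B(1) Lin_finspan[OF assms] Coc_subspace[OF assms]] by blast
qed

lemma coboundary_lin_map:
  assumes "coord M" "coord N"
  shows "lin_map (fsc ksc) (fsc (fsc ksc)) (Lin M N) (Coc M N) (coboundary M N)"
  unfolding lin_map_def
proof (intro conjI ballI allI)
  note M = coord_lmoduleD[OF assms(1)] coordD[OF assms(1)]
  note N = coord_lmoduleD[OF assms(2)] coordD[OF assms(2)]
  show "kv1.subspace (Lin M N)" "kv2.subspace (Coc M N)"
    by (rule Lin_subspace[OF assms], rule Coc_subspace[OF assms])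
  fix g assume g: "g \<in> Lin M N"
  note gD = LinD[OF assms(1) g]
  have "coboundary M N g a \<in> Lin M N" for a
    using gD M N assms by (intro LinI) (auto simp: coboundary_def kv.scale_right_diff_distrib)
  then show "coboundary M N g \<in> Coc M N"
    using gD M N by (intro CocI) (auto simp: coboundary_def kv.scale_right_diff_distrib)
  show "coboundary M N (fsc ksc c g) = fsc (fsc ksc) c (coboundary M N g)" for c
    using gD M N
    by (intro ext) (simp add: coboundary_def fsc_apply kv.scale_right_diff_distrib)
  fix h assume h: "h \<in> Lin M N"
  show "coboundary M N (g + h) = coboundary M N g + coboundary M N h"
    using gD LinD[OF assms(1) h] M N by (auto simp: coboundary_def intro!: ext)
qed

lemma coboundary_in: "coord M \<Longrightarrow> coord N \<Longrightarrow> h \<in> Lin M N \<Longrightarrow> coboundary M N h \<in> Coc M N"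
  using coboundary_lin_map by (auto simp: lin_map_def)

lemma Hom_iff_coboundary:
  assumes "coord M" "coord N"
  shows "f \<in> Hom M N \<longleftrightarrow> f \<in> Lin M N \<and> coboundary M N f = 0"
proof
  assume f: "f \<in> Hom M N"
  then show "f \<in> Lin M N \<and> coboundary M N f = 0"
    using Hom_lin_map[OF assms f] HomD[OF f] by (auto simp: Lin_def coboundary_def fun_eq_iff)
next
  assume f: "f \<in> Lin M N \<and> coboundary M N f = 0"
  then have "act N a (f x) - f (act M a x) = 0" if "x \<in> carr M" for a x
    using that by (auto simp: coboundary_def dest!: fun_cong[of _ _ a] dest!: fun_cong[of _ _ x])
  then show "f \<in> Hom M N" using LinD[OF assms(1)] f by (auto simp: Hom_def)
qed

text \<open>
  \<open>Hom M N = 0\<close> and \<open>Ext M N = 0\<close>, the latter as the statement that all cocycles are coboundaries.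
\<close>

definition no_hom :: "('a, 'k) std_module \<Rightarrow> ('a, 'k) std_module \<Rightarrow> bool" where
  "no_hom M N \<longleftrightarrow> ker0 (Lin M N) (coboundary M N)"

definition no_ext :: "('a, 'k) std_module \<Rightarrow> ('a, 'k) std_module \<Rightarrow> bool" where
  "no_ext M N \<longleftrightarrow> coker0 (Lin M N) (Coc M N) (coboundary M N)"

lemma no_hom_iff:
  assumes "coord M" "coord N"
  shows "no_hom M N \<longleftrightarrow> Hom M N = {0}"
  using Hom_iff_coboundary[OF assms] zero_in_Hom[OF coordD(1)[OF assms(2)], of M]
  unfolding no_hom_def ker0_def by blast

text \<open>
  The Euler form \<open>dim (Hom M N) - dim (Ext M N)\<close>, written as the Euler characteristic of the
  complex.
\<close>

definition euler :: "('a, 'k) std_module \<Rightarrow> ('a, 'k) std_module \<Rightarrow> int" where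
  "euler M N = int (kv1.dim (Lin M N)) - int (kv2.dim (Coc M N))"

lemma euler_no_hom:
  assumes "coord M" "coord N" "no_hom M N"
  shows "euler M N \<le> 0" "no_ext M N \<Longrightarrow> euler M N = 0"
proof -
  note d = coboundary_lin_map[OF assms(1,2)]
  have "{h\<in>Lin M N. coboundary M N h = 0} = {0}"
    using assms(3) Lin_closed(1)[OF assms(1,2)] lin_map_diff(1)[OF vs(2) d]
      by (auto simp: no_hom_def ker0_def)
  then have *: "kv1.dim (Lin M N) = kv2.dim (coboundary M N ` Lin M N)"
    using lin_map_finspan_dim(3)[OF vs(2,3) d Lin_finspan[OF assms(1,2)]] dim_zero[OF vs(2)] by simp
  have sub: "coboundary M N ` Lin M N \<subseteq> Coc M N" using d by (auto simp: lin_map_def)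
  then show "euler M N \<le> 0"
    using dim_mono_finspan[OF vs(3) Coc_finspan[OF assms(1,2)] sub] * by (simp add: euler_def)
  assume "no_ext M N"
  then have "coboundary M N ` Lin M N = Coc M N" using sub by (auto simp: no_ext_def coker0_def)
  then show "euler M N = 0" using * by (simp add: euler_def)
qed

lemma euler_no_ext:
  assumes "coord M" "coord N" "no_ext M N" "\<not> no_hom M N"
  shows "euler M N > 0"
proof -
  note d = coboundary_lin_map[OF assms(1,2)]
  let ?K = "{h\<in>Lin M N. coboundary M N h = 0}"
  have "coboundary M N ` Lin M N = Coc M N"
    using assms(3) d by (auto simp: no_ext_def coker0_def lin_map_def)
  then have "kv1.dim (Lin M N) = kv1.dim ?K + kv2.dim (Coc M N)"
    using lin_map_finspan_dim(3)[OF vs(2,3) d Lin_finspan[OF assms(1,2)]] by simp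
  moreover have "kv1.dim ?K > 0"
    using assms(4) finspan_subset[OF Lin_finspan[OF assms(1,2)], of ?K] dim_pos[OF vs(2)]
    unfolding no_hom_def ker0_def by blast
  ultimately show ?thesis by (simp add: euler_def)
qed

end

section \<open>Constructions of modules\<close>

text \<open>Even and odd coordinates identify \<^typ>\<open>nat \<Rightarrow> 'k\<close> with its square.\<close>

definition evc :: "(nat \<Rightarrow> 'k) \<Rightarrow> nat \<Rightarrow> 'k" where
  "evc x = (\<lambda>i. x (2 * i))"

definition odc :: "(nat \<Rightarrow> 'k) \<Rightarrow> nat \<Rightarrow> 'k" where
  "odc x = (\<lambda>i. x (2 * i + 1))"

definition join :: "(nat \<Rightarrow> 'k) \<Rightarrow> (nat \<Rightarrow> 'k) \<Rightarrow> nat \<Rightarrow> 'k" where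
  "join u v = (\<lambda>i. if even i then u (i div 2) else v (i div 2))"

lemma evc_odc_join [simp]: "evc (join u v) = u" "odc (join u v) = v" "join (evc x) (odc x) = x"
  by (auto simp: evc_def odc_def join_def fun_eq_iff)

lemma evc_odc_linear [simp]:
  fixes x y u v u' v' :: "nat \<Rightarrow> 'k::field"
  shows "evc (x + y) = evc x + evc y" "odc (x + y) = odc x + odc y"
  "evc (- x) = - evc x" "odc (- x) = - odc x" "evc (x - y) = evc x - evc y"
  "odc (x - y) = odc x - odc y"
  "evc 0 = (0 :: nat \<Rightarrow> 'k)" "odc 0 = (0 :: nat \<Rightarrow> 'k)"
  "evc (ksc c x) = ksc c (evc x)" "odc (ksc c x) = ksc c (odc x)"
  "join 0 0 = (0 :: nat \<Rightarrow> 'k)"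
  "join u v + join u' v' = join (u + u') (v + v')" "join u v - join u' v' = join (u - u') (v - v')"
  "- join u v = join (- u) (- v)"
  "ksc c (join u v) = join (ksc c u) (ksc c v)"
  by (auto simp: evc_def odc_def join_def ksc_def fun_eq_iff)

lemma join_eq_iff [simp]: "join u v = join u' v' \<longleftrightarrow> u = u' \<and> v = v'"
  by (metis evc_odc_join(1,2))

lemma eq_join_iff: "x = join u v \<longleftrightarrow> evc x = u \<and> odc x = v"
  by (metis evc_odc_join)

lemma join_eq_0_iff [simp]: "join u v = (0 :: nat \<Rightarrow> 'k::field) \<longleftrightarrow> u = 0 \<and> v = 0"
  by (metis evc_odc_join(1,2) evc_odc_linear(7,8,11))

lemma evc_odc_eq_0: "evc x = 0 \<Longrightarrow> odc x = 0 \<Longrightarrow> x = (0 :: nat \<Rightarrow> 'k::field)"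
  by (metis evc_odc_join(3) evc_odc_linear(11))

text \<open>
  The submodule carried by \<open>U\<close>, provided that \<open>submodule U M\<close> holds.
\<close>

abbreviation submod :: "('a, 'v) lmodule \<Rightarrow> 'v set \<Rightarrow> ('a, 'v) lmodule" where
  "submod M U \<equiv> LModule U (act M)"

lemma submodule_iff:
  assumes "is_lmodule M"
  shows "submodule U M \<longleftrightarrow> U \<subseteq> carr M \<and> 0 \<in> U \<and> (\<forall>x\<in>U. \<forall>y\<in>U. x + y \<in> U) \<and> (\<forall>a. \<forall>x\<in>U. act M a x \<in> U)"
proof -
  note M = is_lmoduleD[OF assms]
  have "- x \<in> U" if "U \<subseteq> carr M" "\<forall>a. \<forall>x\<in>U. act M a x \<in> U" "x \<in> U" for x
  proof -
    have "x \<in> carr M" using that by auto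
    then have "act M (- 1) x + x = 0"
      using M(7)[of x "- 1" 1] M(9,13) by simp
    then have "act M (- 1) x = - x" by (simp add: add_eq_0_iff2)
    then show ?thesis using that by metis
  qed
  then show ?thesis using M unfolding submodule_def is_lmodule_def by (auto simp: subset_iff)
qed

lemma kernel_submodule:
  assumes "is_lmodule M" "is_lmodule N" "f \<in> Hom M N"
  shows "submodule {x\<in>carr M. f x = 0} M"
  using HomD[OF assms(3)] Hom_diff[OF assms(1,3)] is_lmoduleD[OF assms(1)] is_lmoduleD[OF assms(2)]
  by (auto simp: submodule_iff[OF assms(1)])

lemma image_submodule:
  assumes "is_lmodule M" "is_lmodule N" "f \<in> Hom M N"
  shows "submodule (f ` carr M) N"
proof -
  note f = HomD[OF assms(3)] Hom_diff[OF assms(1,3)]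
  note M = is_lmoduleD[OF assms(1)]
  have "0 \<in> f ` carr M" using f M by (intro image_eqI[of _ _ 0]) auto
  then show ?thesis
    using f M by (auto simp: submodule_iff[OF assms(2)] image_iff simp flip: f(3,4))
qed

context fd_algebra
begin

lemma coord_submod:
  assumes "coord M" "submodule U M"
  shows "coord (submod M U)"
proof -
  have U: "is_lmodule (submod M U)" "U \<subseteq> carr M" using assms(2) by (auto simp: submodule_def)
  note u = is_lmoduleD[OF U(1), simplified]
  have s: "act M (sc c 1) x = ksc c x" if "x \<in> U" for c x
    using assms(1) that U(2) by (auto simp: coord_def)
  then have "kv.subspace U" unfolding kv.subspace_def using u by metis
  then show ?thesis
    using U s finspan_subset[OF coordD(3)[OF assms(1)] U(2)] by (auto simp: coord_def)
qed

text \<open>Short exact sequences \<open>0 \<rightarrow> A \<rightarrow> B \<rightarrow> C \<rightarrow> 0\<close> of modules on coordinate spaces.\<close>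

definition ses :: "('a, 'k) std_module \<Rightarrow> ((nat \<Rightarrow> 'k) \<Rightarrow> nat \<Rightarrow> 'k) \<Rightarrow> ('a, 'k) std_module \<Rightarrow>
    ((nat \<Rightarrow> 'k) \<Rightarrow> nat \<Rightarrow> 'k) \<Rightarrow> ('a, 'k) std_module \<Rightarrow> bool" where
  "ses A i B p C \<longleftrightarrow> coord A \<and> coord B \<and> coord C \<and> i \<in> Hom A B \<and> p \<in> Hom B C \<and>
     (\<forall>x\<in>carr A. i x = 0 \<longrightarrow> x = 0) \<and> (\<forall>x\<in>carr A. p (i x) = 0) \<and>
     (\<forall>y\<in>carr B. p y = 0 \<longrightarrow> (\<exists>x\<in>carr A. i x = y)) \<and> (\<forall>z\<in>carr C. \<exists>y\<in>carr B. p y = z)"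

lemma ses_short_exact:
  assumes "ses A i B p C"
  shows "short_exact ksc (carr A) (carr B) (carr C) i p"
  using assms Hom_lin_map by (auto simp: ses_def short_exact_def)

lemma sesD:
  assumes "ses A i B p C"
  shows "coord A" "coord B" "coord C" "i \<in> Hom A B" "p \<in> Hom B C"
    "x \<in> carr A \<Longrightarrow> i x = 0 \<Longrightarrow> x = 0" "x \<in> carr A \<Longrightarrow> p (i x) = 0"
    "y \<in> carr B \<Longrightarrow> p y = 0 \<Longrightarrow> \<exists>x\<in>carr A. i x = y" "z \<in> carr C \<Longrightarrow> \<exists>y\<in>carr B. p y = z"
  using assms by (auto simp: ses_def)

lemma ses_kernel:
  assumes "coord M" "coord N" "f \<in> Hom M N" "\<forall>z\<in>carr N. \<exists>y\<in>carr M. f y = z"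
  defines "K \<equiv> submod M {x\<in>carr M. f x = 0}"
  shows "ses K (id_hom K) M f N"
proof -
  note M = coordD(1)[OF assms(1)] and N = coordD(1)[OF assms(2)]
  have K: "coord K" unfolding K_def by (rule coord_submod[OF assms(1) kernel_submodule[OF M N
    assms(3)]])
  have "id_hom K \<in> Hom K M"
    using coord_lmoduleD[OF K] by (auto simp: Hom_def id_hom_def K_def)
  then show ?thesis using assms K by (auto simp: ses_def id_hom_def K_def)
qed

lemma ses_image:
  assumes "coord M" "coord N" "f \<in> Hom M N"
  defines "K \<equiv> submod M {x\<in>carr M. f x = 0}" and "I \<equiv> submod N (f ` carr M)"
  shows "ses K (id_hom K) M f I"
proof -
  note M = coordD(1)[OF assms(1)] and N = coordD(1)[OF assms(2)]
  have I: "coord I" unfolding I_def by (rule coord_submod[OF assms(2) image_submodule[OF M N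
    assms(3)]])
  have "f \<in> Hom M I" using HomD[OF assms(3)] by (auto simp: Hom_def I_def)
  then show ?thesis unfolding K_def by (rule ses_kernel[OF assms(1) I]) (auto simp: I_def)
qed

text \<open>
  The quotient by a submodule is realised on a linear complement, with the action followed by the
  projection to the complement.
\<close>

lemma ses_quotient:
  assumes "coord M" "submodule U M"
  shows "\<exists>Q p. ses (submod M U) (id_hom (submod M U)) M p Q"
proof -
  have U: "coord (submod M U)" "U \<subseteq> carr M" using coord_submod assms by (auto simp: submodule_def)
  note u = coordD[OF U(1), simplified] coord_lmoduleD[OF U(1), simplified]
  note m = coordD[OF assms(1)] coord_lmoduleD[OF assms(1)]
  have "lin_map ksc ksc U (carr M) (\<lambda>x. x)" using U(2) u m by (auto simp: lin_map_def)
  from lin_map_left_inverse[OF vs(1,1) this] obtain g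
    where g: "lin_map ksc ksc (carr M) U g" and gU: "\<And>x. x \<in> U \<Longrightarrow> g x = x" by auto
  define q where "q x = (if x \<in> carr M then x - g x else 0)" for x
  define Q where "Q = LModule {x\<in>carr M. g x = 0} (\<lambda>a x. q (act M a x))"
  have gin: "g x \<in> U" "g x \<in> carr M" if "x \<in> carr M" for x using g that U(2)
    by (auto simp: lin_map_def)
  note gd = lin_map_diff[OF vs(1) g]
  have gadd: "g (x + y) = g x + g y" if "x \<in> carr M" "y \<in> carr M" for x y
    using g that by (auto simp: lin_map_def)
  have gsc: "g (ksc c x) = ksc c (g x)" if "x \<in> carr M" for x c
    using g that by (auto simp: lin_map_def)
  have q_in: "q x \<in> carr M" "g (q x) = 0" if "x \<in> carr M" for x
    using that gin m gd gU by (auto simp: q_def)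
  have q_add: "q (x + y) = q x + q y" if "x \<in> carr M" "y \<in> carr M" for x y
    using that m gadd by (auto simp: q_def)
  have q_U: "q (act M a (q x)) = q (act M a x)" if x: "x \<in> carr M" for a x
  proof -
    have "act M a (q x) = act M a x - act M a (g x)" using x gin m by (simp add: q_def)
    moreover have "act M a (g x) \<in> U" using u gin x by auto
    ultimately show ?thesis using x m gin gd(2) gU by (simp add: q_def)
  qed
  have qQ: "q x = x" if "x \<in> carr M" "g x = 0" for x using that by (simp add: q_def)
  have mQ: "is_lmodule Q"
    unfolding is_lmodule_def Q_def using m gd gadd q_in q_add q_U qQ by auto
  have "kv.subspace (carr Q)"
    unfolding Q_def by (simp, rule lin_map_kernel_subspace[OF vs(1,1) g])
  moreover have "finspan ksc (carr Q)" using finspan_subset[OF m(3)] by (auto simp: Q_def)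
  moreover have "act Q (sc c 1) x = ksc c x" if "x \<in> carr Q" for c x
    using that assms(1) gsc m(4) by (auto simp: coord_def Q_def intro!: qQ)
  ultimately have nQ: "coord Q" using mQ by (auto simp: coord_def)
  have "q \<in> Hom M Q" using q_in q_add q_U m by (auto simp: Hom_def Q_def) (auto simp: q_def)
  moreover have "id_hom (submod M U) \<in> Hom (submod M U) M"
    using u U(2) by (auto simp: Hom_def id_hom_def)
  moreover have "\<exists>y\<in>carr M. q y = z" if "z \<in> carr Q" for z using that qQ by (auto simp: Q_def)
  moreover have "q x = 0 \<longleftrightarrow> x \<in> U" if "x \<in> carr M" for x
    using that gU gin by (auto simp: q_def) (metis)
  ultimately have "ses (submod M U) (id_hom (submod M U)) M q Q"
    using nQ U assms(1) by (auto simp: ses_def id_hom_def)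
  then show ?thesis by blast
qed

text \<open>
  The extension \<open>0 \<rightarrow> N \<rightarrow> X \<rightarrow> M \<rightarrow> 0\<close> given by a cocycle: even coordinates belong to \<open>N\<close>, odd ones
  to \<open>M\<close>. The zero cocycle gives the direct sum.
\<close>

definition extmod :: "('a, 'k) std_module \<Rightarrow> ('a, 'k) std_module \<Rightarrow> ('a \<Rightarrow> (nat \<Rightarrow> 'k) \<Rightarrow> nat \<Rightarrow> 'k) \<Rightarrow>
    ('a, 'k) std_module" where
  "extmod N M d = LModule {x. evc x \<in> carr N \<and> odc x \<in> carr M}
     (\<lambda>a x. join (act N a (evc x) + d a (odc x)) (act M a (odc x)))"

definition ext_incl :: "('a, 'k) std_module \<Rightarrow> (nat \<Rightarrow> 'k) \<Rightarrow> nat \<Rightarrow> 'k" where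
  "ext_incl N = (\<lambda>x. if x \<in> carr N then join x 0 else 0)"

definition ext_proj :: "('a, 'k) std_module \<Rightarrow> ('a, 'k) std_module \<Rightarrow> (nat \<Rightarrow> 'k) \<Rightarrow> nat \<Rightarrow> 'k" where
  "ext_proj N M = (\<lambda>x. if evc x \<in> carr N \<and> odc x \<in> carr M then odc x else 0)"

lemma ses_extmod:
  assumes "coord M" "coord N" "d \<in> Coc M N"
  shows "ses N (ext_incl N) (extmod N M d) (ext_proj N M) M"
proof -
  note m = coordD[OF assms(1)] coord_lmoduleD[OF assms(1)]
  note n = coordD[OF assms(2)] coord_lmoduleD[OF assms(2)]
  note d = CocD[OF assms(3)] LinD[OF assms(1) CocD(1)[OF assms(3)]]
  let ?X = "extmod N M d"
  have d1: "d 1 x = 0" if "x \<in> carr M" for x using d(4)[OF that, of 1 1] n m d(5) that by simp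
  have mX: "is_lmodule ?X"
    unfolding is_lmodule_def extmod_def using m n d d1 by (auto simp: eq_join_iff algebra_simps)
  have dsc: "d (sc c 1) x = 0" if "x \<in> carr M" for c x using d(3)[of c 1] d1 that
    by (simp add: fsc_apply)
  have act_sc: "act ?X (sc c 1) x = ksc c x" if "x \<in> carr ?X" for c x
    using that m n dsc by (auto simp: extmod_def eq_join_iff intro!: eq_join_iff[THEN iffD2,
      symmetric])
  have sub: "kv.subspace (carr ?X)" unfolding kv.subspace_def extmod_def using m n by auto
  have "lin_map ksc ksc (carr ?X) (carr M) odc" using sub m by (auto simp: lin_map_def extmod_def)
  moreover have "finspan ksc {x\<in>carr ?X. odc x = 0}"
  proof -
    have l: "lin_map ksc ksc {x\<in>carr ?X. odc x = 0} (carr N) evc"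
      using lin_map_kernel_subspace[OF vs(1,1) calculation] n by (auto simp: lin_map_def extmod_def)
    have "{x\<in>{x\<in>carr ?X. odc x = 0}. evc x = 0} \<subseteq> carr M" using evc_odc_eq_0 m by auto
    then have "finspan ksc {x\<in>{x\<in>carr ?X. odc x = 0}. evc x = 0}" using m(3) finspan_subset by blast
    moreover have "finspan ksc (evc ` {x\<in>carr ?X. odc x = 0})"
      by (rule finspan_subset[OF n(3)]) (auto simp: extmod_def)
    ultimately show ?thesis using lin_map_finspan_dim(1)[OF vs(1,1) l] by blast
  qed
  moreover have "finspan ksc (odc ` carr ?X)"
    by (rule finspan_subset[OF m(3)]) (auto simp: extmod_def)
  ultimately have "finspan ksc (carr ?X)" using lin_map_finspan_dim(1)[OF vs(1,1)] by blast
  then have nX: "coord ?X" using mX act_sc sub by (auto simp: coord_def)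
  have "ext_incl N \<in> Hom N ?X" using n m d by (auto simp: Hom_def ext_incl_def extmod_def)
  moreover have "ext_proj N M \<in> Hom ?X M" using n m d
    by (auto simp: Hom_def ext_proj_def extmod_def)
  moreover have "\<exists>x\<in>carr N. ext_incl N x = y" if "y \<in> carr ?X" "ext_proj N M y = 0" for y
    using that by (intro bexI[of _ "evc y"]) (auto simp: extmod_def ext_proj_def ext_incl_def
      eq_join_iff intro!: eq_join_iff[THEN iffD2, symmetric])
  moreover have "\<exists>y\<in>carr ?X. ext_proj N M y = z" if "z \<in> carr M" for z
    using that n by (intro bexI[of _ "join 0 z"]) (auto simp: extmod_def ext_proj_def)
  ultimately show ?thesis
    using nX assms n m by (auto simp: ses_def ext_incl_def ext_proj_def)
qed

section \<open>Linear maps, cocycles and short exact sequences\<close>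

text \<open>
  A linear splitting: \<open>s\<close> is a section of \<open>p\<close> and \<open>r\<close> a retraction of \<open>i\<close>, neither of them a
  homomorphism of modules in general.
\<close>

lemma ses_section:
  assumes "ses A i B p C"
  shows "\<exists>s\<in>Lin C B. \<exists>r\<in>Lin B A. (\<forall>z\<in>carr C. p (s z) = z) \<and> (\<forall>x\<in>carr A. r (i x) = x) \<and>
    (\<forall>y\<in>carr B. i (r y) + s (p y) = y)"
proof -
  note S = sesD[OF assms]
  note a = coordD[OF S(1)] coord_lmoduleD[OF S(1)]
  note b = coordD[OF S(2)] coord_lmoduleD[OF S(2)]
  note c = coordD[OF S(3)] coord_lmoduleD[OF S(3)]
  note i = HomD[OF S(4)] Hom_diff[OF a(1) S(4)] and p = HomD[OF S(5)] Hom_diff[OF b(1) S(5)]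
  note li = Hom_lin_map[OF S(1,2,4)] and lp = Hom_lin_map[OF S(2,3,5)]
  obtain s0 where s0: "lin_map ksc ksc (carr C) (carr B) s0" "\<And>z. z \<in> carr C \<Longrightarrow> p (s0 z) = z"
    using lin_map_right_inverse[OF vs(1,1) lp] S(9) by blast
  obtain r0 where r0: "lin_map ksc ksc (carr B) (carr A) r0" "\<And>x. x \<in> carr A \<Longrightarrow> r0 (i x) = x"
    using lin_map_left_inverse[OF vs(1,1) li] S(6) by blast
  define s where "s z = (if z \<in> carr C then s0 z else 0)" for z
  define r where "r y = (if y \<in> carr B then r0 (y - s (p y)) else 0)" for y
  have s: "s \<in> Lin C B" using s0(1) c by (intro LinI[OF S(3,2)]) (auto simp: s_def lin_map_def)
  note sD = LinD[OF S(3) s]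
  have psc: "p (ksc k x) = ksc k (p x)" if "x \<in> carr B" for k x using lp that
    by (auto simp: lin_map_def)
  have in_B: "y - s (p y) \<in> carr B" if "y \<in> carr B" for y using that b p sD by auto
  have r: "r \<in> Lin B A"
  proof (rule LinI[OF S(2,1)])
    show "r y \<in> carr A" if "y \<in> carr B" for y
      using r0(1) in_B that by (auto simp: r_def lin_map_def)
    show "r (x + y) = r x + r y" if "x \<in> carr B" "y \<in> carr B" for x y
    proof -
      have eq: "x + y - s (p (x + y)) = (x - s (p x)) + (y - s (p y))" using that p sD by simp
      have "r0 (x + y - s (p (x + y))) = r0 (x - s (p x)) + r0 (y - s (p y))"
        unfolding eq using r0(1) in_B that by (auto simp: lin_map_def)
      then show ?thesis using that b by (simp add: r_def)
    qed
    show "r (ksc k x) = ksc k (r x)" if "x \<in> carr B" for k x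
    proof -
      have "ksc k x - s (p (ksc k x)) = ksc k (x - s (p x))"
        using that p sD psc by (simp add: kv.scale_right_diff_distrib)
      then show ?thesis using r0(1) in_B[OF that] that b by (simp add: r_def lin_map_def)
    qed
  qed (simp add: r_def)
  have ps: "p (s z) = z" if "z \<in> carr C" for z using that s0 by (simp add: s_def)
  have "i (r y) + s (p y) = y" if y: "y \<in> carr B" for y
  proof -
    have "p (y - s (p y)) = 0" using y p sD ps by simp
    then obtain x where "x \<in> carr A" "i x = y - s (p y)" using S(8) in_B y by blast
    then show ?thesis using r0(2)[of x] y by (simp add: r_def)
  qed
  moreover have "r (i x) = x" if "x \<in> carr A" for x
    using that i sD S(7) r0(2) by (simp add: r_def)
  ultimately show ?thesis using s r ps by blast
qed

lemma Hom_in_Lin: "coord M \<Longrightarrow> coord N \<Longrightarrow> f \<in> Hom M N \<Longrightarrow> f \<in> Lin M N"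
  using Hom_iff_coboundary by blast

lemma lin_map_precomp:
  assumes "coord M" "coord N" "coord K" "h \<in> Lin M N"
  shows "lin_map (fsc ksc) (fsc ksc) (Lin N K) (Lin M K) (\<lambda>g. g \<circ> h)"
  using Lin_subspace[OF assms(2,3)] Lin_subspace[OF assms(1,3)] Lin_comp[OF assms(1-4)]
  by (auto simp: lin_map_def fsc_apply)

lemma lin_map_postcomp:
  assumes "coord M" "coord N" "coord K" "h \<in> Lin N K"
  shows "lin_map (fsc ksc) (fsc ksc) (Lin M N) (Lin M K) (\<lambda>g. h \<circ> g)"
proof -
  have z: "h 0 = 0" using LinD[OF assms(2,4)] by simp
  have "h (g x + g' x) = h (g x) + h (g' x)" if g: "g \<in> Lin M N" "g' \<in> Lin M N" for g g' x
    using LinD[OF assms(1) g(1)] LinD[OF assms(1) g(2)] LinD[OF assms(2,4)] z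
    by (cases "x \<in> carr M") auto
  moreover have "h (ksc c (g x)) = ksc c (h (g x))" if g: "g \<in> Lin M N" for g c x
    using LinD[OF assms(1) g] LinD[OF assms(2,4)] z by (cases "x \<in> carr M") auto
  ultimately show ?thesis
    using Lin_subspace[OF assms(1,2)] Lin_subspace[OF assms(1,3)] Lin_comp[OF assms(1-3) _ assms(4)]
    by (auto simp: lin_map_def fsc_apply fun_eq_iff)
qed

lemma Lin_exact_contra:
  assumes "ses A i B p C" "coord X"
  shows "short_exact (fsc ksc) (Lin C X) (Lin B X) (Lin A X) (\<lambda>h. h \<circ> p) (\<lambda>h. h \<circ> i)"
  unfolding short_exact_def
proof (intro conjI ballI impI)
  note S = sesD[OF assms(1)]
  note i = Hom_in_Lin[OF S(1,2,4)] and p = Hom_in_Lin[OF S(2,3,5)]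
  obtain s r where s: "s \<in> Lin C B" and r: "r \<in> Lin B A" and
    ps: "\<And>z. z \<in> carr C \<Longrightarrow> p (s z) = z" and ri: "\<And>x. x \<in> carr A \<Longrightarrow> r (i x) = x" and
    id: "\<And>y. y \<in> carr B \<Longrightarrow> i (r y) + s (p y) = y" using ses_section[OF assms(1)] by blast
  note sD = LinD[OF S(3) s] and rD = LinD[OF S(2) r] and iD = LinD[OF S(1) i]
    and pD = LinD[OF S(2) p]
  show "lin_map (fsc ksc) (fsc ksc) (Lin C X) (Lin B X) (\<lambda>h. h \<circ> p)"
    "lin_map (fsc ksc) (fsc ksc) (Lin B X) (Lin A X) (\<lambda>h. h \<circ> i)"
    by (rule lin_map_precomp[OF S(2,3) assms(2) p], rule lin_map_precomp[OF S(1,2) assms(2) i])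
  show "h = 0" if h: "h \<in> Lin C X" "h \<circ> p = 0" for h
  proof
    fix z show "h z = 0 z"
      using fun_cong[OF h(2), of "s z"] ps[of z] LinD(2)[OF S(3) h(1), of z]
        by (cases "z \<in> carr C") auto
  qed
  show "h \<circ> p \<circ> i = 0" if h: "h \<in> Lin C X" for h
  proof
    fix x show "(h \<circ> p \<circ> i) x = 0 x"
      using S(7) iD(2) pD(3) LinD(3)[OF S(3) h] by (cases "x \<in> carr A") auto
  qed
  show "\<exists>x\<in>Lin C X. x \<circ> p = h" if h: "h \<in> Lin B X" "h \<circ> i = 0" for h
  proof (intro bexI[of _ "h \<circ> s"])
    show "h \<circ> s \<in> Lin C X" by (rule Lin_comp[OF S(3,2) assms(2) s h(1)])
    show "h \<circ> s \<circ> p = h"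
    proof
      fix y show "(h \<circ> s \<circ> p) y = h y"
      proof (cases "y \<in> carr B")
        case True
        have "h y = h (i (r y) + s (p y))" using id[OF True] by simp
        also have "\<dots> = h (i (r y)) + h (s (p y))"
          using LinD(4)[OF S(2) h(1)] True iD rD sD pD by auto
        finally show ?thesis using h(2) by (auto simp: fun_eq_iff)
      qed (use LinD[OF S(2) h(1)] pD sD in auto)
    qed
  qed
  show "\<exists>y\<in>Lin B X. y \<circ> i = h" if h: "h \<in> Lin A X" for h
  proof (intro bexI[of _ "h \<circ> r"])
    show "h \<circ> r \<in> Lin B X" by (rule Lin_comp[OF S(2,1) assms(2) r h])
    show "h \<circ> r \<circ> i = h"
    proof
      fix x show "(h \<circ> r \<circ> i) x = h x"
        using ri iD rD LinD[OF S(1) h] by (cases "x \<in> carr A") auto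
    qed
  qed
qed

lemma Lin_exact_co:
  assumes "ses A i B p C" "coord X"
  shows "short_exact (fsc ksc) (Lin X A) (Lin X B) (Lin X C) (\<lambda>h. i \<circ> h) (\<lambda>h. p \<circ> h)"
  unfolding short_exact_def
proof (intro conjI ballI impI)
  note S = sesD[OF assms(1)]
  note i = Hom_in_Lin[OF S(1,2,4)] and p = Hom_in_Lin[OF S(2,3,5)]
  obtain s r where s: "s \<in> Lin C B" and r: "r \<in> Lin B A" and
    ps: "\<And>z. z \<in> carr C \<Longrightarrow> p (s z) = z" and ri: "\<And>x. x \<in> carr A \<Longrightarrow> r (i x) = x" and
    id: "\<And>y. y \<in> carr B \<Longrightarrow> i (r y) + s (p y) = y" using ses_section[OF assms(1)] by blast
  note sD = LinD[OF S(3) s] and rD = LinD[OF S(2) r] and iD = LinD[OF S(1) i]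
    and pD = LinD[OF S(2) p]
  show "lin_map (fsc ksc) (fsc ksc) (Lin X A) (Lin X B) (\<lambda>h. i \<circ> h)"
    "lin_map (fsc ksc) (fsc ksc) (Lin X B) (Lin X C) (\<lambda>h. p \<circ> h)"
    by (rule lin_map_postcomp[OF assms(2) S(1,2) i], rule lin_map_postcomp[OF assms(2) S(2,3) p])
  show "h = 0" if h: "h \<in> Lin X A" "i \<circ> h = 0" for h
  proof
    fix z show "h z = 0 z"
      using h(2) S(6) LinD(1,2)[OF assms(2) h(1), of z]
        by (cases "z \<in> carr X") (auto simp: fun_eq_iff)
  qed
  show "p \<circ> (i \<circ> h) = 0" if h: "h \<in> Lin X A" for h
  proof
    fix x show "(p \<circ> (i \<circ> h)) x = 0 x"
      using S(7) iD(3) pD(3) LinD(1,2)[OF assms(2) h] by (cases "x \<in> carr X") auto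
  qed
  show "\<exists>x\<in>Lin X A. i \<circ> x = h" if h: "h \<in> Lin X B" "p \<circ> h = 0" for h
  proof (intro bexI[of _ "r \<circ> h"])
    show "r \<circ> h \<in> Lin X A" by (rule Lin_comp[OF assms(2) S(2,1) h(1) r])
    show "i \<circ> (r \<circ> h) = h"
    proof
      fix x show "(i \<circ> (r \<circ> h)) x = h x"
      proof (cases "x \<in> carr X")
        case True
        have "p (h x) = 0" using h(2) by (auto simp: fun_eq_iff)
        then show ?thesis using id[of "h x"] LinD(1)[OF assms(2) h(1) True] sD(3) by simp
      qed (use LinD[OF assms(2) h(1)] iD rD in auto)
    qed
  qed
  show "\<exists>y\<in>Lin X B. p \<circ> y = h" if h: "h \<in> Lin X C" for h
  proof (intro bexI[of _ "s \<circ> h"])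
    show "s \<circ> h \<in> Lin X B" by (rule Lin_comp[OF assms(2) S(3,2) h s])
    show "p \<circ> (s \<circ> h) = h"
    proof
      fix x show "(p \<circ> (s \<circ> h)) x = h x"
        using ps pD sD LinD[OF assms(2) h] by (cases "x \<in> carr X") auto
    qed
  qed
qed

lemma coboundary_precomp:
  assumes "coord M" "coord N" "coord X" "f \<in> Hom M N" "h \<in> Lin N X"
  shows "coboundary M X (h \<circ> f) = (\<lambda>a. coboundary N X h a \<circ> f)"
proof (rule ext, rule ext)
  note n = coord_lmoduleD[OF assms(2)]
  note h = LinD[OF assms(2,5)] and f = HomD[OF assms(4)]
  fix a x
  show "coboundary M X (h \<circ> f) a x = (coboundary N X h a \<circ> f) x"
    using h f n coord_lmoduleD[OF assms(3)]
    by (cases "x \<in> carr M") (auto simp: coboundary_def)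
qed

lemma coboundary_postcomp:
  assumes "coord X" "coord M" "coord N" "f \<in> Hom M N" "h \<in> Lin X M"
  shows "coboundary X N (f \<circ> h) = (\<lambda>a. f \<circ> coboundary X M h a)"
proof (rule ext, rule ext)
  note h = LinD[OF assms(1,5)] and f = HomD[OF assms(4)] coord_Hom_diff[OF assms(2) assms(4)]
  fix a x
  show "coboundary X N (f \<circ> h) a x = (f \<circ> coboundary X M h a) x"
    by (simp add: coboundary_def f(4,5,6) h(1) coord_lmoduleD(5)[OF assms(1)]
        coord_lmoduleD(5)[OF assms(2)])
qed

lemma Coc_precomp:
  assumes "coord M" "coord N" "coord X" "f \<in> Hom M N" "d \<in> Coc N X"
  shows "(\<lambda>a. d a \<circ> f) \<in> Coc M X"
  using HomD[OF assms(4)] CocD[OF assms(5)]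
  by (intro CocI Lin_comp[OF assms(1-3) Hom_in_Lin[OF assms(1,2,4)]]) (auto simp: fsc_apply)

lemma Coc_postcomp:
  assumes "coord X" "coord M" "coord N" "f \<in> Hom M N" "d \<in> Coc X M"
  shows "(\<lambda>a. f \<circ> d a) \<in> Coc X N"
proof -
  note f = HomD[OF assms(4)] and d = CocD[OF assms(5)]
    and dl = LinD[OF assms(1) CocD(1)[OF assms(5)]]
  note fsc' = LinD(6)[OF assms(2) Hom_in_Lin[OF assms(2-4)]]
  note x = coord_lmoduleD(5)[OF assms(1)] and m = coord_lmoduleD(5)[OF assms(2)]
  show ?thesis
    by (intro CocI Lin_comp[OF assms(1-3) _ Hom_in_Lin[OF assms(2-4)]] d(1))
      (simp_all add: f d(2-4) dl(1) fsc' x m fsc_apply)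
qed

lemma lin_map_Coc_precomp:
  assumes "coord M" "coord N" "coord X" "f \<in> Hom M N"
  shows "lin_map (fsc (fsc ksc)) (fsc (fsc ksc)) (Coc N X) (Coc M X) (\<lambda>d a. d a \<circ> f)"
  using Coc_subspace[OF assms(2,3)] Coc_subspace[OF assms(1,3)] Coc_precomp[OF assms]
  by (auto simp: lin_map_def fsc_apply fun_eq_iff)

lemma lin_map_Coc_postcomp:
  assumes "coord X" "coord M" "coord N" "f \<in> Hom M N"
  shows "lin_map (fsc (fsc ksc)) (fsc (fsc ksc)) (Coc X M) (Coc X N) (\<lambda>d a. f \<circ> d a)"
proof -
  have *: "f (g x + g' x) = f (g x) + f (g' x)" "f (ksc c (g x)) = ksc c (f (g x))"
    if g: "g \<in> Lin X M" "g' \<in> Lin X M" for g g' c x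
    using lin_map_postcomp[OF assms(1-3) Hom_in_Lin[OF assms(2-4)]] g
    by (auto simp: lin_map_def fun_eq_iff fsc_apply)
  show ?thesis
    using Coc_subspace[OF assms(1,2)] Coc_subspace[OF assms(1,3)] Coc_postcomp[OF assms]
      *[OF CocD(1) CocD(1)]
    by (auto simp: lin_map_def fsc_apply fun_eq_iff)
qed

text \<open>
  Cocycles are left exact in both arguments without any assumption on the algebra; right exactness
  is a hypothesis of the next two lemmas.
\<close>

lemma Coc_exact_contra:
  assumes "ses A i B p C" "coord X" and surj: "\<And>d. d \<in> Coc A X \<Longrightarrow> \<exists>d'\<in>Coc B X. (\<lambda>a. d' a \<circ> i) = d"
  shows "short_exact (fsc (fsc ksc)) (Coc C X) (Coc B X) (Coc A X) (\<lambda>d a. d a \<circ> p) (\<lambda>d a. d a \<circ> i)"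
  unfolding short_exact_def
proof (intro conjI ballI impI)
  note S = sesD[OF assms(1)]
  note ex = Lin_exact_contra[OF assms(1,2), unfolded short_exact_def]
  show "lin_map (fsc (fsc ksc)) (fsc (fsc ksc)) (Coc C X) (Coc B X) (\<lambda>d a. d a \<circ> p)"
    "lin_map (fsc (fsc ksc)) (fsc (fsc ksc)) (Coc B X) (Coc A X) (\<lambda>d a. d a \<circ> i)"
    by (rule lin_map_Coc_precomp[OF S(2,3) assms(2) S(5)], rule lin_map_Coc_precomp[OF S(1,2)
      assms(2) S(4)])
  show "d = 0" if d: "d \<in> Coc C X" "(\<lambda>a. d a \<circ> p) = 0" for d
  proof
    fix a show "d a = 0 a" using ex CocD(1)[OF d(1)] fun_cong[OF d(2), of a] by simp
  qed
  show "(\<lambda>a. d a \<circ> p \<circ> i) = 0" if d: "d \<in> Coc C X" for d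
  proof
    fix a show "d a \<circ> p \<circ> i = 0 a" using ex CocD(1)[OF d(1)] by simp
  qed
  show "\<exists>e\<in>Coc C X. (\<lambda>a. e a \<circ> p) = d" if d: "d \<in> Coc B X" "(\<lambda>a. d a \<circ> i) = 0" for d
  proof -
    have "\<exists>h\<in>Lin C X. h \<circ> p = d a" for a using ex CocD(1)[OF d(1)] fun_cong[OF d(2), of a] by simp
    then obtain e where e: "\<And>a. e a \<in> Lin C X" "\<And>a. e a \<circ> p = d a" by metis
    have e': "e a (p y) = d a y" for a y using e(2) by (metis comp_apply)
    note p = HomD[OF S(5)] and dD = CocD[OF d(1)]
    have "e \<in> Coc C X"
    proof (rule CocI[OF e(1)])
      fix a b c z assume "z \<in> carr C"
      then obtain y where y: "y \<in> carr B" "z = p y" using S(9) by blast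
      show "e (a + b) z = e a z + e b z" "e (sc c a) z = ksc c (e a z)"
        "e (a * b) z = act X a (e b z) + e a (act C b z)"
        using y e' dD p by (auto simp: fsc_apply simp flip: p(4))
    qed
    then show ?thesis using e by (intro bexI[of _ e]) auto
  qed
  show "\<exists>e\<in>Coc B X. (\<lambda>a. e a \<circ> i) = d" if "d \<in> Coc A X" for d using surj that by blast
qed

lemma Coc_exact_co:
  assumes "ses A i B p C" "coord X" and surj: "\<And>d. d \<in> Coc X C \<Longrightarrow> \<exists>d'\<in>Coc X B. (\<lambda>a. p \<circ> d' a) = d"
  shows "short_exact (fsc (fsc ksc)) (Coc X A) (Coc X B) (Coc X C) (\<lambda>d a. i \<circ> d a) (\<lambda>d a. p \<circ> d a)"
  unfolding short_exact_def
proof (intro conjI ballI impI)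
  note S = sesD[OF assms(1)]
  note ex = Lin_exact_co[OF assms(1,2), unfolded short_exact_def]
  show "lin_map (fsc (fsc ksc)) (fsc (fsc ksc)) (Coc X A) (Coc X B) (\<lambda>d a. i \<circ> d a)"
    "lin_map (fsc (fsc ksc)) (fsc (fsc ksc)) (Coc X B) (Coc X C) (\<lambda>d a. p \<circ> d a)"
    by (rule lin_map_Coc_postcomp[OF assms(2) S(1,2,4)], rule lin_map_Coc_postcomp[OF assms(2)
      S(2,3,5)])
  show "d = 0" if d: "d \<in> Coc X A" "(\<lambda>a. i \<circ> d a) = 0" for d
  proof
    fix a show "d a = 0 a" using ex CocD(1)[OF d(1)] fun_cong[OF d(2), of a] by simp
  qed
  show "(\<lambda>a. p \<circ> (i \<circ> d a)) = 0" if d: "d \<in> Coc X A" for d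
  proof
    fix a show "p \<circ> (i \<circ> d a) = 0 a" using ex CocD(1)[OF d(1)] by simp
  qed
  show "\<exists>e\<in>Coc X A. (\<lambda>a. i \<circ> e a) = d" if d: "d \<in> Coc X B" "(\<lambda>a. p \<circ> d a) = 0" for d
  proof -
    have "\<exists>h\<in>Lin X A. i \<circ> h = d a" for a using ex CocD(1)[OF d(1)] fun_cong[OF d(2), of a] by simp
    then obtain e where e: "\<And>a. e a \<in> Lin X A" "\<And>a. i \<circ> e a = d a" by metis
    have e': "i (e a y) = d a y" for a y using e(2) by (metis comp_apply)
    note i = HomD[OF S(4)] coord_Hom_diff[OF S(1) S(4)] and dD = CocD[OF d(1)]
    note eD = LinD[OF assms(2) e(1)]
    note a = coordD[OF S(1)] coord_lmoduleD[OF S(1)] and x = coord_lmoduleD[OF assms(2)]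
    have inj: "u = v" if "u \<in> carr A" "v \<in> carr A" "i u = i v" for u v
      using S(6)[of "u - v"] that i a by auto
    have isc: "i (ksc c u) = ksc c (i u)" if "u \<in> carr A" for c u
      using Hom_lin_map[OF S(1,2,4)] that by (auto simp: lin_map_def)
    have "e \<in> Coc X A"
    proof (rule CocI[OF e(1)])
      fix a b c z assume z: "z \<in> carr X"
      show "e (a + b) z = e a z + e b z"
        by (rule inj) (simp_all add: z eD(1) a(8) i(3) e' dD(2))
      show "e (sc c a) z = ksc c (e a z)"
        by (rule inj) (simp_all add: z eD(1) a(4) isc e' dD(3) fsc_apply)
      show "e (a * b) z = act A a (e b z) + e a (act X b z)"
        by (rule inj) (simp_all add: z eD(1) a(8,11) x(5) i(3,4) e' dD(4))
    qed
    then show ?thesis using e by (intro bexI[of _ e]) auto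
  qed
  show "\<exists>e\<in>Coc X B. (\<lambda>a. p \<circ> e a) = d" if "d \<in> Coc X C" for d using surj that by blast
qed

end

section \<open>Isomorphisms and coordinate models\<close>

text \<open>Mutually inverse isomorphisms of modules.\<close>

definition inverse_homs ::
  "('a::ring_1, 'v::ab_group_add) lmodule \<Rightarrow> ('a, 'w::ab_group_add) lmodule \<Rightarrow> ('v \<Rightarrow> 'w) \<Rightarrow>
   ('w \<Rightarrow> 'v) \<Rightarrow> bool" where
  "inverse_homs M N f g \<longleftrightarrow> f \<in> Hom M N \<and> g \<in> Hom N M \<and>
     (\<forall>x\<in>carr M. g (f x) = x) \<and> (\<forall>y\<in>carr N. f (g y) = y)"

lemma inverse_homsD:
  assumes "inverse_homs M N f g"
  shows "f \<in> Hom M N" "g \<in> Hom N M" "x \<in> carr M \<Longrightarrow> g (f x) = x" "y \<in> carr N \<Longrightarrow> f (g y) = y"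
  using assms by (auto simp: inverse_homs_def)

lemma inverse_homs_sym: "inverse_homs M N f g \<Longrightarrow> inverse_homs N M g f"
  by (simp add: inverse_homs_def)

lemma isomorphicE:
  assumes "isomorphic M N"
  obtains f g where "inverse_homs M N f g"
proof -
  obtain f g where fg: "f \<in> Hom M N" "g \<in> Hom N M" "g \<circ> f = id_hom M" "f \<circ> g = id_hom N"
    using assms unfolding isomorphic_def by blast
  have "g (f x) = x" if "x \<in> carr M" for x using fun_cong[OF fg(3), of x] that
    by (simp add: id_hom_def)
  moreover have "f (g y) = y" if "y \<in> carr N" for y
    using fun_cong[OF fg(4), of y] that by (simp add: id_hom_def)
  ultimately show ?thesis using fg(1,2) by (intro that[of f g]) (simp add: inverse_homs_def)
qed

text \<open>Transport of a homomorphism along isomorphisms.\<close>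

lemma Hom_transport:
  assumes M: "is_lmodule M" "is_lmodule M'" and N: "is_lmodule N" "is_lmodule N'"
    and \<mu>: "inverse_homs M M' \<mu> \<mu>'" and \<nu>: "inverse_homs N N' \<nu> \<nu>'" and f: "f \<in> Hom M N"
  shows "\<nu> \<circ> (f \<circ> \<mu>') \<in> Hom M' N'" "\<nu> \<circ> (f \<circ> \<mu>') = 0 \<Longrightarrow> f = 0"
proof -
  note m = inverse_homsD[OF \<mu>] and n = inverse_homsD[OF \<nu>]
  show "\<nu> \<circ> (f \<circ> \<mu>') \<in> Hom M' N'" by (rule Hom_comp[OF M(2) N Hom_comp[OF M(2,1) N(1) m(2) f] n(1)])
  assume 0: "\<nu> \<circ> (f \<circ> \<mu>') = 0"
  show "f = 0"
  proof
    fix x show "f x = 0 x"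
    proof (cases "x \<in> carr M")
      case True
      have "\<nu> (f x) = 0" using fun_cong[OF 0, of "\<mu> x"] m(3)[OF True] by simp
      then show ?thesis using n(3)[OF HomD(1)[OF f True]] Hom_diff(1)[OF N(2) n(2)] by simp
    qed (use HomD(2)[OF f] in simp)
  qed
qed

lemma isomorphicI:
  assumes "is_lmodule M" "is_lmodule N" "f \<in> Hom M N" "g \<in> Hom N M"
    "\<And>x. x \<in> carr M \<Longrightarrow> g (f x) = x" "\<And>y. y \<in> carr N \<Longrightarrow> f (g y) = y"
  shows "isomorphic M N"
  unfolding isomorphic_def
proof (intro bexI conjI)
  show "g \<circ> f = id_hom M" "f \<circ> g = id_hom N"
    using assms(5,6) HomD(2)[OF assms(3)] HomD(2)[OF assms(4)]
      Hom_diff(1)[OF assms(1,3)] Hom_diff(1)[OF assms(2,4)]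
    by (auto simp: id_hom_def fun_eq_iff)
qed (use assms in auto)

lemma isomorphic_trans:
  assumes "is_lmodule M" "is_lmodule N" "is_lmodule K" "isomorphic M N" "isomorphic N K"
  shows "isomorphic M K"
proof -
  obtain f g where "inverse_homs M N f g" using isomorphicE[OF assms(4)] .
  note fg = inverse_homsD[OF this]
  obtain f' g' where "inverse_homs N K f' g'" using isomorphicE[OF assms(5)] .
  note fg' = inverse_homsD[OF this]
  show ?thesis
    by (rule isomorphicI[OF assms(1,3) Hom_comp[OF assms(1-3) fg(1) fg'(1)] Hom_comp[OF
      assms(3,2,1) fg'(2) fg(2)]])
      (simp_all add: fg fg' HomD(1)[OF fg(1)] HomD(1)[OF fg'(2)])
qed

context fd_algebra
begin

lemma coord_fd:
  assumes "coord M"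
  shows "fd_module sc M"
proof -
  obtain B where B: "B \<subseteq> carr M" "kv.independent B" "carr M \<subseteq> kv.span B"
    using kv.maximal_independent_subset by blast
  have fin: "finite B"
    using coordD(3)[OF assms] B kv.independent_span_bound unfolding finspan_def
      by (meson order_trans)
  have "\<exists>c. x = (\<Sum>b\<in>B. act M (sc (c b) 1) b)" if "x \<in> carr M" for x
  proof -
    have "x \<in> range (\<lambda>c. \<Sum>b\<in>B. ksc (c b) b)" using that B(3) kv.span_finite[OF fin] by blast
    then obtain c where "x = (\<Sum>b\<in>B. ksc (c b) b)" by auto
    also have "\<dots> = (\<Sum>b\<in>B. act M (sc (c b) 1) b)"
      using assms B(1) by (intro sum.cong) (auto simp: coord_def)
    finally show ?thesis by blast
  qed
  then show ?thesis using B(1) fin coordD(1)[OF assms] by (auto simp: fd_module_def)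
qed

lemma fd_lmodule: "fd_module sc M \<Longrightarrow> is_lmodule M"
  by (simp add: fd_module_def)

text \<open>
  Map a coordinate space onto \<open>M\<close> by a finite generating family and restrict to a linear
  complement of the kernel.
\<close>

lemma ex_coord:
  fixes M :: "('a, 'v::ab_group_add) lmodule"
  assumes "fd_module sc M"
  shows "\<exists>N. coord N \<and> isomorphic M N"
proof -
  note m = is_lmoduleD[OF fd_lmodule[OF assms]]
  define s where "s c x = act M (sc c 1) x" for c x
  obtain B where B: "B \<subseteq> carr M" "finite B" "\<And>x. x \<in> carr M \<Longrightarrow> \<exists>c. x = (\<Sum>b\<in>B. s (c b) b)"
    using assms by (auto simp: fd_module_def s_def)
  have s_in: "s c x \<in> carr M" if "x \<in> carr M" for c x using that m by (simp add: s_def)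
  have s_add: "s (c + d) x = s c x + s d x" if "x \<in> carr M" for c d x
    using that m by (simp add: s_def scale_left_distrib)
  have s_addr: "s c (x + y) = s c x + s c y" if "x \<in> carr M" "y \<in> carr M" for c x y
    using that m by (simp add: s_def)
  have sc_mult: "sc (c * d) 1 = sc c 1 * sc d 1" for c d
    by (metis mult_scale_left mult_1_left scale_scale)
  have s_mult: "s (c * d) x = s c (s d x)" if "x \<in> carr M" for c d x
    using that m by (simp add: s_def sc_mult)
  have s_0: "s c 0 = 0" for c using m by (simp add: s_def)
  have sum_in: "(\<Sum>i\<in>I. f i) \<in> carr M" if "\<And>i. i \<in> I \<Longrightarrow> f i \<in> carr M" for I :: "nat set" and f
    using that by (induction I rule: infinite_finite_induct) (auto simp: m)
  have s_sum: "s c (\<Sum>i\<in>I. f i) = (\<Sum>i\<in>I. s c (f i))"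
    if "\<And>i. i \<in> I \<Longrightarrow> f i \<in> carr M" for I :: "nat set" and f c
    using that by (induction I rule: infinite_finite_induct) (auto simp: s_0 s_addr sum_in)
  obtain d b where b: "bij_betw b {..<d::nat} B"
    using ex_bij_betw_nat_finite[OF B(2)] by (auto simp: lessThan_atLeast0)
  have bM: "b i \<in> carr M" if "i < d" for i using b B that by (auto simp: bij_betw_def)
  define V where "V = {x :: nat \<Rightarrow> 'k. \<forall>i\<ge>d. x i = 0}"
  have V: "kv.subspace V" by (auto simp: kv.subspace_def V_def ksc_def)
  have finV: "finspan ksc V"
    unfolding finspan_def
  proof (intro exI[of _ "(\<lambda>i j. if i = j then 1 else 0) ` {..<d}"] conjI subsetI)
    fix x assume x: "x \<in> V"
    have eq: "x j = (\<Sum>i<d. ksc (x i) (\<lambda>j. if i = j then 1 else 0) j)" for j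
    proof -
      have "(\<Sum>i<d. ksc (x i) (\<lambda>j. if i = j then 1 else 0) j) = (\<Sum>i<d. if i = j then x i else 0)"
        by (rule sum.cong) (auto simp: ksc_def)
      also have "\<dots> = x j" using x by (simp add: V_def)
      finally show ?thesis by simp
    qed
    have sum_apply: "(\<Sum>i\<in>I. f i) j = (\<Sum>i\<in>I. f i j)" for f :: "nat \<Rightarrow> nat \<Rightarrow> 'k" and I j
      by (induction I rule: infinite_finite_induct) auto
    have "x = (\<Sum>i<d. ksc (x i) (\<lambda>j. if i = j then 1 else 0))"
      by (rule ext, rule trans[OF eq sum_apply[symmetric]])
    also have "\<dots> \<in> kv.span ((\<lambda>i j. if i = j then 1 else 0) ` {..<d})"
      by (intro kv.span_sum kv.span_scale kv.span_base) auto
    finally show "x \<in> kv.span ((\<lambda>i j. if i = j then 1 else 0) ` {..<d})" .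
  qed simp
  define \<phi> where "\<phi> x = (\<Sum>i<d. s (x i) (b i))" for x :: "nat \<Rightarrow> 'k"
  have \<phi>_in: "\<phi> x \<in> carr M" for x unfolding \<phi>_def by (intro sum_in s_in bM) auto
  have \<phi>_add: "\<phi> (x + y) = \<phi> x + \<phi> y" for x y
    unfolding \<phi>_def sum.distrib[symmetric] by (intro sum.cong) (auto simp: s_add bM)
  have \<phi>_sc: "\<phi> (ksc c x) = s c (\<phi> x)" for c x
    unfolding \<phi>_def by (subst s_sum) (auto simp: s_in bM ksc_def s_mult)
  have \<phi>_diff: "\<phi> (x - y) = \<phi> x - \<phi> y" for x y using \<phi>_add[of "x - y" y] by simp
  have \<phi>_0: "\<phi> 0 = 0" using \<phi>_add[of 0 0] by simp
  define K where "K = {x\<in>V. \<phi> x = 0}"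
  have K: "kv.subspace K"
    using V unfolding kv.subspace_def K_def by (auto simp: \<phi>_add \<phi>_0 \<phi>_sc s_0)
  have "lin_map ksc ksc K V (\<lambda>x. x)" using K V by (auto simp: lin_map_def K_def)
  from lin_map_left_inverse[OF vs(1,1) this] obtain g
    where g: "lin_map ksc ksc V K g" and gK: "\<And>x. x \<in> K \<Longrightarrow> g x = x" by auto
  define C where "C = {x\<in>V. g x = 0}"
  have C: "kv.subspace C" unfolding C_def by (rule lin_map_kernel_subspace[OF vs(1,1) g])
  note Ccl = subspace_closed[OF vs(1) C]
  have \<phi>_inj: "x = y" if "x \<in> C" "y \<in> C" "\<phi> x = \<phi> y" for x y
  proof -
    have "x - y \<in> C" using that Ccl by auto
    moreover from this have "x - y \<in> K" using that by (auto simp: K_def C_def \<phi>_diff)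
    ultimately show ?thesis using gK[of "x - y"] by (auto simp: C_def)
  qed
  have \<phi>_surj: "\<exists>x\<in>C. \<phi> x = y" if y: "y \<in> carr M" for y
  proof -
    obtain e where "y = (\<Sum>b\<in>B. s (e b) b)" using B(3)[OF y] by blast
    also have "\<dots> = (\<Sum>i<d. s (e (b i)) (b i))" by (rule sum.reindex_bij_betw[OF b, symmetric])
    also have "\<dots> = \<phi> (\<lambda>i. if i < d then e (b i) else 0)" by (simp add: \<phi>_def)
    finally have "\<phi> (\<lambda>i. if i < d then e (b i) else 0) = y" by simp
    moreover have "(\<lambda>i. if i < d then e (b i) else 0) \<in> V" by (simp add: V_def)
    ultimately obtain x where x: "x \<in> V" "\<phi> x = y" by blast
    have gx: "g x \<in> K" using g x by (auto simp: lin_map_def)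
    then have "g x \<in> V" "\<phi> (g x) = 0" by (auto simp: K_def)
    moreover from this have "x - g x \<in> C"
      using x gx gK lin_map_diff(2)[OF vs(1) g] subspace_closed(3)[OF vs(1) V] by (simp add: C_def)
    ultimately show ?thesis using x \<phi>_diff by (intro bexI[of _ "x - g x"]) auto
  qed
  define \<psi> where "\<psi> y = (if y \<in> carr M then THE x. x \<in> C \<and> \<phi> x = y else 0)" for y
  have \<psi>: "\<psi> y \<in> C \<and> \<phi> (\<psi> y) = y" if "y \<in> carr M" for y
  proof -
    have "\<exists>!x. x \<in> C \<and> \<phi> x = y" using \<phi>_surj[OF that] \<phi>_inj by blast
    from theI'[OF this] show ?thesis using that by (simp add: \<psi>_def)
  qed
  have \<psi>C: "\<psi> y \<in> C" and \<phi>\<psi>: "\<phi> (\<psi> y) = y" if "y \<in> carr M" for y using \<psi>[OF that] by auto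
  have \<psi>\<phi>: "\<psi> (\<phi> x) = x" if "x \<in> C" for x using \<phi>_inj that \<psi>C \<phi>\<psi> \<phi>_in by blast
  have \<psi>_add: "\<psi> (x + y) = \<psi> x + \<psi> y" if "x \<in> carr M" "y \<in> carr M" for x y
    by (rule \<phi>_inj) (simp_all add: that \<psi>C Ccl m \<phi>\<psi> \<phi>_add)
  define N where "N = LModule C (\<lambda>a c. \<psi> (act M a (\<phi> c)))"
  have cN: "carr N = C" and aN: "act N a c = \<psi> (act M a (\<phi> c))" for a c by (auto simp: N_def)
  have N: "is_lmodule N"
    unfolding is_lmodule_def cN aN
    by (simp add: Ccl \<psi>C \<phi>_in m \<phi>_add \<psi>_add \<phi>\<psi> \<psi>\<phi>)
  have "act N (sc c 1) x = ksc c x" if "x \<in> C" for c x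
    unfolding aN s_def[symmetric] \<phi>_sc[symmetric] by (rule \<psi>\<phi>[OF Ccl(5)[OF that]])
  then have "coord N"
    using N C finspan_subset[OF finV, of C] by (auto simp: coord_def cN C_def)
  moreover have "isomorphic M N"
  proof (rule isomorphicI[OF fd_lmodule[OF assms] N])
    show "\<psi> \<in> Hom M N"
      by (auto simp: Hom_def cN aN \<psi>C \<psi>_add \<phi>\<psi>) (simp add: \<psi>_def)
    show "(\<lambda>c. if c \<in> C then \<phi> c else 0) \<in> Hom N M"
      by (auto simp: Hom_def cN aN \<phi>_in \<phi>_add Ccl \<psi>C \<phi>\<psi> m)
  qed (auto simp: cN \<psi>C \<phi>\<psi> \<psi>\<phi>)
  ultimately show ?thesis by blast
qed

text \<open>
  Relative projectivity and injectivity may be tested on coordinate models, with epimorphisms and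
  monomorphisms replaced by surjections and injections, in classes with cokernels or kernels.
\<close>

lemma projective_wrtI:
  fixes P :: "('a, 'w::ab_group_add) lmodule"
  assumes P: "is_lmodule P" and fd: "\<And>X. X \<in> \<A> \<Longrightarrow> fd_module sc X"
    and iso: "\<And>X Y. X \<in> \<A> \<Longrightarrow> coord Y \<Longrightarrow> isomorphic X Y \<Longrightarrow> Y \<in> \<A>"
    and coker: "\<And>X Y f p Q. X \<in> \<A> \<Longrightarrow> Y \<in> \<A> \<Longrightarrow> coord X \<Longrightarrow> coord Y \<Longrightarrow> f \<in> Hom X Y \<Longrightarrow>
      ses (submod Y (f ` carr X)) (id_hom (submod Y (f ` carr X))) Y p Q \<Longrightarrow> Q \<in> \<A>"
    and lift: "\<And>X Y g f. X \<in> \<A> \<Longrightarrow> Y \<in> \<A> \<Longrightarrow> coord X \<Longrightarrow> coord Y \<Longrightarrow> g \<in> Hom X Y \<Longrightarrow>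
      (\<forall>y\<in>carr Y. \<exists>x\<in>carr X. g x = y) \<Longrightarrow> f \<in> Hom P Y \<Longrightarrow> \<exists>h\<in>Hom P X. g \<circ> h = f"
  shows "projective_wrt \<A> P"
  unfolding projective_wrt_def
proof (intro ballI allI impI)
  fix X Y g f assume X: "X \<in> \<A>" and Y: "Y \<in> \<A>" and epi: "epi_in \<A> X Y g" and f: "f \<in> Hom P Y"
  note mX = fd_lmodule[OF fd[OF X]] and mY = fd_lmodule[OF fd[OF Y]]
  have g: "g \<in> Hom X Y" using epi by (simp add: epi_in_def)
  obtain X' where X': "coord X'" "isomorphic X X'" using ex_coord[OF fd[OF X]] by blast
  obtain Y' where Y': "coord Y'" "isomorphic Y Y'" using ex_coord[OF fd[OF Y]] by blast
  note mX' = coordD(1)[OF X'(1)] and mY' = coordD(1)[OF Y'(1)]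
  obtain \<alpha> \<alpha>' where "inverse_homs X X' \<alpha> \<alpha>'" using isomorphicE[OF X'(2)] .
  note \<alpha> = inverse_homsD[OF this]
  obtain \<beta> \<beta>' where "inverse_homs Y Y' \<beta> \<beta>'" using isomorphicE[OF Y'(2)] .
  note \<beta> = inverse_homsD[OF this]
  define g' where "g' = \<beta> \<circ> (g \<circ> \<alpha>')"
  have g': "g' \<in> Hom X' Y'" unfolding g'_def
    by (rule Hom_comp[OF mX' mY mY' Hom_comp[OF mX' mX mY \<alpha>(2) g] \<beta>(1)])
  have XA: "X' \<in> \<A>" and YA: "Y' \<in> \<A>" using iso X Y X' Y' by auto
  let ?U = "submod Y' (g' ` carr X')"
  \<comment> \<open>an epimorphism is surjective: its cokernel map and the zero map agree after \<open>g\<close>\<close>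
  obtain p Q where pQ: "ses ?U (id_hom ?U) Y' p Q"
    using ses_quotient[OF Y'(1) image_submodule[OF mX' mY' g']] by blast
  note S = sesD[OF pQ]
  have "Q \<in> \<A>" by (rule coker[OF XA YA X'(1) Y'(1) g' pQ])
  moreover have "p \<circ> \<beta> \<in> Hom Y Q" by (rule Hom_comp[OF mY mY' coordD(1)[OF S(3)] \<beta>(1) S(5)])
  moreover have "0 \<in> Hom Y Q" by (rule zero_in_Hom[OF coordD(1)[OF S(3)]])
  moreover have "p \<circ> \<beta> \<circ> g = 0 \<circ> g"
  proof
    fix x show "(p \<circ> \<beta> \<circ> g) x = (0 \<circ> g) x"
    proof (cases "x \<in> carr X")
      case True
      have "\<beta> (g x) = g' (\<alpha> x)" using \<alpha>(3)[OF True] by (simp add: g'_def)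
      then have "\<beta> (g x) \<in> carr ?U" using HomD(1)[OF \<alpha>(1) True] by auto
      then show ?thesis using S(7)[of "\<beta> (g x)"] by (simp add: id_hom_def)
    next
      case False
      then show ?thesis using HomD(2)[OF g False] Hom_diff(1)[OF mY \<beta>(1)] Hom_diff(1)[OF mY'
        S(5)] by simp
    qed
  qed
  ultimately have p0: "p \<circ> \<beta> = 0" using epi unfolding epi_in_def by blast
  have "\<exists>x\<in>carr X'. g' x = y" if y: "y \<in> carr Y'" for y
  proof -
    have "p y = 0" using fun_cong[OF p0, of "\<beta>' y"] \<beta>(4)[OF y] by simp
    then obtain x where "x \<in> carr ?U" "id_hom ?U x = y" using S(8)[OF y] by blast
    then show ?thesis by (auto simp: id_hom_def)
  qed
  moreover have "\<beta> \<circ> f \<in> Hom P Y'" by (rule Hom_comp[OF P mY mY' f \<beta>(1)])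
  ultimately obtain h where h: "h \<in> Hom P X'" "g' \<circ> h = \<beta> \<circ> f"
    using lift[OF XA YA X'(1) Y'(1) g', of "\<beta> \<circ> f"] by blast
  have "g \<circ> (\<alpha>' \<circ> h) = f"
  proof
    fix x show "(g \<circ> (\<alpha>' \<circ> h)) x = f x"
    proof (cases "x \<in> carr P")
      case True
      have "\<beta> (g (\<alpha>' (h x))) = \<beta> (f x)" using fun_cong[OF h(2), of x] by (simp add: g'_def)
      moreover have "g (\<alpha>' (h x)) \<in> carr Y"
        using HomD(1)[OF g HomD(1)[OF \<alpha>(2) HomD(1)[OF h(1) True]]] .
      ultimately show ?thesis using \<beta>(3) HomD(1)[OF f True] by (metis comp_apply)
    next
      case False
      then show ?thesis
        using HomD(2)[OF h(1)] HomD(2)[OF f] Hom_diff(1)[OF mX' \<alpha>(2)] Hom_diff(1)[OF mX g] by simp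
    qed
  qed
  then show "\<exists>h\<in>Hom P X. g \<circ> h = f" using Hom_comp[OF P mX' mX h(1) \<alpha>(2)] by blast
qed

lemma injective_wrtI:
  fixes P :: "('a, 'w::ab_group_add) lmodule"
  assumes P: "is_lmodule P" and fd: "\<And>X. X \<in> \<A> \<Longrightarrow> fd_module sc X"
    and iso: "\<And>X Y. X \<in> \<A> \<Longrightarrow> coord Y \<Longrightarrow> isomorphic X Y \<Longrightarrow> Y \<in> \<A>"
    and ker: "\<And>X Y f. X \<in> \<A> \<Longrightarrow> Y \<in> \<A> \<Longrightarrow> coord X \<Longrightarrow> coord Y \<Longrightarrow> f \<in> Hom X Y \<Longrightarrow>
      submod X {x\<in>carr X. f x = 0} \<in> \<A>"
    and extend: "\<And>X Y g f. X \<in> \<A> \<Longrightarrow> Y \<in> \<A> \<Longrightarrow> coord X \<Longrightarrow> coord Y \<Longrightarrow> g \<in> Hom X Y \<Longrightarrow>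
      (\<forall>x\<in>carr X. g x = 0 \<longrightarrow> x = 0) \<Longrightarrow> f \<in> Hom X P \<Longrightarrow> \<exists>h\<in>Hom Y P. h \<circ> g = f"
  shows "injective_wrt \<A> P"
  unfolding injective_wrt_def
proof (intro ballI allI impI)
  fix X Y g f assume X: "X \<in> \<A>" and Y: "Y \<in> \<A>" and mono: "mono_in \<A> X Y g" and f: "f \<in> Hom X P"
  note mX = fd_lmodule[OF fd[OF X]] and mY = fd_lmodule[OF fd[OF Y]]
  have g: "g \<in> Hom X Y" using mono by (simp add: mono_in_def)
  obtain X' where X': "coord X'" "isomorphic X X'" using ex_coord[OF fd[OF X]] by blast
  obtain Y' where Y': "coord Y'" "isomorphic Y Y'" using ex_coord[OF fd[OF Y]] by blast
  note mX' = coordD(1)[OF X'(1)] and mY' = coordD(1)[OF Y'(1)]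
  obtain \<alpha> \<alpha>' where "inverse_homs X X' \<alpha> \<alpha>'" using isomorphicE[OF X'(2)] .
  note \<alpha> = inverse_homsD[OF this]
  obtain \<beta> \<beta>' where "inverse_homs Y Y' \<beta> \<beta>'" using isomorphicE[OF Y'(2)] .
  note \<beta> = inverse_homsD[OF this]
  define g' where "g' = \<beta> \<circ> (g \<circ> \<alpha>')"
  have g': "g' \<in> Hom X' Y'" unfolding g'_def
    by (rule Hom_comp[OF mX' mY mY' Hom_comp[OF mX' mX mY \<alpha>(2) g] \<beta>(1)])
  have XA: "X' \<in> \<A>" and YA: "Y' \<in> \<A>" using iso X Y X' Y' by auto
  \<comment> \<open>a monomorphism is injective: the inclusion of its kernel and the zero map agree before \<open>g\<close>\<close>
  define K where "K = submod X' {x\<in>carr X'. g' x = 0}"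
  have KA: "K \<in> \<A>" unfolding K_def by (rule ker[OF XA YA X'(1) Y'(1) g'])
  have nK: "coord K"
    unfolding K_def by (rule coord_submod[OF X'(1) kernel_submodule[OF mX' mY' g']])
  have "id_hom K \<in> Hom K X'"
    using coord_lmoduleD[OF nK] by (auto simp: Hom_def id_hom_def K_def)
  then have "\<alpha>' \<circ> id_hom K \<in> Hom K X" by (rule Hom_comp[OF coordD(1)[OF nK] mX' mX _ \<alpha>(2)])
  moreover have "0 \<in> Hom K X" by (rule zero_in_Hom[OF mX])
  moreover have "g \<circ> (\<alpha>' \<circ> id_hom K) = g \<circ> 0"
  proof
    fix x show "(g \<circ> (\<alpha>' \<circ> id_hom K)) x = (g \<circ> 0) x"
    proof (cases "x \<in> carr K")
      case True
      then have x: "x \<in> carr X'" and "\<beta> (g (\<alpha>' x)) = 0" by (auto simp: K_def g'_def)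
      then have "g (\<alpha>' x) = 0"
        using \<beta>(3)[OF HomD(1)[OF g HomD(1)[OF \<alpha>(2) x]]] Hom_diff(1)[OF mY' \<beta>(2)] by simp
      then show ?thesis using True Hom_diff(1)[OF mX g] by (simp add: id_hom_def)
    qed (use Hom_diff(1)[OF mX' \<alpha>(2)] in \<open>simp add: id_hom_def\<close>)
  qed
  ultimately have k0: "\<alpha>' \<circ> id_hom K = 0" using mono KA unfolding mono_in_def by blast
  have "x = 0" if x: "x \<in> carr X'" "g' x = 0" for x
  proof -
    have "\<alpha>' x = 0" using fun_cong[OF k0, of x] x by (simp add: id_hom_def K_def)
    then show ?thesis using \<alpha>(4)[OF x(1)] Hom_diff(1)[OF mX \<alpha>(1)] by simp
  qed
  moreover have "f \<circ> \<alpha>' \<in> Hom X' P" by (rule Hom_comp[OF mX' mX P \<alpha>(2) f])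
  ultimately obtain h where h: "h \<in> Hom Y' P" "h \<circ> g' = f \<circ> \<alpha>'"
    using extend[OF XA YA X'(1) Y'(1) g', of "f \<circ> \<alpha>'"] by blast
  have "h \<circ> \<beta> \<circ> g = f"
  proof
    fix x show "(h \<circ> \<beta> \<circ> g) x = f x"
    proof (cases "x \<in> carr X")
      case True
      then show ?thesis using fun_cong[OF h(2), of "\<alpha> x"] \<alpha>(3)[OF True] by (simp add: g'_def)
    next
      case False
      then show ?thesis
        using HomD(2)[OF g] HomD(2)[OF f] Hom_diff(1)[OF mY \<beta>(1)] Hom_diff(1)[OF mY' h(1)] by simp
    qed
  qed
  then show "\<exists>h\<in>Hom Y P. h \<circ> g = f" using Hom_comp[OF mY mY' P \<beta>(1) h(1)] by blast
qed

section \<open>Enough projectives\<close>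

text \<open>
  Projectivity, tested on modules on coordinate spaces and against surjective homomorphisms.
\<close>

definition lifting :: "('a, 'k) std_module \<Rightarrow> bool" where
  "lifting P \<longleftrightarrow> (\<forall>X Y g f. coord X \<longrightarrow> coord Y \<longrightarrow> g \<in> Hom X Y \<longrightarrow> (\<forall>y\<in>carr Y. \<exists>x\<in>carr X. g x = y) \<longrightarrow>
     f \<in> Hom P Y \<longrightarrow> (\<exists>h\<in>Hom P X. g \<circ> h = f))"

lemma liftingD:
  "lifting P \<Longrightarrow> coord X \<Longrightarrow> coord Y \<Longrightarrow> g \<in> Hom X Y \<Longrightarrow> (\<And>y. y \<in> carr Y \<Longrightarrow> \<exists>x\<in>carr X. g x = y) \<Longrightarrow>
    f \<in> Hom P Y \<Longrightarrow> \<exists>h\<in>Hom P X. g \<circ> h = f"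
  unfolding lifting_def by blast

lemma projective_iff_lifting:
  assumes "coord P"
  shows "projective_wrt (mod_cat sc :: ('a, 'k) std_module set) P \<longleftrightarrow> lifting P"
proof
  assume P: "projective_wrt (mod_cat sc :: ('a, 'k) std_module set) P"
  show "lifting P"
    unfolding lifting_def
  proof (intro allI impI)
    fix X Y g f
    assume X: "coord X" and Y: "coord Y" and g: "g \<in> Hom X Y"
      and surj: "\<forall>y\<in>carr Y. \<exists>x\<in>carr X. g x = y"
      and f: "f \<in> Hom P Y"
    have "u = v" if uv: "u \<in> Hom Y Z" "v \<in> Hom Y Z" "u \<circ> g = v \<circ> g" for u v
      and Z :: "('a, 'k) std_module"
    proof
      fix y show "u y = v y"
        using surj uv HomD(2)[OF uv(1), of y] HomD(2)[OF uv(2), of y] by (metis comp_apply)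
    qed
    then have "epi_in (mod_cat sc) X Y g" using g by (auto simp: epi_in_def)
    then show "\<exists>h\<in>Hom P X. g \<circ> h = f"
      using P X Y f coord_fd unfolding projective_wrt_def mod_cat_def by blast
  qed
next
  assume P: "lifting P"
  show "projective_wrt (mod_cat sc :: ('a, 'k) std_module set) P"
    by (rule projective_wrtI[OF coordD(1)[OF assms]])
      (use P coord_fd sesD(3) in \<open>auto simp: lifting_def mod_cat_def\<close>)
qed

text \<open>The zero module.\<close>

definition zmod :: "('a, 'k) std_module" where
  "zmod = LModule {0} (\<lambda>_ _. 0)"

lemma coord_zmod: "coord zmod"
proof -
  have "finspan ksc {0::nat \<Rightarrow> 'k}" unfolding finspan_def
    by (intro exI[of _ "{0}"]) (auto intro: kv.span_zero)
  then show ?thesis by (auto simp: coord_def zmod_def is_lmodule_def kv.subspace_def)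
qed

lemma lifting_zmod: "lifting zmod"
  unfolding lifting_def
proof (intro allI impI)
  fix X Y g f assume *: "coord X" "coord Y" "g \<in> Hom X Y" "f \<in> Hom zmod Y"
  have f: "f = 0"
  proof
    fix x show "f x = 0 x"
      using HomD(2)[OF *(4)] coord_Hom_diff(1)[OF coord_zmod *(4)]
        by (cases "x = 0") (auto simp: zmod_def)
  qed
  have "g \<circ> 0 = f" unfolding f using coord_Hom_diff(1)[OF *(1) *(3)] by auto
  then show "\<exists>h\<in>Hom zmod X. g \<circ> h = f" using zero_in_Hom[OF coordD(1)[OF *(1)]] by blast
qed

text \<open>
  A coordinate model of the regular module, with the image \<open>e\<close> of the unit as its generator.
\<close>

lemma ex_free_module:
  "\<exists>R e. coord R \<and> lifting R \<and> e \<in> carr R \<and> (\<forall>M m. coord M \<longrightarrow> m \<in> carr M \<longrightarrow> (\<exists>f\<in>Hom R M. f e = m))"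
proof -
  let ?A = "LModule UNIV (*) :: ('a, 'a) lmodule"
  have mA: "is_lmodule ?A" by (auto simp: is_lmodule_def algebra_simps)
  obtain B where B: "finite B" "span B = UNIV" using finite_dim by blast
  have "\<exists>c. x = (\<Sum>b\<in>B. sc (c b) 1 * b)" for x
  proof -
    have "x \<in> span B" using B by simp
    then show ?thesis unfolding span_finite[OF B(1)] by (auto simp: mult_scale_left)
  qed
  then have "fd_module sc ?A" using B mA by (auto simp: fd_module_def)
  then obtain R where R: "coord R" "isomorphic ?A R" using ex_coord by blast
  then obtain \<rho> \<rho>' where inv: "inverse_homs ?A R \<rho> \<rho>'" using isomorphicE by blast
  then have \<rho>: "\<rho> \<in> Hom ?A R" "\<rho>' \<in> Hom R ?A" "\<And>x. \<rho>' (\<rho> x) = x" "\<And>y. y \<in> carr R \<Longrightarrow> \<rho> (\<rho>' y) = y"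
    by (auto simp: inverse_homs_def)
  note h = HomD[OF \<rho>(1), simplified] and h' = HomD[OF \<rho>(2), simplified]
  have ex: "\<exists>f\<in>Hom R M. f (\<rho> 1) = m" if M: "coord M" "m \<in> carr M" for M m
  proof -
    note mm = coord_lmoduleD[OF M(1)] and r = coord_lmoduleD[OF R(1)]
    have "(\<lambda>x. if x \<in> carr R then act M (\<rho>' x) m else 0) \<in> Hom R M"
      using h' mm r M(2) by (auto simp: Hom_def)
    then show ?thesis using \<rho>(3) h mm M(2) by (intro bexI) auto
  qed
  have unique: "f = f'" if ff: "f \<in> Hom R M" "f' \<in> Hom R M" "f (\<rho> 1) = f' (\<rho> 1)" for f f'
    and M :: "('a, 'k) std_module"
  proof
    fix x show "f x = f' x"
    proof (cases "x \<in> carr R")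
      case True
      have "x = act R (\<rho>' x) (\<rho> 1)" using \<rho>(4)[OF True] HomD(4)[OF \<rho>(1), of 1 "\<rho>' x"] by simp
      then show ?thesis using HomD(4)[OF ff(1) h(1)] HomD(4)[OF ff(2) h(1)] ff(3) by metis
    qed (use HomD(2)[OF ff(1)] HomD(2)[OF ff(2)] in auto)
  qed
  have "lifting R"
    unfolding lifting_def
  proof (intro allI impI)
    fix X Y g f
    assume X: "coord X" and Y: "coord Y" and g: "g \<in> Hom X Y"
      and surj: "\<forall>y\<in>carr Y. \<exists>x\<in>carr X. g x = y"
      and f: "f \<in> Hom R Y"
    obtain x where x: "x \<in> carr X" "g x = f (\<rho> 1)" using surj HomD(1)[OF f h(1)] by blast
    obtain k where k: "k \<in> Hom R X" "k (\<rho> 1) = x" using ex[OF X x(1)] by blast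
    have "g \<circ> k = f"
      by (rule unique[OF Hom_comp[OF coordD(1)[OF R(1)] coordD(1)[OF X] coordD(1)[OF Y]
        k(1) g] f]) (simp add: k x)
    then show "\<exists>h\<in>Hom R X. g \<circ> h = f" using k by blast
  qed
  then show ?thesis using R ex h(1) by blast
qed

lemma zero_in_Coc: "coord M \<Longrightarrow> coord N \<Longrightarrow> 0 \<in> Coc M N"
  by (rule Coc_closed(1))

lemma extmod_zero:
  assumes "coord M" "coord N"
  shows "coord (extmod N M 0)" "carr (extmod N M 0) = {x. evc x \<in> carr N \<and> odc x \<in> carr M}"
    "act (extmod N M 0) a x = join (act N a (evc x)) (act M a (odc x))"
  using sesD(2)[OF ses_extmod[OF assms zero_in_Coc[OF assms]]] by (auto simp: extmod_def)

text \<open>Homomorphisms out of a direct sum.\<close>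

lemma Hom_copair:
  assumes "coord M" "coord N" "coord X" "f \<in> Hom N X" "g \<in> Hom M X"
  shows "(\<lambda>x. if x \<in> carr (extmod N M 0) then f (evc x) + g (odc x) else 0) \<in> Hom (extmod N M 0) X"
  using coord_lmoduleD[OF assms(3)] coord_lmoduleD[OF extmod_zero(1)[OF assms(1,2)]]
    coord_lmoduleD[OF assms(1)] coord_lmoduleD[OF assms(2)]
    HomD[OF assms(4)] HomD[OF assms(5)]
  by (auto simp: Hom_def extmod_zero[OF assms(1,2)] algebra_simps)

lemma Hom_decompose:
  assumes "coord M" "coord N" "coord X" "f \<in> Hom (extmod N M 0) X"
  shows "(\<lambda>x. if x \<in> carr N then f (join x 0) else 0) \<in> Hom N X"
    "(\<lambda>x. if x \<in> carr M then f (join 0 x) else 0) \<in> Hom M X"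
    "x \<in> carr (extmod N M 0) \<Longrightarrow> f x = f (join (evc x) 0) + f (join 0 (odc x))"
proof -
  note e = extmod_zero[OF assms(1,2)]
  note m = coord_lmoduleD[OF assms(1)] and n = coord_lmoduleD[OF assms(2)]
  note f = HomD[OF assms(4), unfolded e(2) mem_Collect_eq]
  have add: "f (join (u + u') (v + v')) = f (join u v) + f (join u' v')"
    if "u \<in> carr N" "u' \<in> carr N" "v \<in> carr M" "v' \<in> carr M" for u v u' v'
    using f(3)[of "join u v" "join u' v'"] that by simp
  have actf: "f (join (act N a u) (act M a v)) = act X a (f (join u v))"
    if "u \<in> carr N" "v \<in> carr M" for a u v
    using f(4)[of "join u v" a] that by (simp add: e(3))
  show "(\<lambda>x. if x \<in> carr N then f (join x 0) else 0) \<in> Hom N X"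
    using f(1) m n add[of _ _ 0 0] actf[of _ 0] by (simp add: Hom_def)
  show "(\<lambda>x. if x \<in> carr M then f (join 0 x) else 0) \<in> Hom M X"
    using f(1) m n add[of 0 0] actf[of 0] by (simp add: Hom_def)
  show "f x = f (join (evc x) 0) + f (join 0 (odc x))" if "x \<in> carr (extmod N M 0)"
    using add[of "evc x" 0 0 "odc x"] that m n by (simp add: e(2))
qed

lemma lifting_sum:
  assumes "coord M" "coord N" "lifting M" "lifting N"
  shows "lifting (extmod N M 0)"
  unfolding lifting_def
proof (intro allI impI)
  fix X Y g f
  assume X: "coord X" and Y: "coord Y" and g: "g \<in> Hom X Y"
    and surj: "\<forall>y\<in>carr Y. \<exists>x\<in>carr X. g x = y"
    and f: "f \<in> Hom (extmod N M 0) Y"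
  note d = Hom_decompose[OF assms(1,2) Y f]
  obtain h where h: "h \<in> Hom N X" "g \<circ> h = (\<lambda>x. if x \<in> carr N then f (join x 0) else 0)"
    using liftingD[OF assms(4) X Y g _ d(1)] surj by blast
  obtain k where k: "k \<in> Hom M X" "g \<circ> k = (\<lambda>x. if x \<in> carr M then f (join 0 x) else 0)"
    using liftingD[OF assms(3) X Y g _ d(2)] surj by blast
  let ?l = "\<lambda>x. if x \<in> carr (extmod N M 0) then h (evc x) + k (odc x) else 0"
  have "g \<circ> ?l = f"
  proof
    fix x show "(g \<circ> ?l) x = f x"
    proof (cases "x \<in> carr (extmod N M 0)")
      case True
      then have x: "evc x \<in> carr N" "odc x \<in> carr M" by (auto simp: extmod_zero[OF assms(1,2)])
      have "g (h (evc x)) = f (join (evc x) 0)" "g (k (odc x)) = f (join 0 (odc x))"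
        using fun_cong[OF h(2), of "evc x"] fun_cong[OF k(2), of "odc x"] x by auto
      then show ?thesis
        using True d(3)[OF True] HomD(3)[OF g HomD(1)[OF h(1) x(1)] HomD(1)[OF k(1) x(2)]] by simp
    qed (use HomD(2)[OF f] coord_Hom_diff(1)[OF X g] in auto)
  qed
  then show "\<exists>h\<in>Hom (extmod N M 0) X. g \<circ> h = f"
    using Hom_copair[OF assms(1,2) X h(1) k(1)] by blast
qed

text \<open>
  A finite sum of copies of the regular module reaches a finite set of generators.
\<close>

lemma enough_projectives:
  assumes M: "coord M"
  shows "\<exists>P f. coord P \<and> lifting P \<and> f \<in> Hom P M \<and> (\<forall>y\<in>carr M. \<exists>x\<in>carr P. f x = y)"
proof -
  note m = coord_lmoduleD[OF M]
  obtain R e where R: "coord R" "lifting R" "e \<in> carr R" "\<And>m. m \<in> carr M \<Longrightarrow> \<exists>f\<in>Hom R M. f e = m"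
    using ex_free_module M by blast
  have *: "\<exists>P f. coord P \<and> lifting P \<and> f \<in> Hom P M \<and> S \<subseteq> f ` carr P" if "finite S"
    "S \<subseteq> carr M" for S
    using that
  proof (induction S rule: finite_induct)
    case empty
    then show ?case using coord_zmod lifting_zmod zero_in_Hom[OF coordD(1)[OF M]] by blast
  next
    case (insert y S)
    then obtain P f where P: "coord P" "lifting P" "f \<in> Hom P M" "S \<subseteq> f ` carr P" by auto
    obtain k where k: "k \<in> Hom R M" "k e = y" using R(4) insert.prems by blast
    let ?l = "\<lambda>x. if x \<in> carr (extmod P R 0) then f (evc x) + k (odc x) else 0"
    note ez = extmod_zero[OF R(1) P(1)]
    note z = coord_lmoduleD(1)[OF P(1)] coord_lmoduleD(1)[OF R(1)]
      coord_Hom_diff(1)[OF P(1) P(3)] coord_Hom_diff(1)[OF R(1) k(1)]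
    have "y = ?l (join 0 e)" using z k R(3) by (simp add: ez)
    moreover have "join 0 e \<in> carr (extmod P R 0)" using z R(3) by (simp add: ez)
    moreover have "f x = ?l (join x 0)" "join x 0 \<in> carr (extmod P R 0)" if "x \<in> carr P" for x
      using that z by (auto simp: ez)
    ultimately have "insert y S \<subseteq> ?l ` carr (extmod P R 0)" using P(4) by blast
    then show ?case
      using ez(1) lifting_sum[OF R(1) P(1) R(2) P(2)] Hom_copair[OF R(1) P(1) M P(3) k(1)] by blast
  qed
  obtain B where B: "B \<subseteq> carr M" "kv.independent B" "carr M \<subseteq> kv.span B"
    using kv.maximal_independent_subset by blast
  have fin: "finite B"
    using coordD(3)[OF M] B kv.independent_span_bound unfolding finspan_def by (meson order_trans)
  then obtain P f where P: "coord P" "lifting P" "f \<in> Hom P M" "B \<subseteq> f ` carr P"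
    using *[OF fin B(1)] by blast
  have "kv.subspace (f ` carr P)" by (rule lin_map_image_subspace[OF vs(1,1) Hom_lin_map[OF
    P(1) M P(3)]])
  then have "carr M \<subseteq> f ` carr P" using B(3) kv.span_minimal[OF P(4)] by blast
  then show ?thesis using P by blast
qed

end

section \<open>Consequences of heredity\<close>

locale hereditary_algebra = fd_algebra sc for sc :: "'k::field \<Rightarrow> 'a::ring_1 \<Rightarrow> 'a" +
  assumes hereditary: "hereditary sc"
begin

lemma lifting_submodule:
  assumes "coord P" "lifting P" "submodule U P"
  shows "coord (submod P U)" "lifting (submod P U)"
proof -
  show U: "coord (submod P U)" by (rule coord_submod[OF assms(1,3)])
  show "lifting (submod P U)"
    using hereditary assms coord_fd[OF assms(1)] projective_iff_lifting[OF assms(1)]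
      projective_iff_lifting[OF U]
    unfolding hereditary_def mod_cat_def by blast
qed

text \<open>
  The pullback of a cocycle to a projective module is a coboundary: \<open>D\<close> is the first component of
  a lift of \<open>q\<close> to the extension given by \<open>d\<close>.
\<close>

lemma lifting_derivation:
  assumes "coord Q" "lifting Q" "coord M" "coord N" "q \<in> Hom Q M" "d \<in> Coc M N"
  shows "\<exists>D\<in>Lin Q N. \<forall>a. \<forall>x\<in>carr Q. D (act Q a x) = act N a (D x) + d a (q x)"
proof -
  note S = sesD[OF ses_extmod[OF assms(3,4,6)]]
  let ?X = "extmod N M d"
  obtain h where h: "h \<in> Hom Q ?X" "ext_proj N M \<circ> h = q"
    using liftingD[OF assms(2) S(2) assms(3) S(5) S(9) assms(5)] by blast
  have X: "evc (h x) \<in> carr N" "odc (h x) \<in> carr M" if "x \<in> carr Q" for x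
    using HomD(1)[OF h(1) that] by (auto simp: extmod_def)
  have odc: "odc (h x) = q x" if "x \<in> carr Q" for x
    using fun_cong[OF h(2), of x] X[OF that] by (simp add: ext_proj_def)
  have lin: "lin_map ksc ksc (carr Q) (carr ?X) h" by (rule Hom_lin_map[OF assms(1) S(2) h(1)])
  have "(\<lambda>x. evc (h x)) \<in> Lin Q N"
    by (rule LinI[OF assms(1,4)]) (use X lin HomD(2)[OF h(1)] in \<open>auto simp: lin_map_def\<close>)
  moreover have "evc (h (act Q a x)) = act N a (evc (h x)) + d a (q x)" if "x \<in> carr Q" for a x
    using HomD(4)[OF h(1) that, of a] odc[OF that] by (simp add: extmod_def)
  ultimately show ?thesis by (intro bexI[of _ "\<lambda>x. evc (h x)"] allI ballI)
qed

text \<open>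
  The cocycle obtained from a presentation of \<open>M\<close> by \<open>P\<close> and a homomorphism on the relations: it
  represents the image of that homomorphism under the connecting map to the extension group.
\<close>

lemma connecting_cocycle:
  assumes "coord P" "coord M" "coord X" "\<pi> \<in> Hom P M" "\<sigma> \<in> Lin M P"
    and \<pi>\<sigma>: "\<And>m. m \<in> carr M \<Longrightarrow> \<pi> (\<sigma> m) = m"
    and \<phi>: "\<phi> \<in> Hom (submod P {x\<in>carr P. \<pi> x = 0}) X"
  shows "(\<lambda>a m. if m \<in> carr M then \<phi> (act P a (\<sigma> m) - \<sigma> (act M a m)) else 0) \<in> Coc M X"
proof -
  let ?K = "submod P {x\<in>carr P. \<pi> x = 0}"
  note p = coordD[OF assms(1)] coord_lmoduleD[OF assms(1)]
  note m = coordD[OF assms(2)] coord_lmoduleD[OF assms(2)]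
  note s = LinD[OF assms(2,5)] and \<pi> = HomD[OF assms(4)] Hom_diff[OF p(1) assms(4)]
  have nK: "coord ?K" by (rule coord_submod[OF assms(1) kernel_submodule[OF p(1) m(1) assms(4)]])
  note f = HomD[OF \<phi>] and fl = Hom_lin_map[OF nK assms(3) \<phi>]
  have fsc: "\<phi> (ksc c x) = ksc c (\<phi> x)" if "x \<in> carr ?K" for c x using fl that
    by (auto simp: lin_map_def)
  define c where "c a m = act P a (\<sigma> m) - \<sigma> (act M a m)" for a m
  have cK: "c a x \<in> carr ?K" if "x \<in> carr M" for a x
    using that by (simp add: c_def p(9-11) s(1) m(11) \<pi>(4,6) \<pi>\<sigma>)
  have act_K: "act P a y \<in> carr ?K" if "y \<in> carr ?K" for a y
    using coord_lmoduleD(5)[OF nK that] by simp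
  have c_add: "c a (x + y) = c a x + c a y" if "x \<in> carr M" "y \<in> carr M" for a x y
    using that by (simp add: c_def s(1,4) p(12) m(11,12))
  have c_sc: "c a (ksc k x) = ksc k (c a x)" if "x \<in> carr M" for a k x
    using that by (simp add: c_def s(1,6) p(6) m(6,11) kv.scale_right_diff_distrib)
  have c_add': "c (a + b) x = c a x + c b x" if "x \<in> carr M" for a b x
    using that by (simp add: c_def s(1,4) p(13) m(11,13))
  have c_sc': "c (sc k a) x = ksc k (c a x)" if "x \<in> carr M" for a k x
    using that by (simp add: c_def s(1,6) p(5) m(5,11) kv.scale_right_diff_distrib)
  have c_mult: "c (a * b) x = act P a (c b x) + c a (act M b x)" if "x \<in> carr M" for a b x
    using that by (simp add: c_def s(1) p(11,14,18) m(11,14))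
  have "(\<lambda>a m. if m \<in> carr M then \<phi> (c a m) else 0) \<in> Coc M X"
  proof (rule CocI)
    show "(\<lambda>m. if m \<in> carr M then \<phi> (c a m) else 0) \<in> Lin M X" for a
      by (rule LinI[OF assms(2,3)]) (simp_all add: f(1)[OF cK] f(3)[OF cK cK] c_add c_sc
        fsc[OF cK] m(4,8))
  next
    fix a b x k assume x: "x \<in> carr M"
    show "(if x \<in> carr M then \<phi> (c (a + b) x) else 0) =
      (if x \<in> carr M then \<phi> (c a x) else 0) + (if x \<in> carr M then \<phi> (c b x) else 0)"
      using x by (simp add: c_add' f(3)[OF cK cK])
    show "(if x \<in> carr M then \<phi> (c (sc k a) x) else 0) = ksc k (if x \<in> carr M then \<phi> (c a x)
      else 0)"
      using x by (simp add: c_sc' fsc[OF cK])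
    have "\<phi> (act P a (c b x)) = act X a (\<phi> (c b x))"
      using f(4)[OF cK[OF x], of b a] f(4)[OF cK[OF x]] by simp
    then show "(if x \<in> carr M then \<phi> (c (a * b) x) else 0) =
      act X a (if x \<in> carr M then \<phi> (c b x) else 0) + (if act M b x \<in> carr M then \<phi> (c a (act M
      b x)) else 0)"
      using x by (simp add: c_mult f(3)[OF act_K[OF cK] cK] m(11))
  qed
  then show ?thesis unfolding c_def .
qed

text \<open>
  Heredity makes cocycles right exact in both arguments. In the next two proofs \<open>P\<close> is a
  projective module over \<open>X\<close> or \<open>B\<close> and \<open>K\<close> the module of relations. Pulled back to \<open>P\<close>, or to a
  submodule of \<open>P\<close>, which is projective as well, the given cocycle is, up to sign, the coboundary
  of some \<open>D\<close>, and \<open>D\<close> is a homomorphism on \<open>K\<close>. The cocycle \<open>e\<close> connected with it has the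
  required image up to a coboundary, which is subtracted.
\<close>

lemma Coc_lift:
  assumes "ses A i B p C" "coord X" "d \<in> Coc X C"
  shows "\<exists>d'\<in>Coc X B. (\<lambda>a. p \<circ> d' a) = d"
proof -
  note S = sesD[OF assms(1)]
  obtain P \<pi> where P: "coord P" "lifting P" "\<pi> \<in> Hom P X" "\<forall>y\<in>carr X. \<exists>x\<in>carr P. \<pi> x = y"
    using enough_projectives[OF assms(2)] by blast
  let ?K = "submod P {x\<in>carr P. \<pi> x = 0}"
  note mp = coord_lmoduleD[OF P(1)] and mx = coord_lmoduleD[OF assms(2)]
  note mc = coord_lmoduleD[OF S(3)] and mb = coord_lmoduleD[OF S(2)]
  have sK: "submodule {x\<in>carr P. \<pi> x = 0} P"
    by (rule kernel_submodule[OF coordD(1)[OF P(1)] coordD(1)[OF assms(2)] P(3)])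
  note K = lifting_submodule[OF P(1,2) sK]
  obtain \<sigma> where \<sigma>: "\<sigma> \<in> Lin X P" "\<And>m. m \<in> carr X \<Longrightarrow> \<pi> (\<sigma> m) = m"
    using ses_section[OF ses_kernel[OF P(1) assms(2) P(3,4)]] by blast
  note s = LinD[OF assms(2) \<sigma>(1)] and \<pi> = HomD[OF P(3)] coord_Hom_diff[OF P(1) P(3)]
  obtain D where D: "D \<in> Lin P C" "\<And>a x. x \<in> carr P \<Longrightarrow> D (act P a x) = act C a (D x) + d a (\<pi> x)"
    using lifting_derivation[OF P(1,2) assms(2) S(3) P(3) assms(3)] by blast
  note Dl = LinD[OF P(1) D(1)]
  have d0: "d a 0 = 0" for a using LinD(3)[OF assms(2) CocD(1)[OF assms(3)]] .
  have "(\<lambda>x. if x \<in> carr ?K then D x else 0) \<in> Hom ?K C"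
    using coord_lmoduleD(2,5)[OF K(1)] D(2) d0 Dl by (auto simp: Hom_def)
  then obtain \<phi> where \<phi>: "\<phi> \<in> Hom ?K B" "p \<circ> \<phi> = (\<lambda>x. if x \<in> carr ?K then D x else 0)"
    using liftingD[OF K(2) S(2,3,5)] S(9) by blast
  define e where "e = (\<lambda>a m. if m \<in> carr X then \<phi> (act P a (\<sigma> m) - \<sigma> (act X a m)) else 0)"
  have e: "e \<in> Coc X B"
    unfolding e_def by (rule connecting_cocycle[OF P(1) assms(2) S(2) P(3) \<sigma> \<phi>(1)])
  have "D \<circ> \<sigma> \<in> Lin X C" by (rule Lin_comp[OF assms(2) P(1) S(3) \<sigma>(1) D(1)])
  then obtain h where h: "h \<in> Lin X B" "p \<circ> h = D \<circ> \<sigma>"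
    using Lin_exact_co[OF assms(1,2)] by (auto simp: short_exact_def)
  have ph: "p (h m) = D (\<sigma> m)" for m using fun_cong[OF h(2), of m] by simp
  note hl = LinD[OF assms(2) h(1)]
  have "p (e a m - coboundary X B h a m) = d a m" for a m
  proof (cases "m \<in> carr X")
    case True
    let ?c = "act P a (\<sigma> m) - \<sigma> (act X a m)"
    have c: "?c \<in> carr ?K"
      using True by (simp add: mp(4,5) s(1) mx(5) \<pi>(4,6) \<sigma>(2))
    have "p (e a m) = D ?c" using fun_cong[OF \<phi>(2), of ?c] c True by (simp add: e_def)
    also have "\<dots> = act C a (D (\<sigma> m)) + d a m - D (\<sigma> (act X a m))"
      using True by (simp add: Dl(5) mp(5) s(1) mx(5) D(2) \<sigma>(2))
    finally have 1: "p (e a m) = act C a (D (\<sigma> m)) + d a m - D (\<sigma> (act X a m))" .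
    have 2: "p (coboundary X B h a m) = act C a (D (\<sigma> m)) - D (\<sigma> (act X a m))"
      using True by (simp add: coboundary_def coord_Hom_diff(2)[OF S(2) S(5)] mb(5) hl(1) mx(5)
        HomD(4)[OF S(5)] ph)
    have "e a m \<in> carr B" "coboundary X B h a m \<in> carr B"
      using LinD(1)[OF assms(2) CocD(1)[OF e] True]
        LinD(1)[OF assms(2) CocD(1)[OF coboundary_in[OF assms(2) S(2) h(1)]] True] by auto
    then show ?thesis using 1 2 coord_Hom_diff(2)[OF S(2) S(5)] by simp
  next
    case False
    then show ?thesis
      using LinD(2)[OF assms(2) CocD(1)[OF assms(3)] False] coord_Hom_diff(1)[OF S(2) S(5)]
      by (simp add: e_def coboundary_def)
  qed
  then have "(\<lambda>a. p \<circ> (e - coboundary X B h) a) = d" by (intro ext) simp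
  then show ?thesis using Coc_closed(3)[OF assms(2) S(2) e coboundary_in[OF assms(2) S(2) h(1)]]
    by blast
qed

lemma Coc_extend:
  assumes "ses A i B p C" "coord X" "d \<in> Coc A X"
  shows "\<exists>d'\<in>Coc B X. (\<lambda>a. d' a \<circ> i) = d"
proof -
  note S = sesD[OF assms(1)]
  obtain P \<pi> where P: "coord P" "lifting P" "\<pi> \<in> Hom P B" "\<forall>y\<in>carr B. \<exists>x\<in>carr P. \<pi> x = y"
    using enough_projectives[OF S(2)] by blast
  let ?K = "submod P {x\<in>carr P. \<pi> x = 0}" and ?Q = "submod P {x\<in>carr P. (p \<circ> \<pi>) x = 0}"
  note mp = coord_lmoduleD[OF P(1)] and mx = coord_lmoduleD[OF assms(2)]
  note ma = coord_lmoduleD[OF S(1)] and mb = coord_lmoduleD[OF S(2)]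
  have sK: "submodule {x\<in>carr P. \<pi> x = 0} P"
    by (rule kernel_submodule[OF coordD(1)[OF P(1)] coordD(1)[OF S(2)] P(3)])
  have p\<pi>: "p \<circ> \<pi> \<in> Hom P C"
    by (rule Hom_comp[OF coordD(1)[OF P(1)] coordD(1)[OF S(2)] coordD(1)[OF S(3)] P(3) S(5)])
  have sQ: "submodule {x\<in>carr P. (p \<circ> \<pi>) x = 0} P"
    by (rule kernel_submodule[OF coordD(1)[OF P(1)] coordD(1)[OF S(3)] p\<pi>])
  note K = coord_submod[OF P(1) sK] and Q = lifting_submodule[OF P(1,2) sQ]
  obtain \<sigma> where \<sigma>: "\<sigma> \<in> Lin B P" "\<And>m. m \<in> carr B \<Longrightarrow> \<pi> (\<sigma> m) = m"
    using ses_section[OF ses_kernel[OF P(1) S(2) P(3,4)]] by blast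
  note s = LinD[OF S(2) \<sigma>(1)] and \<pi> = HomD[OF P(3)] coord_Hom_diff[OF P(1) P(3)]
  note i = HomD[OF S(4)] coord_Hom_diff[OF S(1) S(4)]
  note p0 = coord_Hom_diff(1)[OF S(2) S(5)]
  have inj: "u = v" if "u \<in> carr A" "v \<in> carr A" "i u = i v" for u v
    using S(6)[of "u - v"] that i ma by auto
  have "\<forall>x\<in>carr ?Q. \<exists>u. u \<in> carr A \<and> i u = \<pi> x" using S(8)[OF \<pi>(1)] by auto
  from bchoice[OF this] obtain q0 where "\<forall>x\<in>carr ?Q. q0 x \<in> carr A \<and> i (q0 x) = \<pi> x" ..
  then have q0: "q0 x \<in> carr A" "i (q0 x) = \<pi> x" if "x \<in> carr ?Q" for x using that by blast+
  define q where "q x = (if x \<in> carr ?Q then q0 x else 0)" for x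
  have q: "q x \<in> carr A" "i (q x) = \<pi> x" if "x \<in> carr ?Q" for x using q0 that by (auto simp: q_def)
  note mq = coord_lmoduleD[OF Q(1)]
  have QP: "x \<in> carr P" if "x \<in> carr ?Q" for x using that by simp
  have qH: "q \<in> Hom ?Q A"
    unfolding Hom_def
  proof (intro CollectI conjI ballI allI impI)
    show "q x = 0" if "x \<notin> carr ?Q" for x using that by (simp only: q_def if_False)
    show "q (x + y) = q x + q y" if "x \<in> carr ?Q" "y \<in> carr ?Q" for x y
      by (rule inj) (simp_all only: q[OF mq(2)[OF that]] q[OF that(1)] q[OF that(2)] ma(2)
        i(3) \<pi>(3)[OF QP QP, OF that])
    show "q (act ?Q a x) = act A a (q x)" if "x \<in> carr ?Q" for a x
    proof (rule inj)
      note ax = mq(5)[OF that, of a]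
      show "q (act ?Q a x) \<in> carr A" by (rule q(1)[OF ax])
      show "act A a (q x) \<in> carr A" by (rule ma(5)[OF q(1)[OF that]])
      show "i (q (act ?Q a x)) = i (act A a (q x))"
        unfolding q(2)[OF ax] i(4)[OF q(1)[OF that]] q(2)[OF that] using \<pi>(4)[OF QP[OF that]]
          by simp
    qed
  qed (rule q(1))
  obtain D where D: "D \<in> Lin ?Q X" "\<And>a x. x \<in> carr ?Q \<Longrightarrow> D (act P a x) = act X a (D x) + d a (q x)"
    using lifting_derivation[OF Q S(1) assms(2) qH assms(3)] by auto
  note Dl = LinD[OF Q(1) D(1)]
  have d0: "d a 0 = 0" for a using LinD(3)[OF S(1) CocD(1)[OF assms(3)]] .
  have KQ: "x \<in> carr ?Q" "q x = 0" if "x \<in> carr ?K" for x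
  proof -
    show x: "x \<in> carr ?Q" using that p0 by simp
    show "q x = 0" using that q[OF x] S(6) by simp
  qed
  have \<phi>: "(\<lambda>x. if x \<in> carr ?K then D x else 0) \<in> Hom ?K X"
    unfolding Hom_def
  proof (intro CollectI conjI ballI allI impI)
    note mk = coord_lmoduleD[OF K]
    fix x a assume x: "x \<in> carr ?K"
    show "(if x \<in> carr ?K then D x else 0) \<in> carr X" using x Dl(1)[OF KQ(1)[OF x]] by simp
    show "(if act ?K a x \<in> carr ?K then D (act ?K a x) else 0) = act X a (if x \<in> carr ?K then D
      x else 0)"
      using mk(5)[OF x, of a] x D(2)[OF KQ(1)[OF x], of a] KQ(2)[OF x] d0 by simp
    fix y assume y: "y \<in> carr ?K"
    show "(if x + y \<in> carr ?K then D (x + y) else 0) = (if x \<in> carr ?K then D x else 0) + (if y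
      \<in> carr ?K then D y else 0)"
      using mk(2)[OF x y] x y Dl(4)[OF KQ(1)[OF x] KQ(1)[OF y]] by simp
  qed auto
  define e where "e = (\<lambda>a m. if m \<in> carr B then (\<lambda>x. if x \<in> carr ?K then D x else 0) (act P a (\<sigma>
    m) - \<sigma> (act B a m)) else 0)"
  have e: "e \<in> Coc B X"
    unfolding e_def by (rule connecting_cocycle[OF P(1) S(2) assms(2) P(3) \<sigma> \<phi>])
  have \<sigma>i: "\<sigma> (i x) \<in> carr ?Q" "q (\<sigma> (i x)) = x" if x: "x \<in> carr A" for x
  proof -
    show *: "\<sigma> (i x) \<in> carr ?Q" using x by (simp add: s(1) i(1) \<sigma>(2) S(7))
    show "q (\<sigma> (i x)) = x" by (rule inj) (simp_all only: q[OF *] \<sigma>(2)[OF i(1)[OF x]] x)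
  qed
  have isc: "i (ksc c u) = ksc c (i u)" if "u \<in> carr A" for c u
    using Hom_lin_map[OF S(1,2,4)] that by (auto simp: lin_map_def)
  have "(\<lambda>x. if x \<in> carr A then D (\<sigma> (i x)) else 0) \<in> Lin A X"
    by (rule LinI[OF S(1) assms(2)])
      (simp_all only: if_True if_False ma(2) coordD(4)[OF S(1)] i(1,3) isc s(4,6) Dl(1,4,6) \<sigma>i(1))
  then obtain h where h: "h \<in> Lin B X" "h \<circ> i = (\<lambda>x. if x \<in> carr A then D (\<sigma> (i x)) else 0)"
    using Lin_exact_contra[OF assms(1,2)] by (auto simp: short_exact_def)
  have hi: "h (i x) = D (\<sigma> (i x))" if "x \<in> carr A" for x using fun_cong[OF h(2), of x] that by simp
  have "e a (i x) - coboundary B X h a (i x) = d a x" for a x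
  proof (cases "x \<in> carr A")
    case True
    let ?c = "act P a (\<sigma> (i x)) - \<sigma> (act B a (i x))"
    have c: "?c \<in> carr ?K"
      using True by (simp add: mp(4,5) s(1) i(1) mb(5) \<pi>(4,6) \<sigma>(2))
    have ai: "act B a (i x) = i (act A a x)" using i(4)[OF True] by simp
    have "e a (i x) = D ?c" using c i(1)[OF True] by (simp add: e_def)
    also have "\<dots> = D (act P a (\<sigma> (i x))) - D (\<sigma> (i (act A a x)))"
      unfolding ai using mq(5)[OF \<sigma>i(1)[OF True], of a] by (intro Dl(5) \<sigma>i(1) ma(5) True) simp
    also have "\<dots> = act X a (D (\<sigma> (i x))) + d a x - D (\<sigma> (i (act A a x)))"
      using D(2)[OF \<sigma>i(1)[OF True], of a] \<sigma>i(2)[OF True] by simp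
    finally show ?thesis using True by (simp add: coboundary_def i(1) ai hi ma(5))
  next
    case False
    have "e a 0 - coboundary B X h a 0 = 0"
      using LinD(3)[OF S(2) CocD(1)[OF e]] LinD(3)[OF S(2) CocD(1)[OF coboundary_in[OF S(2)
        assms(2) h(1)]]]
      by simp
    then show ?thesis using LinD(2)[OF S(1) CocD(1)[OF assms(3)] False] i(2)[OF False] by simp
  qed
  then have "(\<lambda>a. (e - coboundary B X h) a \<circ> i) = d" by (intro ext) simp
  then show ?thesis using Coc_closed(3)[OF S(2) assms(2) e coboundary_in[OF S(2) assms(2) h(1)]]
    by blast
qed

lemma contra_ses:
  assumes "ses A i B p C" "coord X"
  shows "two_term_ses (fsc ksc) (fsc (fsc ksc)) (Lin C X) (Lin B X) (Lin A X) (Coc C X) (Coc B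
    X) (Coc A X)
    (\<lambda>h. h \<circ> p) (\<lambda>h. h \<circ> i) (\<lambda>d a. d a \<circ> p) (\<lambda>d a. d a \<circ> i)
    (coboundary C X) (coboundary B X) (coboundary A X)"
proof -
  note S = sesD[OF assms(1)]
  show ?thesis
  proof (rule two_term_ses.intro)
    show "short_exact (fsc ksc) (Lin C X) (Lin B X) (Lin A X) (\<lambda>h. h \<circ> p) (\<lambda>h. h \<circ> i)"
      by (rule Lin_exact_contra[OF assms])
    show "short_exact (fsc (fsc ksc)) (Coc C X) (Coc B X) (Coc A X) (\<lambda>d a. d a \<circ> p) (\<lambda>d a. d a \<circ> i)"
      by (rule Coc_exact_contra[OF assms Coc_extend[OF assms]])
    show "coboundary B X (h \<circ> p) = (\<lambda>a. coboundary C X h a \<circ> p)" if "h \<in> Lin C X" for h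
      by (rule coboundary_precomp[OF S(2,3) assms(2) S(5) that])
    show "coboundary A X (h \<circ> i) = (\<lambda>a. coboundary B X h a \<circ> i)" if "h \<in> Lin B X" for h
      by (rule coboundary_precomp[OF S(1,2) assms(2) S(4) that])
  qed (rule vs coboundary_lin_map[OF S(1) assms(2)] coboundary_lin_map[OF S(2) assms(2)]
      coboundary_lin_map[OF S(3) assms(2)])+
qed

lemma co_ses:
  assumes "ses A i B p C" "coord X"
  shows "two_term_ses (fsc ksc) (fsc (fsc ksc)) (Lin X A) (Lin X B) (Lin X C) (Coc X A) (Coc X
    B) (Coc X C)
    (\<lambda>h. i \<circ> h) (\<lambda>h. p \<circ> h) (\<lambda>d a. i \<circ> d a) (\<lambda>d a. p \<circ> d a)
    (coboundary X A) (coboundary X B) (coboundary X C)"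
proof -
  note S = sesD[OF assms(1)]
  show ?thesis
  proof (rule two_term_ses.intro)
    show "short_exact (fsc ksc) (Lin X A) (Lin X B) (Lin X C) (\<lambda>h. i \<circ> h) (\<lambda>h. p \<circ> h)"
      by (rule Lin_exact_co[OF assms])
    show "short_exact (fsc (fsc ksc)) (Coc X A) (Coc X B) (Coc X C) (\<lambda>d a. i \<circ> d a) (\<lambda>d a. p \<circ> d a)"
      by (rule Coc_exact_co[OF assms Coc_lift[OF assms]])
    show "coboundary X B (i \<circ> h) = (\<lambda>a. i \<circ> coboundary X A h a)" if "h \<in> Lin X A" for h
      by (rule coboundary_postcomp[OF assms(2) S(1,2,4) that])
    show "coboundary X C (p \<circ> h) = (\<lambda>a. p \<circ> coboundary X B h a)" if "h \<in> Lin X B" for h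
      by (rule coboundary_postcomp[OF assms(2) S(2,3,5) that])
  qed (rule vs coboundary_lin_map[OF assms(2) S(1)] coboundary_lin_map[OF assms(2) S(2)]
      coboundary_lin_map[OF assms(2) S(3)])+
qed

text \<open>
  Vanishing in the six-term exact sequences of \<open>Hom\<close> and \<open>Ext\<close>, in the first and in the second
  argument.
\<close>

lemma contra_vanishing:
  assumes "ses A i B p C" "coord X"
  shows "no_hom B X \<Longrightarrow> no_hom C X" "no_hom C X \<Longrightarrow> no_hom A X \<Longrightarrow> no_hom B X"
    "no_hom B X \<Longrightarrow> no_ext C X \<Longrightarrow> no_hom A X" "no_hom A X \<Longrightarrow> no_ext B X \<Longrightarrow> no_ext C X"
    "no_ext C X \<Longrightarrow> no_ext A X \<Longrightarrow> no_ext B X" "no_ext B X \<Longrightarrow> no_ext A X"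
proof -
  note R = contra_ses[OF assms]
  show "no_hom B X \<Longrightarrow> no_hom C X"
    unfolding no_hom_def no_ext_def by (rule two_term_ses.ker0_1[OF R])
  show "no_hom C X \<Longrightarrow> no_hom A X \<Longrightarrow> no_hom B X"
    unfolding no_hom_def no_ext_def by (rule two_term_ses.ker0_2[OF R])
  show "no_hom B X \<Longrightarrow> no_ext C X \<Longrightarrow> no_hom A X"
    unfolding no_hom_def no_ext_def by (rule two_term_ses.ker0_3[OF R])
  show "no_hom A X \<Longrightarrow> no_ext B X \<Longrightarrow> no_ext C X"
    unfolding no_hom_def no_ext_def by (rule two_term_ses.coker0_1[OF R])
  show "no_ext C X \<Longrightarrow> no_ext A X \<Longrightarrow> no_ext B X"
    unfolding no_hom_def no_ext_def by (rule two_term_ses.coker0_2[OF R])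
  show "no_ext B X \<Longrightarrow> no_ext A X"
    unfolding no_hom_def no_ext_def by (rule two_term_ses.coker0_3[OF R])
qed

lemma co_vanishing:
  assumes "ses A i B p C" "coord X"
  shows "no_hom X B \<Longrightarrow> no_hom X A" "no_hom X A \<Longrightarrow> no_hom X C \<Longrightarrow> no_hom X B"
    "no_hom X B \<Longrightarrow> no_ext X A \<Longrightarrow> no_hom X C" "no_hom X C \<Longrightarrow> no_ext X B \<Longrightarrow> no_ext X A"
    "no_ext X A \<Longrightarrow> no_ext X C \<Longrightarrow> no_ext X B" "no_ext X B \<Longrightarrow> no_ext X C"
proof -
  note R = co_ses[OF assms]
  show "no_hom X B \<Longrightarrow> no_hom X A"
    unfolding no_hom_def no_ext_def by (rule two_term_ses.ker0_1[OF R])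
  show "no_hom X A \<Longrightarrow> no_hom X C \<Longrightarrow> no_hom X B"
    unfolding no_hom_def no_ext_def by (rule two_term_ses.ker0_2[OF R])
  show "no_hom X B \<Longrightarrow> no_ext X A \<Longrightarrow> no_hom X C"
    unfolding no_hom_def no_ext_def by (rule two_term_ses.ker0_3[OF R])
  show "no_hom X C \<Longrightarrow> no_ext X B \<Longrightarrow> no_ext X A"
    unfolding no_hom_def no_ext_def by (rule two_term_ses.coker0_1[OF R])
  show "no_ext X A \<Longrightarrow> no_ext X C \<Longrightarrow> no_ext X B"
    unfolding no_hom_def no_ext_def by (rule two_term_ses.coker0_2[OF R])
  show "no_ext X B \<Longrightarrow> no_ext X C"
    unfolding no_hom_def no_ext_def by (rule two_term_ses.coker0_3[OF R])
qed

lemma Hom_extend: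
  assumes "ses A i B p C" "coord X" "no_ext C X" "f \<in> Hom A X"
  shows "\<exists>h\<in>Hom B X. h \<circ> i = f"
proof -
  note S = sesD[OF assms(1)]
  have "f \<in> Lin A X" "coboundary A X f = 0" using assms(4) Hom_iff_coboundary[OF S(1) assms(2)]
    by auto
  then have "\<exists>h\<in>Lin B X. coboundary B X h = 0 \<and> h \<circ> i = f"
    using two_term_ses.ker_lift[OF contra_ses[OF assms(1,2)]] assms(3) unfolding no_ext_def by blast
  then show ?thesis using Hom_iff_coboundary[OF S(2) assms(2)] by blast
qed

lemma Hom_lift:
  assumes "ses A i B p C" "coord X" "no_ext X A" "f \<in> Hom X C"
  shows "\<exists>h\<in>Hom X B. p \<circ> h = f"
proof -
  note S = sesD[OF assms(1)]
  have "f \<in> Lin X C" "coboundary X C f = 0" using assms(4) Hom_iff_coboundary[OF assms(2) S(3)]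
    by auto
  then have "\<exists>h\<in>Lin X B. coboundary X B h = 0 \<and> p \<circ> h = f"
    using two_term_ses.ker_lift[OF co_ses[OF assms(1,2)]] assms(3) unfolding no_ext_def by blast
  then show ?thesis using Hom_iff_coboundary[OF assms(2) S(2)] by blast
qed

lemma euler_additive:
  assumes "ses A i B p C" "coord X"
  shows "euler B X = euler A X + euler C X" "euler X B = euler X A + euler X C"
proof -
  note S = sesD[OF assms(1)]
  show "euler B X = euler A X + euler C X"
    using two_term_ses.euler_additive[OF contra_ses[OF assms] Lin_finspan[OF S(2) assms(2)]
      Coc_finspan[OF S(2) assms(2)]]
    by (simp add: euler_def)
  show "euler X B = euler X A + euler X C"
    using two_term_ses.euler_additive[OF co_ses[OF assms] Lin_finspan[OF assms(2) S(2)]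
      Coc_finspan[OF assms(2) S(2)]]
    by (simp add: euler_def)
qed

end

section \<open>Extension groups and perpendicular categories in terms of cocycles\<close>

context fd_algebra
begin

text \<open>
  If the extension given by a cocycle splits, then the cocycle is a coboundary.
\<close>

lemma section_coboundary:
  assumes "coord M" "coord N" "d \<in> Coc M N" and k: "k \<in> Hom M (extmod N M d)"
    and sect: "\<And>x. x \<in> carr M \<Longrightarrow> ext_proj N M (k x) = x"
  shows "\<exists>h\<in>Lin M N. coboundary M N h = d"
proof -
  let ?X = "extmod N M d"
  note S = sesD[OF ses_extmod[OF assms(1-3)]]
  note n = coord_lmoduleD[OF assms(2)]
  have X: "evc (k x) \<in> carr N" "odc (k x) = x" if x: "x \<in> carr M" for x
    using HomD(1)[OF k x] sect[OF x] by (auto simp: extmod_def ext_proj_def)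
  have kl: "lin_map ksc ksc (carr M) (carr ?X) k" by (rule Hom_lin_map[OF assms(1) S(2) k])
  define h where "h x = - evc (k x)" for x
  have h: "h \<in> Lin M N"
    by (rule LinI[OF assms(1,2)])
      (use X n kl HomD(2)[OF k] in \<open>auto simp: h_def lin_map_def\<close>)
  have "coboundary M N h = d"
  proof (rule ext, rule ext)
    fix a x show "coboundary M N h a x = d a x"
    proof (cases "x \<in> carr M")
      case True
      have "evc (k (act M a x)) = act N a (evc (k x)) + d a x"
        using HomD(4)[OF k True, of a] X(2)[OF True] by (simp add: extmod_def)
      then show ?thesis
        using True n(11)[OF X(1)[OF True]] by (simp add: coboundary_def h_def)
    next
      case False
      then show ?thesis using LinD(2)[OF assms(1) CocD(1)[OF assms(3)]]
        by (simp add: coboundary_def)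
    qed
  qed
  then show ?thesis using h by blast
qed

text \<open>
  Any two split extensions are equivalent, so that the zero class consists of all of them.
\<close>

lemma split_extensions_equivalent:
  fixes M :: "('a, 'v::ab_group_add) lmodule" and N :: "('a, 'w::ab_group_add) lmodule"
  assumes M: "is_lmodule M" and N: "is_lmodule N"
    and e: "(X, f, g) \<in> extensions sc M N" and e': "(X', f', g') \<in> extensions sc M N"
    and s: "s \<in> Hom M X" "g \<circ> s = id_hom M" and s': "s' \<in> Hom M X'" "g' \<circ> s' = id_hom M"
  shows "((X, f, g), (X', f', g')) \<in> ext_equiv sc M N"
proof -
  have X: "is_lmodule X" "f \<in> Hom N X" "g \<in> Hom X M" "inj_on f (carr N)"
    "f ` carr N = {x \<in> carr X. g x = 0}"
    using e fd_lmodule by (auto simp: extensions_def)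
  have X': "is_lmodule X'" "f' \<in> Hom N X'" "g' \<in> Hom X' M" "f' ` carr N = {x \<in> carr X'. g' x = 0}"
    using e' fd_lmodule by (auto simp: extensions_def)
  note x = is_lmoduleD[OF X(1)] and x' = is_lmoduleD[OF X'(1)] and n = is_lmoduleD[OF N]
  note f = HomD[OF X(2)] Hom_diff[OF N X(2)] and g = HomD[OF X(3)] Hom_diff[OF X(1) X(3)]
  note f' = HomD[OF X'(2)] Hom_diff[OF N X'(2)] and g' = HomD[OF X'(3)] Hom_diff[OF X'(1) X'(3)]
  note sD = HomD[OF s(1)] Hom_diff[OF M s(1)] and s'D = HomD[OF s'(1)] Hom_diff[OF M s'(1)]
  have gs: "g (s m) = m" if "m \<in> carr M" for m using fun_cong[OF s(2), of m] that
    by (simp add: id_hom_def)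
  have gs': "g' (s' m) = m" if "m \<in> carr M" for m using fun_cong[OF s'(2), of m] that
    by (simp add: id_hom_def)
  have "\<forall>y\<in>carr X. \<exists>u. u \<in> carr N \<and> f u = y - s (g y)"
  proof
    fix y assume y: "y \<in> carr X"
    then have "y - s (g y) \<in> {x \<in> carr X. g x = 0}" by (simp add: x(4) sD(1) g(1,6) gs)
    then have "y - s (g y) \<in> f ` carr N" by (simp only: X(5))
    then show "\<exists>u. u \<in> carr N \<and> f u = y - s (g y)" by auto
  qed
  \<comment> \<open>\<open>r\<close> is the retraction belonging to the section \<open>s\<close>\<close>
  from bchoice[OF this] obtain r where "\<forall>y\<in>carr X. r y \<in> carr N \<and> f (r y) = y - s (g y)" ..
  then have r: "r y \<in> carr N" "f (r y) = y - s (g y)" if "y \<in> carr X" for y using that by blast+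
  have inj: "u = v" if "u \<in> carr N" "v \<in> carr N" "f u = f v" for u v using X(4) that
    by (auto simp: inj_on_def)
  have r_add: "r (y + z) = r y + r z" if "y \<in> carr X" "z \<in> carr X" for y z
    by (rule inj) (simp_all add: that x(2) r n(2) f(3) g(1,3) sD(3))
  have r_act: "r (act X a y) = act N a (r y)" if "y \<in> carr X" for a y
    by (rule inj) (simp_all add: that x(1,5) r n(5) f(4) g(1,4) sD(1) x(12) sD(4)[symmetric])
  have r_f: "r (f u) = u" if "u \<in> carr N" for u
  proof (rule inj)
    have "g (f u) = 0" using that X(5) by auto
    then show "f (r (f u)) = f u" using r(2)[OF f(1)[OF that]] sD(5) by simp
  qed (use that r(1)[OF f(1)] in auto)
  define h where "h y = (if y \<in> carr X then f' (r y) + s' (g y) else 0)" for y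
  have "h \<in> Hom X X'"
    unfolding Hom_def h_def using x x' r(1) r_add r_act f'(1,3,4) g(1,3,4) s'D(1,3,4)
    by (simp add: algebra_simps)
  moreover have "h \<circ> f = f'"
  proof
    fix u show "(h \<circ> f) u = f' u"
    proof (cases "u \<in> carr N")
      case True
      then have "g (f u) = 0" using X(5) by auto
      then show ?thesis using True f(1) r_f s'D(5) by (simp add: h_def)
    next
      case False
      have "r 0 = 0" using r_f[OF n(1)] f(5) by simp
      then show ?thesis using False f(2) f'(2,5) g(5) s'D(5) x(1) by (simp add: h_def)
    qed
  qed
  moreover have "g' \<circ> h = g"
  proof
    fix y show "(g' \<circ> h) y = g y"
    proof (cases "y \<in> carr X")
      case True
      have "g' (f' (r y)) = 0" using X'(4) r(1)[OF True] by auto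
      then show ?thesis using True by (simp add: h_def g'(3) f'(1) r(1) s'D(1) g(1) gs')
    qed (use g(2) g'(5) in \<open>simp add: h_def\<close>)
  qed
  ultimately show ?thesis using e e' by (auto simp: ext_equiv_def)
qed

lemma Ext_trivial_iff_split:
  fixes M :: "('a, 'v::ab_group_add) lmodule" and N :: "('a, 'w::ab_group_add) lmodule"
  assumes M: "is_lmodule M" and N: "is_lmodule N" and ne: "extensions sc M N \<noteq> {}"
  shows "Ext sc M N = {Ext_zero sc M N} \<longleftrightarrow>
    (\<forall>X f g. (X, f, g) \<in> extensions sc M N \<longrightarrow> (\<exists>s\<in>Hom M X. g \<circ> s = id_hom M))"
proof
  assume L: "Ext sc M N = {Ext_zero sc M N}"
  show "\<forall>X f g. (X, f, g) \<in> extensions sc M N \<longrightarrow> (\<exists>s\<in>Hom M X. g \<circ> s = id_hom M)"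
  proof (intro allI impI)
    fix X f g assume e: "(X, f, g) \<in> extensions sc M N"
    then have X: "is_lmodule X" "f \<in> Hom N X" "g \<in> Hom X M"
      using fd_lmodule by (auto simp: extensions_def)
    have "id_hom X \<circ> f = f"
      using HomD(1,2)[OF X(2)] is_lmoduleD(1)[OF X(1)] by (auto simp: fun_eq_iff id_hom_def)
    moreover have "g \<circ> id_hom X = g"
      using HomD(2)[OF X(3)] Hom_diff(1)[OF X(1,3)] by (auto simp: fun_eq_iff id_hom_def)
    ultimately have "((X, f, g), (X, f, g)) \<in> ext_equiv sc M N"
      using e id_hom_in_Hom[OF X(1)] by (auto simp: ext_equiv_def)
    moreover have "ext_equiv sc M N `` {(X, f, g)} = Ext_zero sc M N"
      using L quotientI[OF e, of "ext_equiv sc M N"] unfolding Ext_def by blast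
    ultimately have "(X, f, g) \<in> Ext_zero sc M N" by blast
    then show "\<exists>s\<in>Hom M X. g \<circ> s = id_hom M" by (auto simp: Ext_zero_def)
  qed
next
  assume R: "\<forall>X f g. (X, f, g) \<in> extensions sc M N \<longrightarrow> (\<exists>s\<in>Hom M X. g \<circ> s = id_hom M)"
  then have z: "Ext_zero sc M N = extensions sc M N" by (auto simp: Ext_zero_def)
  have "(e, e') \<in> ext_equiv sc M N" if ee: "e \<in> extensions sc M N" "e' \<in> extensions sc M N" for e e'
  proof -
    obtain X f g where e: "e = (X, f, g)" by (cases e)
    obtain X' f' g' where e': "e' = (X', f', g')" by (cases e')
    show ?thesis using R ee split_extensions_equivalent[OF M N] unfolding e e' by meson
  qed
  moreover have "ext_equiv sc M N \<subseteq> extensions sc M N \<times> extensions sc M N"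
    by (auto simp: ext_equiv_def)
  ultimately have "ext_equiv sc M N `` {e} = extensions sc M N" if "e \<in> extensions sc M N" for e
    using that by blast
  then show "Ext sc M N = {Ext_zero sc M N}"
    unfolding Ext_def z quotient_def using ne by auto
qed

end

context hereditary_algebra
begin

text \<open>
  For arbitrary finite dimensional modules, vanishing of the group of Yoneda classes may be read
  off from the cocycles of coordinate models.
\<close>

lemma Ext_trivial_iff:
  fixes M :: "('a, 'v::ab_group_add) lmodule" and N :: "('a, 'w::ab_group_add) lmodule"
  assumes M: "is_lmodule M" and N: "is_lmodule N" and M': "coord M'" "isomorphic M M'"
    and N': "coord N'" "isomorphic N N'"
  shows "Ext sc M N = {Ext_zero sc M N} \<longleftrightarrow> no_ext M' N'"
proof -
  obtain \<mu> \<mu>' where "inverse_homs M M' \<mu> \<mu>'" using isomorphicE[OF M'(2)] .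
  note \<mu> = inverse_homsD[OF this]
  obtain \<nu> \<nu>' where "inverse_homs N N' \<nu> \<nu>'" using isomorphicE[OF N'(2)] .
  note \<nu> = inverse_homsD[OF this]
  note mM' = coordD(1)[OF M'(1)] and mN' = coordD(1)[OF N'(1)]
  note m = HomD(1)[OF \<mu>(1)] HomD(1)[OF \<mu>(2)] and n = HomD(1)[OF \<nu>(1)] HomD(1)[OF \<nu>(2)]
  note z = Hom_diff(1)[OF M \<mu>(1)] Hom_diff(1)[OF mM' \<mu>(2)] Hom_diff(1)[OF N \<nu>(1)] Hom_diff(1)[OF
    mN' \<nu>(2)]
  have ses_ext: "(X, i \<circ> \<nu>, \<mu>' \<circ> p) \<in> extensions sc M N" if S: "ses N' i X p M'" for X i p
  proof -
    note S' = sesD[OF S]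
    have iu: "i u \<in> carr X" if "u \<in> carr N'" for u using HomD(1)[OF S'(4) that] .
    have "inj_on (i \<circ> \<nu>) (carr N)"
    proof (rule inj_onI)
      fix u v assume uv: "u \<in> carr N" "v \<in> carr N" "(i \<circ> \<nu>) u = (i \<circ> \<nu>) v"
      then have "i (\<nu> u - \<nu> v) = 0" using Hom_diff(2)[OF mN' S'(4) n(1) n(1)] by simp
      then have "\<nu> u = \<nu> v" using S'(6)[OF is_lmoduleD(4)[OF mN' n(1) n(1)]] uv by fastforce
      then show "u = v" using \<nu>(3) uv by metis
    qed
    moreover have "(i \<circ> \<nu>) ` carr N = {x \<in> carr X. (\<mu>' \<circ> p) x = 0}"
    proof (intro equalityI subsetI)
      fix x assume "x \<in> (i \<circ> \<nu>) ` carr N"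
      then show "x \<in> {x \<in> carr X. (\<mu>' \<circ> p) x = 0}" using n(1) iu S'(7) z by auto
    next
      fix x assume "x \<in> {x \<in> carr X. (\<mu>' \<circ> p) x = 0}"
      then have x: "x \<in> carr X" "\<mu>' (p x) = 0" by auto
      then have "p x = 0" using \<mu>(4)[OF HomD(1)[OF S'(5) x(1)]] z by simp
      then obtain u where "u \<in> carr N'" "i u = x" using S'(8) x by blast
      then show "x \<in> (i \<circ> \<nu>) ` carr N" using \<nu>(4) n(2) by (intro image_eqI[of _ _ "\<nu>' u"]) auto
    qed
    moreover have "(\<mu>' \<circ> p) ` carr X = carr M"
    proof (intro equalityI subsetI)
      fix y assume y: "y \<in> carr M"
      then obtain x where "x \<in> carr X" "p x = \<mu> y" using S'(9) m by blast
      then show "y \<in> (\<mu>' \<circ> p) ` carr X" using \<mu>(3)[OF y] by (intro image_eqI[of _ _ x]) auto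
    qed (use HomD(1)[OF S'(5)] m in auto)
    ultimately show ?thesis
      using coord_fd[OF S'(2)] Hom_comp[OF N mN' coordD(1)[OF S'(2)] \<nu>(1) S'(4)]
        Hom_comp[OF coordD(1)[OF S'(2)] mM' M S'(5) \<mu>(2)]
      by (auto simp: extensions_def)
  qed
  have ne: "extensions sc M N \<noteq> {}"
    using ses_ext[OF ses_extmod[OF M'(1) N'(1) zero_in_Coc[OF M'(1) N'(1)]]] by blast
  show ?thesis
    unfolding Ext_trivial_iff_split[OF M N ne]
  proof
    assume R: "\<forall>X f g. (X, f, g) \<in> extensions sc M N \<longrightarrow> (\<exists>s\<in>Hom M X. g \<circ> s = id_hom M)"
    show "no_ext M' N'"
      unfolding no_ext_def coker0_def
    proof
      fix d assume d: "d \<in> Coc M' N'"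
      let ?X = "extmod N' M' d"
      note S = ses_extmod[OF M'(1) N'(1) d]
      note S' = sesD[OF S]
      obtain s where s: "s \<in> Hom M ?X" "(\<mu>' \<circ> ext_proj N' M') \<circ> s = id_hom M"
        using R ses_ext[OF S] by blast
      have k: "s \<circ> \<mu>' \<in> Hom M' ?X" by (rule Hom_comp[OF mM' M coordD(1)[OF S'(2)] \<mu>(2) s(1)])
      have "ext_proj N' M' ((s \<circ> \<mu>') x) = x" if x: "x \<in> carr M'" for x
      proof -
        have *: "(s \<circ> \<mu>') x \<in> carr ?X" by (rule HomD(1)[OF k x])
        have "\<mu>' (ext_proj N' M' ((s \<circ> \<mu>') x)) = \<mu>' x"
          using fun_cong[OF s(2), of "\<mu>' x"] m(2)[OF x] by (simp add: id_hom_def)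
        then show ?thesis using \<mu>(4)[OF x] \<mu>(4)[OF HomD(1)[OF S'(5) *]] by metis
      qed
      then show "\<exists>h\<in>Lin M' N'. coboundary M' N' h = d"
        by (rule section_coboundary[OF M'(1) N'(1) d k])
    qed
  next
    assume L: "no_ext M' N'"
    show "\<forall>X f g. (X, f, g) \<in> extensions sc M N \<longrightarrow> (\<exists>s\<in>Hom M X. g \<circ> s = id_hom M)"
    proof (intro allI impI)
      fix X f g assume e: "(X, f, g) \<in> extensions sc M N"
      then have X: "fd_module sc X" "f \<in> Hom N X" "g \<in> Hom X M" "inj_on f (carr N)"
        "f ` carr N = {x \<in> carr X. g x = 0}" "g ` carr X = carr M"
        by (auto simp: extensions_def)
      note mX = fd_lmodule[OF X(1)]
      obtain X' where X': "coord X'" "isomorphic X X'" using ex_coord[OF X(1)] by blast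
      note mX' = coordD(1)[OF X'(1)]
      obtain \<xi> \<xi>' where "inverse_homs X X' \<xi> \<xi>'" using isomorphicE[OF X'(2)] .
      note \<xi> = inverse_homsD[OF this]
      note \<xi>z = Hom_diff(1)[OF mX \<xi>(1)] Hom_diff(1)[OF mX' \<xi>(2)]
        and \<xi>i = HomD(1)[OF \<xi>(1)] HomD(1)[OF \<xi>(2)]
      define i where "i = \<xi> \<circ> (f \<circ> \<nu>')"
      define p where "p = \<mu> \<circ> (g \<circ> \<xi>')"
      have i: "i \<in> Hom N' X'" unfolding i_def
        by (rule Hom_comp[OF mN' mX mX' Hom_comp[OF mN' N mX \<nu>(2) X(2)] \<xi>(1)])
      have p: "p \<in> Hom X' M'" unfolding p_def
        by (rule Hom_comp[OF mX' M mM' Hom_comp[OF mX' mX M \<xi>(2) X(3)] \<mu>(1)])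
      have "ses N' i X' p M'"
        unfolding ses_def
      proof (intro conjI ballI impI)
        show "x = 0" if x: "x \<in> carr N'" "i x = 0" for x
        proof -
          have fx: "f (\<nu>' x) \<in> carr X" by (rule HomD(1)[OF X(2) n(2)[OF x(1)]])
          have "f (\<nu>' x) = 0" using \<xi>(3)[OF fx] x(2) \<xi>z by (simp add: i_def)
          then have "\<nu>' x = 0"
            using X(4) n(2)[OF x(1)] is_lmoduleD(1)[OF N] Hom_diff(1)[OF N X(2)]
              by (auto simp: inj_on_def)
          then show ?thesis using \<nu>(4)[OF x(1)] z by simp
        qed
        show "p (i x) = 0" if x: "x \<in> carr N'" for x
        proof -
          have "f (\<nu>' x) \<in> {x \<in> carr X. g x = 0}" using n(2)[OF x] X(5) by blast
          then show ?thesis using \<xi>(3)[of "f (\<nu>' x)"] z by (simp add: i_def p_def)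
        qed
        show "\<exists>x\<in>carr N'. i x = y" if y: "y \<in> carr X'" "p y = 0" for y
        proof -
          have "g (\<xi>' y) \<in> carr M" by (rule HomD(1)[OF X(3) \<xi>i(2)[OF y(1)]])
          then have "g (\<xi>' y) = 0" using \<mu>(3)[of "g (\<xi>' y)"] y(2) z by (simp add: p_def)
          then have "\<xi>' y \<in> f ` carr N" using X(5) \<xi>i(2)[OF y(1)] by blast
          then obtain u where u: "u \<in> carr N" "f u = \<xi>' y" by force
          then show ?thesis using \<nu>(3)[OF u(1)] n(1) \<xi>(4)[OF y(1)] by (intro bexI[of _
            "\<nu> u"]) (auto simp: i_def)
        qed
        show "\<exists>x\<in>carr X'. p x = y" if y: "y \<in> carr M'" for y
        proof -
          obtain x where x: "x \<in> carr X" "g x = \<mu>' y" using X(6) m(2)[OF y] by (metis imageE)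
          then show ?thesis using \<xi>(3)[OF x(1)] \<xi>i(1) \<mu>(4)[OF y] by (intro bexI[of _
            "\<xi> x"]) (auto simp: p_def)
        qed
      qed (use M' N' X' i p in auto)
      then obtain k where k: "k \<in> Hom M' X'" "p \<circ> k = id_hom M'"
        using Hom_lift[OF _ M'(1) L id_hom_in_Hom[OF mM']] by blast
      have "g \<circ> (\<xi>' \<circ> (k \<circ> \<mu>)) = id_hom M"
      proof
        fix x show "(g \<circ> (\<xi>' \<circ> (k \<circ> \<mu>))) x = id_hom M x"
        proof (cases "x \<in> carr M")
          case True
          have "\<mu> (g (\<xi>' (k (\<mu> x)))) = \<mu> x"
            using fun_cong[OF k(2), of "\<mu> x"] m(1)[OF True] by (simp add: p_def id_hom_def)
          moreover have "g (\<xi>' (k (\<mu> x))) \<in> carr M"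
            by (rule HomD(1)[OF X(3) \<xi>i(2)[OF HomD(1)[OF k(1) m(1)[OF True]]]])
          ultimately have "g (\<xi>' (k (\<mu> x))) = x" using \<mu>(3) True by metis
          then show ?thesis using True by (simp add: id_hom_def)
        next
          case False
          then show ?thesis
            using HomD(2)[OF \<mu>(1) False] Hom_diff(1)[OF mM' k(1)] \<xi>z Hom_diff(1)[OF mX X(3)]
            by (simp add: id_hom_def)
        qed
      qed
      then show "\<exists>s\<in>Hom M X. g \<circ> s = id_hom M"
        using Hom_comp[OF M mX' mX Hom_comp[OF M mM' mX' \<mu>(1) k(1)] \<xi>(2)] by blast
    qed
  qed
qed

end

context fd_algebra
begin

lemma Hom_trivial_iff:
  fixes M :: "('a, 'v::ab_group_add) lmodule" and N :: "('a, 'w::ab_group_add) lmodule"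
  assumes M: "is_lmodule M" and N: "is_lmodule N" and M': "coord M'" "isomorphic M M'"
    and N': "coord N'" "isomorphic N N'"
  shows "Hom M N = {0} \<longleftrightarrow> no_hom M' N'"
proof -
  obtain \<mu> \<mu>' where \<mu>: "inverse_homs M M' \<mu> \<mu>'" using isomorphicE[OF M'(2)] .
  obtain \<nu> \<nu>' where \<nu>: "inverse_homs N N' \<nu> \<nu>'" using isomorphicE[OF N'(2)] .
  note mM' = coordD(1)[OF M'(1)] and mN' = coordD(1)[OF N'(1)]
  note forth = Hom_transport[OF M mM' N mN' \<mu> \<nu>]
    and backwards = Hom_transport[OF mM' M mN' N inverse_homs_sym[OF \<mu>] inverse_homs_sym[OF \<nu>]]
  have "Hom M N = {0} \<longleftrightarrow> Hom M' N' = {0}"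
  proof (intro iffI equalityI subsetI)
    show "f \<in> {0}" if "Hom M' N' = {0}" "f \<in> Hom M N" for f
      using forth[OF that(2)] that(1) by simp
    show "f \<in> {0}" if "Hom M N = {0}" "f \<in> Hom M' N'" for f
      using backwards[OF that(2)] that(1) by simp
  qed (use zero_in_Hom[OF N, of M] zero_in_Hom[OF mN', of M'] in simp_all)
  then show ?thesis using no_hom_iff[OF M'(1) N'(1)] by blast
qed

text \<open>
  \<open>N\<close> is right perpendicular to \<open>M\<close>, and \<open>M\<close> left perpendicular to \<open>N\<close>.
\<close>

definition perp :: "('a, 'k) std_module \<Rightarrow> ('a, 'k) std_module \<Rightarrow> bool" where
  "perp M N \<longleftrightarrow> no_hom M N \<and> no_ext M N"

end

section \<open>Direct sums\<close>

lemma is_lmodule_dsum: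
  assumes "\<And>i. i \<in> I \<Longrightarrow> is_lmodule (E i)"
  shows "is_lmodule (dsum I E)"
proof -
  note e = is_lmoduleD[OF assms]
  show ?thesis
    unfolding is_lmodule_def dsum_def
    by (auto simp: e fun_eq_iff split: if_splits)
qed

context hereditary_algebra
begin

lemma perp_zmod:
  assumes "coord X"
  shows "perp zmod X" "perp X zmod"
proof -
  have 1: "h = 0" if "h \<in> Lin zmod X" for h
  proof
    fix x show "h x = 0 x"
      using LinD(2,3)[OF coord_zmod that] by (cases "x = 0") (auto simp: zmod_def)
  qed
  have 2: "h = 0" if "h \<in> Lin X zmod" for h
  proof
    fix x show "h x = 0 x"
      using LinD(1,2)[OF assms that] by (cases "x \<in> carr X") (auto simp: zmod_def)
  qed
  have "\<exists>h\<in>Lin zmod X. coboundary zmod X h = d" if "d \<in> Coc zmod X" for d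
  proof (intro bexI)
    have "d = 0" using 1 CocD(1)[OF that] by (intro ext) (metis zero_fun_apply)
    then show "coboundary zmod X 0 = d" using lin_map_diff(1)[OF vs(2) coboundary_lin_map[OF
      coord_zmod assms]] by simp
  qed (rule Lin_closed(1)[OF coord_zmod assms])
  then show "perp zmod X" using 1 by (auto simp: perp_def no_hom_def no_ext_def ker0_def coker0_def)
  have "\<exists>h\<in>Lin X zmod. coboundary X zmod h = d" if "d \<in> Coc X zmod" for d
  proof (intro bexI)
    have "d = 0" using 2 CocD(1)[OF that] by (intro ext) (metis zero_fun_apply)
    then show "coboundary X zmod 0 = d" using lin_map_diff(1)[OF vs(2) coboundary_lin_map[OF
      assms coord_zmod]] by simp
  qed (rule Lin_closed(1)[OF assms coord_zmod])
  then show "perp X zmod" using 2 by (auto simp: perp_def no_hom_def no_ext_def ker0_def coker0_def)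
qed

text \<open>
  Both perpendicular categories have the two-out-of-three property for short exact sequences.
\<close>

lemma perp_ses:
  assumes "ses A i B p C" "coord X"
  shows "perp A X \<Longrightarrow> perp C X \<Longrightarrow> perp B X" "perp X A \<Longrightarrow> perp X C \<Longrightarrow> perp X B"
    "perp B X \<Longrightarrow> perp C X \<Longrightarrow> perp A X" "perp A X \<Longrightarrow> perp B X \<Longrightarrow> perp C X"
    "perp X B \<Longrightarrow> perp X C \<Longrightarrow> perp X A" "perp X A \<Longrightarrow> perp X B \<Longrightarrow> perp X C"
  using contra_vanishing[OF assms] co_vanishing[OF assms] unfolding perp_def by blast+

lemma ses_isomorphic:
  assumes "coord A" "coord B" "isomorphic A B"
  shows "\<exists>f. ses A f B 0 zmod"
proof -
  obtain f g where "inverse_homs A B f g" using isomorphicE[OF assms(3)] .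
  note fg = inverse_homsD[OF this]
  have "ses A f B 0 zmod"
    unfolding ses_def
  proof (intro conjI ballI impI)
    show "x = 0" if "x \<in> carr A" "f x = 0" for x
      using fg(3)[OF that(1)] that(2) coord_Hom_diff(1)[OF assms(2) fg(2)] by simp
    show "\<exists>x\<in>carr A. f x = y" if "y \<in> carr B" for y using fg(4)[OF that] HomD(1)[OF fg(2) that]
      by blast
    show "\<exists>y\<in>carr B. 0 y = z" if "z \<in> carr zmod" for z :: "nat \<Rightarrow> 'k"
      using that coord_lmoduleD(1)[OF assms(2)] by (auto simp: zmod_def)
  qed (use assms coord_zmod fg zero_in_Hom[OF coordD(1)[OF coord_zmod]] in auto)
  then show ?thesis by blast
qed

text \<open>A direct sum has each of its two terms both as a submodule and as a quotient.\<close>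

lemma ses_sum_swap:
  assumes "coord M" "coord N"
  shows "\<exists>i p. ses M i (extmod N M 0) p N"
proof -
  note e = extmod_zero[OF assms]
  note m = coord_lmoduleD[OF assms(1)] and n = coord_lmoduleD[OF assms(2)]
  let ?i = "\<lambda>x. if x \<in> carr M then join 0 x else 0"
  let ?p = "\<lambda>x. if x \<in> carr (extmod N M 0) then evc x else 0"
  have "?i \<in> Hom M (extmod N M 0)" using m n by (auto simp: Hom_def e)
  moreover have "?p \<in> Hom (extmod N M 0) N" using m n by (auto simp: Hom_def e)
  moreover have "\<exists>x\<in>carr M. ?i x = y" if "y \<in> carr (extmod N M 0)" "?p y = 0" for y
    using that by (intro bexI[of _ "odc y"]) (auto simp: e intro!: eq_join_iff[THEN iffD2,
      symmetric])
  moreover have "\<exists>y\<in>carr (extmod N M 0). ?p y = z" if "z \<in> carr N" for z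
    using that m by (intro bexI[of _ "join z 0"]) (auto simp: e)
  ultimately have "ses M ?i (extmod N M 0) ?p N"
    using assms e(1) m n by (auto simp: ses_def e)
  then show ?thesis by blast
qed

lemma perp_sum:
  assumes "coord M" "coord N" "coord X"
  shows "perp (extmod N M 0) X \<longleftrightarrow> perp N X \<and> perp M X" "perp X (extmod N M 0) \<longleftrightarrow> perp X N \<and> perp X M"
proof -
  note 1 = ses_extmod[OF assms(1,2) zero_in_Coc[OF assms(1,2)]]
  obtain i p where 2: "ses M i (extmod N M 0) p N" using ses_sum_swap[OF assms(1,2)] by blast
  note contra_vanishing[OF 1 assms(3)] contra_vanishing[OF 2 assms(3)]
  then show "perp (extmod N M 0) X \<longleftrightarrow> perp N X \<and> perp M X" unfolding perp_def by blast
  note co_vanishing[OF 1 assms(3)] co_vanishing[OF 2 assms(3)]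
  then show "perp X (extmod N M 0) \<longleftrightarrow> perp X N \<and> perp X M" unfolding perp_def by blast
qed

text \<open>
  A coordinate model of a finite direct sum, together with its perpendicular categories; by
  induction, adding one summand at a time with \<open>extmod\<close> for the zero cocycle.
\<close>

lemma dsum_model:
  fixes E :: "nat \<Rightarrow> ('a, 'v::ab_group_add) lmodule"
  assumes "finite I" "\<And>i. i \<in> I \<Longrightarrow> is_lmodule (E i) \<and> coord (F i) \<and> isomorphic (E i) (F i)"
  shows "\<exists>D. coord D \<and> isomorphic (dsum I E) D \<and>
    (\<forall>X. coord X \<longrightarrow> (perp D X \<longleftrightarrow> (\<forall>i\<in>I. perp (F i) X)) \<and> (perp X D \<longleftrightarrow> (\<forall>i\<in>I. perp X (F i))))"
  using assms
proof (induction I rule: finite_induct)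
  case empty
  have "isomorphic (dsum {} E) zmod"
  proof (rule isomorphicI[where f = 0 and g = 0])
    show *: "is_lmodule (dsum {} E)" by (rule is_lmodule_dsum) simp
    show "0 \<in> Hom (zmod :: ('a, 'k) std_module) (dsum {} E)" by (rule zero_in_Hom[OF *])
    show "is_lmodule zmod" "0 \<in> Hom (dsum {} E) (zmod :: ('a, 'k) std_module)"
      using coordD(1)[OF coord_zmod] zero_in_Hom[OF coordD(1)[OF coord_zmod]] by auto
  qed (auto simp: dsum_def zmod_def fun_eq_iff)
  then show ?case using coord_zmod perp_zmod by blast
next
  case (insert j I)
  obtain D where D: "coord D" "isomorphic (dsum I E) D"
    "\<And>X. coord X \<Longrightarrow> perp D X \<longleftrightarrow> (\<forall>i\<in>I. perp (F i) X)" "\<And>X. coord X \<Longrightarrow> perp X D \<longleftrightarrow> (\<forall>i\<in>I. perp X (F i))"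
    using insert by blast
  have mj: "is_lmodule (E j)" and nj: "coord (F j)" "isomorphic (E j) (F j)" using insert.prems
    by auto
  obtain \<alpha> \<alpha>' where "inverse_homs (E j) (F j) \<alpha> \<alpha>'" using isomorphicE[OF nj(2)] .
  note \<alpha> = inverse_homsD[OF this]
  obtain \<beta> \<beta>' where "inverse_homs (dsum I E) D \<beta> \<beta>'" using isomorphicE[OF D(2)] .
  note \<beta> = inverse_homsD[OF this]
  have mI: "is_lmodule (dsum I E)" by (rule is_lmodule_dsum) (use insert.prems in auto)
  have mJ: "is_lmodule (dsum (insert j I) E)" by (rule is_lmodule_dsum) (use insert.prems in auto)
  define S where "S = extmod (F j) D 0"
  note e = extmod_zero[OF D(1) nj(1), folded S_def]
  note cJ = is_lmoduleD[OF mJ] and cS = coord_lmoduleD[OF e(1)] and cD = coord_lmoduleD[OF D(1)]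
  have split: "x j \<in> carr (E j)" "x(j := 0) \<in> carr (dsum I E)" if
    "x \<in> carr (dsum (insert j I) E)" for x
    using that insert.hyps by (auto simp: dsum_def)
  have merge: "u(j := v) \<in> carr (dsum (insert j I) E)" "u j = 0" if "u \<in> carr (dsum I E)"
    "v \<in> carr (E j)" for u v
    using that insert.hyps by (auto simp: dsum_def)
  have act_upd: "(act (dsum (insert j I) E) a x)(j := 0) = act (dsum I E) a (x(j := 0))"
    "act (dsum (insert j I) E) a x j = act (E j) a (x j)" for a x
    using insert.hyps by (auto simp: dsum_def fun_eq_iff)
  have act_mrg: "act (dsum (insert j I) E) a (u(j := v)) = (act (dsum I E) a u)(j := act (E j) a
    v)" for a u v
    using insert.hyps by (auto simp: dsum_def fun_eq_iff)
  have add_upd: "(x + y)(j := 0) = x(j := 0) + y(j := 0)" for x y :: "nat \<Rightarrow> 'v"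
    by (auto simp: fun_eq_iff)
  have add_mrg: "(u + u')(j := v + v') = u(j := v) + u'(j := v')" for u u' and v v' :: 'v
    by (auto simp: fun_eq_iff)
  define f where "f x = (if x \<in> carr (dsum (insert j I) E) then join (\<alpha> (x j)) (\<beta> (x(j := 0)))
    else 0)" for x
  define g where "g y = (if y \<in> carr S then (\<beta>' (odc y))(j := \<alpha>' (evc y)) else 0)" for y
  note a = HomD[OF \<alpha>(1)] and a' = HomD[OF \<alpha>(2)] and b = HomD[OF \<beta>(1)] and b' = HomD[OF \<beta>(2)]
  have iso: "isomorphic (dsum (insert j I) E) S"
  proof (rule isomorphicI[OF mJ coordD(1)[OF e(1)]])
    show "f \<in> Hom (dsum (insert j I) E) S"
      unfolding Hom_def
    proof (intro CollectI conjI ballI allI impI)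
      fix x c assume x: "x \<in> carr (dsum (insert j I) E)"
      note sx = split[OF x]
      show "f x \<in> carr S" using x sx a(1) b(1) by (simp add: f_def e(2))
      have *: "\<alpha> (act (E j) c (x j)) = act (F j) c (\<alpha> (x j))" by (rule a(4)[OF sx(1)])
      have **: "\<beta> (act (dsum I E) c (x(j := 0))) = act D c (\<beta> (x(j := 0)))" by (rule b(4)[OF sx(2)])
      show "f (act (dsum (insert j I) E) c x) = act S c (f x)"
        unfolding f_def using x cJ(5)[OF x, of c] by (simp add: e(3) act_upd * **)
      fix y assume y: "y \<in> carr (dsum (insert j I) E)"
      note sy = split[OF y]
      show "f (x + y) = f x + f y"
        unfolding f_def using x y cJ(2)[OF x y] a(3)[OF sx(1) sy(1)] b(3)[OF sx(2) sy(2)]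
          by (simp add: add_upd)
    qed (simp add: f_def)
    show "g \<in> Hom S (dsum (insert j I) E)"
      unfolding Hom_def
    proof (intro CollectI conjI ballI allI impI)
      fix x c assume x: "x \<in> carr S"
      then have sx: "evc x \<in> carr (F j)" "odc x \<in> carr D" by (auto simp: e(2))
      show "g x \<in> carr (dsum (insert j I) E)" using x merge(1)[OF b'(1)[OF sx(2)] a'(1)[OF
        sx(1)]] by (simp add: g_def)
      show "g (act S c x) = act (dsum (insert j I) E) c (g x)"
        unfolding g_def using x cS(5)[OF x, of c]
          by (simp add: e(3) act_mrg a'(4)[OF sx(1)] b'(4)[OF sx(2)])
      fix y assume y: "y \<in> carr S"
      then have sy: "evc y \<in> carr (F j)" "odc y \<in> carr D" by (auto simp: e(2))
      show "g (x + y) = g x + g y"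
        unfolding g_def using x y cS(2)[OF x y] a'(3)[OF sx(1) sy(1)] b'(3)[OF sx(2) sy(2)]
          by (simp add: add_mrg)
    qed (simp add: g_def)
  next
    fix x assume x: "x \<in> carr (dsum (insert j I) E)"
    note sx = split[OF x]
    have "f x \<in> carr S" using x sx a(1) b(1) by (simp add: f_def e(2))
    then show "g (f x) = x" using x by (simp add: g_def) (simp add: f_def \<alpha>(3)[OF sx(1)] \<beta>(3)[OF
      sx(2)])
  next
    fix x assume x: "x \<in> carr S"
    then have sx: "evc x \<in> carr (F j)" "odc x \<in> carr D" by (auto simp: e(2))
    note mm = merge[OF b'(1)[OF sx(2)] a'(1)[OF sx(1)]]
    have "(\<beta>' (odc x))(j := 0) = \<beta>' (odc x)" using mm(2) by (metis fun_upd_triv)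
    then show "f (g x) = x" using x mm(1) by (simp add: g_def f_def \<alpha>(4)[OF sx(1)] \<beta>(4)[OF sx(2)])
  qed
  have "(perp S X \<longleftrightarrow> (\<forall>i\<in>insert j I. perp (F i) X)) \<and> (perp X S \<longleftrightarrow> (\<forall>i\<in>insert j I. perp X (F i)))"
    if X: "coord X" for X
    using perp_sum[OF D(1) nj(1) X] D(3,4)[OF X] unfolding S_def by auto
  then show ?case using e(1) iso by (intro exI[of _ S] conjI allI impI) blast+
qed

lemma perp_dsum_iff:
  fixes E :: "nat \<Rightarrow> ('a, 'v::ab_group_add) lmodule" and X :: "('a, 'w::ab_group_add) lmodule"
  assumes "finite I" and E: "\<And>i. i \<in> I \<Longrightarrow> is_lmodule (E i) \<and> coord (F i) \<and> isomorphic (E i) (F i)"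
    and X: "fd_module sc X" "coord X'" "isomorphic X X'"
  shows "X \<in> right_perp sc (dsum I E) \<longleftrightarrow> (\<forall>i\<in>I. perp (F i) X')"
    "X \<in> left_perp sc (dsum I E) \<longleftrightarrow> (\<forall>i\<in>I. perp X' (F i))"
proof -
  note model = dsum_model[of I E F, OF assms(1)]
  obtain D where D0: "coord D" "isomorphic (dsum I E) D"
    "\<forall>X. coord X \<longrightarrow> (perp D X \<longleftrightarrow> (\<forall>i\<in>I. perp (F i) X)) \<and> (perp X D \<longleftrightarrow> (\<forall>i\<in>I. perp X (F i)))"
    by (rule exE[OF model], rule E, assumption, elim conjE, rule that)
  from D0(3)[rule_format, OF X(2)]
  have D: "coord D" "isomorphic (dsum I E) D"
    "perp D X' \<longleftrightarrow> (\<forall>i\<in>I. perp (F i) X')" "perp X' D \<longleftrightarrow> (\<forall>i\<in>I. perp X' (F i))"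
    using D0(1,2) by simp_all
  have m: "is_lmodule (dsum I E)" by (rule is_lmodule_dsum) (use E in auto)
  note x = fd_lmodule[OF X(1)]
  show "X \<in> right_perp sc (dsum I E) \<longleftrightarrow> (\<forall>i\<in>I. perp (F i) X')"
    unfolding D(3)[symmetric] perp_def[of D X'] right_perp_def mod_cat_def
    using Hom_trivial_iff[OF m x D(1,2) X(2,3)] Ext_trivial_iff[OF m x D(1,2) X(2,3)] X(1) by simp
  show "X \<in> left_perp sc (dsum I E) \<longleftrightarrow> (\<forall>i\<in>I. perp X' (F i))"
    unfolding D(4)[symmetric] perp_def[of X' D] left_perp_def mod_cat_def
    using Hom_trivial_iff[OF x m X(2,3) D(1,2)] Ext_trivial_iff[OF x m X(2,3) D(1,2)] X(1) by simp
qed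

end

section \<open>Additive functions on modules\<close>

text \<open>
  More functions than points are linearly dependent. Elimination of one point \<open>t\<close> at a time.
\<close>

lemma linear_dependence:
  fixes g :: "'i \<Rightarrow> 't \<Rightarrow> real"
  assumes "finite T" "finite I" "card T < card I"
  shows "\<exists>c. (\<exists>i\<in>I. c i \<noteq> 0) \<and> (\<forall>t\<in>T. (\<Sum>i\<in>I. c i * g i t) = 0)"
  using assms
proof (induction T arbitrary: I g rule: finite_induct)
  case empty
  then have "I \<noteq> {}" by auto
  then show ?case by (intro exI[of _ "\<lambda>_. 1"]) auto
next
  case (insert t T)
  show ?case
  proof (cases "\<forall>i\<in>I. g i t = 0")
    case True
    obtain c where "\<exists>i\<in>I. c i \<noteq> 0" "\<forall>t\<in>T. (\<Sum>i\<in>I. c i * g i t) = 0"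
      using insert.IH[of I g] insert.prems insert.hyps by auto
    then show ?thesis using True by (intro exI[of _ c]) auto
  next
    case False
    then obtain j where j: "j \<in> I" "g j t \<noteq> 0" by blast
    let ?q = "\<lambda>i. g i t / g j t"
    have "card T < card (I - {j})" using insert.prems insert.hyps j by auto
    then obtain c where c: "\<exists>i\<in>I - {j}. c i \<noteq> 0"
      "\<forall>s\<in>T. (\<Sum>i\<in>I - {j}. c i * (g i s - ?q i * g j s)) = 0"
      using insert.IH[of "I - {j}" "\<lambda>i s. g i s - ?q i * g j s"] insert.prems by auto
    define c' where "c' i = (if i = j then - (\<Sum>i\<in>I - {j}. c i * ?q i) else c i)" for i
    have "(\<Sum>i\<in>I. c' i * g i s) = (\<Sum>i\<in>I - {j}. c i * (g i s - ?q i * g j s))" for s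
    proof -
      have "(\<Sum>i\<in>I. c' i * g i s) = c' j * g j s + (\<Sum>i\<in>I - {j}. c' i * g i s)"
        using insert.prems(1) j(1) by (rule sum.remove)
      also have "(\<Sum>i\<in>I - {j}. c' i * g i s) = (\<Sum>i\<in>I - {j}. c i * g i s)"
        by (rule sum.cong) (auto simp: c'_def)
      also have "c' j * g j s = - (\<Sum>i\<in>I - {j}. c i * ?q i * g j s)"
        by (simp add: c'_def sum_distrib_right)
      finally show ?thesis by (simp add: sum_subtractf algebra_simps)
    qed
    moreover have "\<exists>i\<in>I. c' i \<noteq> 0" using c(1) by (auto simp: c'_def)
    ultimately show ?thesis using c(2) j(2) by (intro exI[of _ c']) auto
  qed
qed

context hereditary_algebra
begin

text \<open>
  Functions on modules that are additive on short exact sequences.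
\<close>

definition additive_fun :: "(('a, 'k) std_module \<Rightarrow> real) \<Rightarrow> bool" where
  "additive_fun f \<longleftrightarrow> (\<forall>A i B p C. ses A i B p C \<longrightarrow> f B = f A + f C)"

lemma additive_zero:
  assumes "additive_fun f" "coord M" "carr M = {0}"
  shows "f M = 0"
proof -
  have "ses M (id_hom M) M 0 M"
    using assms(2,3) id_hom_in_Hom[OF coordD(1)[OF assms(2)]] zero_in_Hom[OF coordD(1)[OF
      assms(2)], of M]
    by (auto simp: ses_def id_hom_def)
  then have "f M = f M + f M" using assms(1) unfolding additive_fun_def by blast
  then show ?thesis by simp
qed

lemma additive_iso:
  assumes "additive_fun f" "coord A" "coord B" "isomorphic A B"
  shows "f A = f B"
proof -
  obtain g where "ses A g B 0 zmod" using ses_isomorphic[OF assms(2-4)] by blast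
  then have "f B = f A + f zmod" using assms(1) unfolding additive_fun_def by blast
  then show ?thesis using additive_zero[OF assms(1) coord_zmod] by (simp add: zmod_def)
qed

lemma additive_dim: "additive_fun (\<lambda>M. real (kv.dim (carr M)))"
  unfolding additive_fun_def
proof (intro allI impI)
  fix A i B p C assume S: "ses A i B p C"
  show "real (kv.dim (carr B)) = real (kv.dim (carr A)) + real (kv.dim (carr C))"
    using dim_short_exact[OF vs(1) coordD(3)[OF sesD(2)[OF S]] ses_short_exact[OF S]] by simp
qed

lemma ses_dim: "ses A i B p C \<Longrightarrow> kv.dim (carr B) = kv.dim (carr A) + kv.dim (carr C)"
  using dim_short_exact[OF vs(1) coordD(3)[OF sesD(2)] ses_short_exact] by blast

lemma coord_dim_pos:
  assumes "coord M" "carr M \<noteq> {0}"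
  shows "kv.dim (carr M) > 0"
proof -
  obtain x where "x \<in> carr M" "x \<noteq> 0" using assms coord_lmoduleD(1)[OF assms(1)] by blast
  then show ?thesis by (rule dim_pos[OF vs(1) coordD(3)[OF assms(1)]])
qed

lemma additive_euler:
  assumes "coord X"
  shows "additive_fun (\<lambda>M. real_of_int (euler M X))" "additive_fun (\<lambda>M. real_of_int (euler X M))"
  using euler_additive[OF _ assms] by (auto simp: additive_fun_def)

text \<open>
  A nonzero submodule of least dimension is simple.
\<close>

lemma ex_simple_submodule:
  assumes M: "coord M" "carr M \<noteq> {0}"
  shows "\<exists>U. submodule U M \<and> simple_module sc (submod M U)"
proof -
  let ?P = "\<lambda>U. submodule U M \<and> U \<noteq> {0}"
  have "submodule (carr M) M" using coordD(1)[OF M(1)] by (simp add: submodule_def lmodule.collapse)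
  then obtain U where U: "?P U" and min: "\<And>V. ?P V \<Longrightarrow> kv.dim U \<le> kv.dim V"
    using ex_has_least_nat[of ?P "carr M" "\<lambda>U. kv.dim U"] M(2) by blast
  have nU: "coord (submod M U)" using coord_submod[OF M(1)] U by blast
  have "V = U" if V: "submodule V (submod M U)" "V \<noteq> {0}" for V
  proof -
    have VM: "submodule V M" "V \<subseteq> U" using V(1) U by (auto simp: submodule_def)
    obtain Q p where S: "ses (submod (submod M U) V) (id_hom (submod (submod M U) V)) (submod M
      U) p Q"
      using ses_quotient[OF nU V(1)] by blast
    have "kv.dim (carr Q) = 0" using ses_dim[OF S] min[of V] VM V(2) by simp
    then have "carr Q = {0}" using coord_dim_pos[OF sesD(3)[OF S]] by force
    then have "p y = 0" if "y \<in> U" for y using HomD(1)[OF sesD(5)[OF S], of y] that by simp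
    then have "U \<subseteq> V" using sesD(8)[OF S] by (auto simp: id_hom_def)
    then show ?thesis using VM by blast
  qed
  then have "simple_module sc (submod M U)" using U coord_fd[OF nU]
    by (auto simp: simple_module_def)
  then show ?thesis using U by blast
qed

lemma additive_vanishes:
  assumes f: "additive_fun f" and simple: "\<And>S. coord S \<Longrightarrow> simple_module sc S \<Longrightarrow> f S = 0"
    and M: "coord M"
  shows "f M = 0"
  using M
proof (induction "kv.dim (carr M)" arbitrary: M rule: less_induct)
  case less
  show ?case
  proof (cases "carr M = {0}")
    case True
    then show ?thesis using additive_zero[OF f less.prems] by simp
  next
    case False
    obtain U where U: "submodule U M" "simple_module sc (submod M U)"
      using ex_simple_submodule[OF less.prems False] by blast
    obtain Q p where S: "ses (submod M U) (id_hom (submod M U)) M p Q"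
      using ses_quotient[OF less.prems U(1)] by blast
    have nU: "coord (submod M U)" by (rule coord_submod[OF less.prems U(1)])
    have "kv.dim U > 0" using coord_dim_pos[OF nU] U(2) by (auto simp: simple_module_def)
    then have "f Q = 0" using less.hyps[OF _ sesD(3)[OF S]] ses_dim[OF S] by simp
    moreover have "f M = f (submod M U) + f Q" using f S unfolding additive_fun_def by blast
    ultimately show ?thesis using simple[OF nU U(2)] by simp
  qed
qed

text \<open>
  The additive functions form a space of dimension at most the number of isomorphism classes of
  simple modules. That this number is positive is assumed because it is defined as a cardinality,
  which is zero for an infinite set.
\<close>

lemma additive_dependence:
  assumes I: "finite I" "num_simples sc < card I" and n: "0 < num_simples sc"
    and f: "\<And>i. i \<in> I \<Longrightarrow> additive_fun (f i)"
  shows "\<exists>c. (\<exists>i\<in>I. c i \<noteq> 0) \<and> (\<forall>M. coord M \<longrightarrow> (\<Sum>i\<in>I. c i * f i M) = 0)"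
proof -
  let ?R = "{(S, T). simple_module sc S \<and> simple_module sc T \<and>
  isomorphic S T} :: ('a, 'k) std_module rel"
  let ?T = "{S :: ('a, 'k) std_module. simple_module sc S} // ?R"
  have fin: "finite ?T" using n card_ge_0_finite unfolding num_simples_def by blast
  define rep where "rep C = (SOME S. S \<in> C)" for C :: "('a, 'k) std_module set"
  define model where "model S = (SOME N. coord N \<and> isomorphic S N)" for S :: "('a, 'k) std_module"
  have model: "coord (model S)" "isomorphic S (model S)" if "fd_module sc S" for S
    using someI_ex[OF ex_coord[OF that]] by (auto simp: model_def)
  obtain c where c: "\<exists>i\<in>I. c i \<noteq> 0" "\<And>C. C \<in> ?T \<Longrightarrow> (\<Sum>i\<in>I. c i * f i (model (rep C))) = 0"
    using linear_dependence[OF fin I(1), of "\<lambda>i C. f i (model (rep C))"] I(2) unfolding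
      num_simples_def by blast
  let ?h = "\<lambda>M. \<Sum>i\<in>I. c i * f i M"
  have h: "additive_fun ?h"
    unfolding additive_fun_def
  proof (intro allI impI)
    fix A i B p C assume S: "ses A i B p C"
    have "?h B = (\<Sum>j\<in>I. c j * f j A + c j * f j C)"
    proof (rule sum.cong)
      fix j assume "j \<in> I"
      then have "f j B = f j A + f j C" using f S unfolding additive_fun_def by blast
      then show "c j * f j B = c j * f j A + c j * f j C" by (simp add: distrib_left)
    qed simp
    then show "?h B = ?h A + ?h C" by (simp add: sum.distrib)
  qed
  have "?h S = 0" if S: "coord S" "simple_module sc S" for S
  proof -
    let ?C = "?R `` {S}"
    have C: "?C \<in> ?T" using S(2) by (intro quotientI) simp
    have "isomorphic S S"
      by (rule isomorphicI[OF coordD(1)[OF S(1)] coordD(1)[OF S(1)] id_hom_in_Hom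
        id_hom_in_Hom]) (auto simp: id_hom_def coordD(1)[OF S(1)])
    then have "S \<in> ?C" using S(2) by simp
    then have "rep ?C \<in> ?C" unfolding rep_def by (rule someI)
    then have "(S, rep ?C) \<in> ?R" by (simp only: Image_singleton_iff)
    then have r: "isomorphic S (rep ?C)" "fd_module sc (rep ?C)"
      unfolding mem_Collect_eq prod.case simple_module_def by blast+
    have "isomorphic S (model (rep ?C))"
      by (rule isomorphic_trans[OF coordD(1)[OF S(1)] fd_lmodule[OF r(2)] coordD(1)[OF
        model(1)[OF r(2)]] r(1) model(2)[OF r(2)]])
    then have "?h S = ?h (model (rep ?C))" by (rule additive_iso[OF h S(1) model(1)[OF r(2)]])
    then show ?thesis using c(2)[OF C] by simp
  qed
  then have "?h M = 0" if "coord M" for M by (rule additive_vanishes[OF h _ that])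
  then show ?thesis using c(1) by blast
qed

section \<open>Exceptional sequences of coordinate models\<close>

text \<open>
  Perpendicular categories contain the kernel, the image and the cokernel of each of their
  morphisms. That the image belongs to them uses right exactness of \<open>Ext\<close>.
\<close>

lemma perp_kernel_image_cokernel:
  assumes "coord Y" "coord Y'" "f \<in> Hom Y Y'" "coord M"
  shows "perp Y M \<Longrightarrow> perp Y' M \<Longrightarrow> perp (submod Y {x\<in>carr Y. f x = 0}) M"
    "perp Y M \<Longrightarrow> perp Y' M \<Longrightarrow> perp (submod Y' (f ` carr Y)) M"
    "perp Y M \<Longrightarrow> perp Y' M \<Longrightarrow> ses (submod Y' (f ` carr Y)) i Y' p Q \<Longrightarrow> perp Q M"
    "perp M Y \<Longrightarrow> perp M Y' \<Longrightarrow> perp M (submod Y {x\<in>carr Y. f x = 0})"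
    "perp M Y \<Longrightarrow> perp M Y' \<Longrightarrow> perp M (submod Y' (f ` carr Y))"
    "perp M Y \<Longrightarrow> perp M Y' \<Longrightarrow> ses (submod Y' (f ` carr Y)) i Y' p Q \<Longrightarrow> perp M Q"
proof -
  note S = ses_image[OF assms(1-3)]
  obtain Q' p' where S': "ses (submod Y' (f ` carr Y)) (id_hom (submod Y' (f ` carr Y))) Y' p' Q'"
    using ses_quotient[OF assms(2) image_submodule[OF coordD(1)[OF assms(1)] coordD(1)[OF
      assms(2)] assms(3)]] by blast
  show i1: "perp (submod Y' (f ` carr Y)) M" if "perp Y M" "perp Y' M"
    using that contra_vanishing(1)[OF S assms(4)] contra_vanishing(6)[OF S' assms(4)]
      by (simp add: perp_def)
  show i2: "perp M (submod Y' (f ` carr Y))" if "perp M Y" "perp M Y'"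
    using that co_vanishing(6)[OF S assms(4)] co_vanishing(1)[OF S' assms(4)]
      by (simp add: perp_def)
  show "perp (submod Y {x\<in>carr Y. f x = 0}) M" if "perp Y M" "perp Y' M"
    by (rule perp_ses(3)[OF S assms(4) that(1) i1[OF that]])
  show "perp M (submod Y {x\<in>carr Y. f x = 0})" if "perp M Y" "perp M Y'"
    by (rule perp_ses(5)[OF S assms(4) that(1) i2[OF that]])
  show "perp Q M" if "perp Y M" "perp Y' M" "ses (submod Y' (f ` carr Y)) i Y' p Q"
    by (rule perp_ses(4)[OF that(3) assms(4) i1[OF that(1,2)] that(2)])
  show "perp M Q" if "perp M Y" "perp M Y'" "ses (submod Y' (f ` carr Y)) i Y' p Q"
    by (rule perp_ses(6)[OF that(3) assms(4) i2[OF that(1,2)] that(2)])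
qed

lemma end_divisionD:
  assumes "end_division M" "f \<in> Hom M M" "f \<noteq> 0"
  obtains g where "g \<in> Hom M M" "g \<circ> f = id_hom M" "f \<circ> g = id_hom M"
  using assms unfolding end_division_def by blast

text \<open>
  A homomorphism from \<open>E\<close> to a non-split extension of \<open>E\<close> by \<open>Y\<close> is zero after projection to \<open>E\<close>,
  since it would otherwise provide a section; so it comes from \<open>Hom E Y\<close>.
\<close>

lemma no_hom_nonsplit:
  assumes E: "coord E" "end_division E" and Y: "coord Y" "no_hom E Y"
    and d: "d \<in> Coc E Y" "\<not> (\<exists>h\<in>Lin E Y. coboundary E Y h = d)"
  shows "no_hom E (extmod Y E d)"
proof -
  note S = sesD[OF ses_extmod[OF E(1) Y(1) d(1)]]
  let ?X = "extmod Y E d"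
  note e = coordD(1)[OF E(1)] and x = coordD(1)[OF S(2)]
  have "t = 0" if t: "t \<in> Hom E ?X" for t
  proof (cases "ext_proj Y E \<circ> t = 0")
    case True
    have tX: "evc (t u) \<in> carr Y" "odc (t u) = 0" if "u \<in> carr E" for u
      using HomD(1)[OF t that] fun_cong[OF True, of u] by (auto simp: extmod_def ext_proj_def)
    have d0: "d a 0 = 0" for a using LinD(3)[OF E(1) CocD(1)[OF d(1)]] .
    have "evc (t (act E a u)) = act Y a (evc (t u))" if "u \<in> carr E" for a u
      using HomD(4)[OF t that, of a] tX(2)[OF that] d0 by (simp add: extmod_def)
    then have "(\<lambda>u. evc (t u)) \<in> Hom E Y"
      using tX HomD(2,3)[OF t] by (simp add: Hom_def)
    then have "(\<lambda>u. evc (t u)) = 0" using Y no_hom_iff[OF E(1) Y(1)] by blast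
    then have "evc (t u) = 0" for u by (auto dest: fun_cong[of _ _ u])
    show ?thesis
    proof
      fix u show "t u = 0 u"
        using \<open>evc (t u) = 0\<close> tX(2)[of u] HomD(2)[OF t, of u] evc_odc_eq_0[of "t u"]
          by (cases "u \<in> carr E") auto
    qed
  next
    case False
    have "ext_proj Y E \<circ> t \<in> Hom E E" by (rule Hom_comp[OF e x e t S(5)])
    then obtain g where g: "g \<in> Hom E E" "ext_proj Y E \<circ> t \<circ> g = id_hom E"
      using end_divisionD[OF E(2) _ False] by blast
    have "\<exists>h\<in>Lin E Y. coboundary E Y h = d"
    proof (rule section_coboundary[OF E(1) Y(1) d(1) Hom_comp[OF e e x g(1) t]])
      show "ext_proj Y E ((t \<circ> g) u) = u" if "u \<in> carr E" for u
        using fun_cong[OF g(2), of u] that by (simp add: id_hom_def)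
    qed
    then show ?thesis using d(2) by blast
  qed
  then show ?thesis using no_hom_iff[OF E(1) S(2)] zero_in_Hom[OF x] by blast
qed

text \<open>
  One step towards the universal extension: if \<open>Hom E Y\<close> vanishes but \<open>Ext E Y\<close> does not, then for
  a non-split extension \<open>Z\<close> of \<open>E\<close> by \<open>Y\<close> the space \<open>Hom E Z\<close> vanishes too, and \<open>- euler E Z\<close>, the
  dimension of \<open>Ext E Z\<close>, is smaller than that of \<open>Ext E Y\<close>.
\<close>

lemma nonsplit_step:
  assumes E: "coord E" "end_division E" "no_ext E E" and Y: "coord Y" "no_hom E Y" "\<not> no_ext E Y"
  shows "\<exists>i Z p. ses Y i Z p E \<and> no_hom E Z \<and> nat (- euler E Z) < nat (- euler E Y)"
proof -
  obtain d where d: "d \<in> Coc E Y" "\<not> (\<exists>h\<in>Lin E Y. coboundary E Y h = d)"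
    using Y(3) unfolding no_ext_def coker0_def by blast
  note S = ses_extmod[OF E(1) Y(1) d(1)]
  have Z: "no_hom E (extmod Y E d)" by (rule no_hom_nonsplit[OF E(1,2) Y(1,2) d])
  have "\<not> no_hom E E" using E no_hom_iff[OF E(1,1)] by (simp add: end_division_def)
  then have "euler E E > 0" by (rule euler_no_ext[OF E(1,1,3)])
  then have "nat (- euler E (extmod Y E d)) < nat (- euler E Y)"
    using euler_additive(2)[OF S E(1)] euler_no_hom(1)[OF E(1) sesD(2)[OF S] Z] by simp
  then show ?thesis using S Z by blast
qed

text \<open>
  A nonzero endomorphism of \<open>E\<close> is invertible, so its image is not contained in a proper
  submodule.
\<close>

lemma kernel_no_hom:
  assumes E: "coord E" "end_division E" and Y: "coord Y" and f: "f \<in> Hom E Y" "f \<noteq> 0"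
  shows "no_hom E (submod E {x\<in>carr E. f x = 0})"
proof -
  let ?K = "submod E {x\<in>carr E. f x = 0}"
  have nK: "coord ?K" by (rule coord_submod[OF E(1) kernel_submodule[OF coordD(1)[OF E(1)]
    coordD(1)[OF Y] f(1)]])
  have "g = 0" if g: "g \<in> Hom E ?K" for g
  proof (rule ccontr)
    assume "g \<noteq> 0"
    moreover have "g \<in> Hom E E" using g by (auto simp: Hom_def)
    ultimately obtain k where k: "k \<in> Hom E E" "g \<circ> k = id_hom E" using end_divisionD[OF E(2)]
      by metis
    have "f u = 0" for u
    proof (cases "u \<in> carr E")
      case True
      have "g (k u) = u" using fun_cong[OF k(2), of u] True by (simp add: id_hom_def)
      then show ?thesis using HomD(1)[OF g HomD(1)[OF k(1) True]] by simp
    qed (rule HomD(2)[OF f(1)])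
    then show False using f(2) by (simp add: fun_eq_iff)
  qed
  then show ?thesis using no_hom_iff[OF E(1) nK] zero_in_Hom[OF coordD(1)[OF nK]] by blast
qed

lemma nonzero_hom:
  assumes "coord E" "coord Y" "\<not> no_hom E Y"
  obtains f where "f \<in> Hom E Y" "f \<noteq> 0"
  using assms no_hom_iff[OF assms(1,2)] zero_in_Hom[OF coordD(1)[OF assms(2)], of E] by blast

text \<open>The quotient by the image of a nonzero homomorphism has smaller dimension.\<close>

lemma image_quotient:
  assumes E: "coord E" and Y: "coord Y" and f: "f \<in> Hom E Y" "f \<noteq> 0"
  obtains Q p where "ses (submod Y (f ` carr E)) (id_hom (submod Y (f ` carr E))) Y p Q"
    "kv.dim (carr Q) < kv.dim (carr Y)"
proof -
  have sub: "submodule (f ` carr E) Y" by (rule image_submodule[OF coordD(1)[OF E]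
    coordD(1)[OF Y] f(1)])
  obtain Q p where S: "ses (submod Y (f ` carr E)) (id_hom (submod Y (f ` carr E))) Y p Q"
    using ses_quotient[OF Y sub] by blast
  obtain u where u: "f u \<noteq> 0" using f(2) by (auto simp: fun_eq_iff)
  then have "u \<in> carr E" using HomD(2)[OF f(1)] by blast
  then have "carr (submod Y (f ` carr E)) \<noteq> {0}" using u by auto
  then have "kv.dim (carr Q) < kv.dim (carr Y)"
    using coord_dim_pos[OF coord_submod[OF Y sub]] ses_dim[OF S] by simp
  then show ?thesis using S that by blast
qed

end

text \<open>
  Coordinate models \<open>F 1, \<dots>, F n\<close> of the terms of a nonempty complete exceptional sequence.
\<close>

locale complete_models = hereditary_algebra sc for sc :: "'k::field \<Rightarrow> 'a::ring_1 \<Rightarrow> 'a" +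
  fixes n :: nat and F :: "nat \<Rightarrow> ('a, 'k) std_module"
  assumes n: "n = num_simples sc" "n > 0"
    and coord: "\<And>i. i \<in> {1..n} \<Longrightarrow> coord (F i)"
    and rigid: "\<And>i. i \<in> {1..n} \<Longrightarrow> no_ext (F i) (F i)"
    and div: "\<And>i. i \<in> {1..n} \<Longrightarrow> end_division (F i)"
    and seq: "\<And>i j. i \<in> {1..n} \<Longrightarrow> j \<in> {1..n} \<Longrightarrow> i < j \<Longrightarrow> perp (F j) (F i)"
begin

lemma euler_seq:
  "i \<in> {1..n} \<Longrightarrow> euler (F i) (F i) > 0"
  "i \<in> {1..n} \<Longrightarrow> j \<in> {1..n} \<Longrightarrow> i < j \<Longrightarrow> euler (F j) (F i) = 0"
proof -
  show "euler (F i) (F i) > 0" if i: "i \<in> {1..n}"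
    using euler_no_ext[OF coord[OF i] coord[OF i] rigid[OF i]] no_hom_iff[OF coord[OF i]
      coord[OF i]] div[OF i]
    by (simp add: end_division_def)
  show "euler (F j) (F i) = 0" if "i \<in> {1..n}" "j \<in> {1..n}" "i < j"
    using euler_no_hom(2)[OF coord coord] seq that by (auto simp: perp_def)
qed

text \<open>
  Only the zero module is left perpendicular to the first \<open>k\<close> terms and right perpendicular to the
  others. Let \<open>W\<close> be nonzero with these properties. The additive functions \<open>f 0\<close>, the dimension,
  \<open>f i M = euler M (F i)\<close> for \<open>1 \<le> i \<le> k\<close>, and \<open>f i M = euler (F i) M\<close> for \<open>i > k\<close> satisfy a
  linear relation with coefficients \<open>c\<close>. At the modules \<open>W, F (k+1), \<dots>, F n, F k, \<dots>, F 1\<close>, taken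
  in this order, the matrix of their values is triangular with nonzero diagonal, so all
  coefficients vanish.
\<close>

lemma perpendicular_zero:
  assumes W: "coord W" and l: "\<And>i. i \<in> {1..k} \<Longrightarrow> perp W (F i)"
    and r: "\<And>i. i \<in> {k<..n} \<Longrightarrow> perp (F i) W"
    and k: "k \<le> n"
  shows "carr W = {0}"
proof (rule ccontr)
  assume "carr W \<noteq> {0}"
  then have dim: "kv.dim (carr W) > 0" by (rule coord_dim_pos[OF W])
  define f where "f i M = (if i = 0 then real (kv.dim (carr M)) else
    if i \<le> k then real_of_int (euler M (F i)) else real_of_int (euler (F i) M))" for i M
  have "additive_fun (f i)" if "i \<in> {0..n}" for i
  proof (cases "i = 0")
    case True
    then show ?thesis using additive_dim by (simp add: f_def[abs_def])
  next
    case False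
    then show ?thesis using additive_euler[OF coord, of i] that
      by (cases "i \<le> k") (simp_all add: f_def[abs_def])
  qed
  then obtain c where c: "\<exists>i\<in>{0..n}. c i \<noteq> 0" "\<And>M. coord M \<Longrightarrow> (\<Sum>i\<in>{0..n}. c i * f i M) = 0"
    using additive_dependence[of "{0..n}" f] n by auto
  have coeff: "c j = 0"
    if M: "coord M" and j: "j \<in> {0..n}" "f j M \<noteq> 0" and z: "\<And>i. i \<in> {0..n} \<Longrightarrow> i \<noteq> j \<Longrightarrow> c i = 0 \<or>
    f i M = 0" for j M
  proof -
    have "(\<Sum>i\<in>{0..n}. c i * f i M) = c j * f j M + (\<Sum>i\<in>{0..n} - {j}. c i * f i M)"
      using j by (intro sum.remove) auto
    also have "(\<Sum>i\<in>{0..n} - {j}. c i * f i M) = 0" using z by (intro sum.neutral) auto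
    finally show ?thesis using c(2)[OF M] j by simp
  qed
  have c0: "c 0 = 0"
  proof (rule coeff[OF W])
    fix i assume i: "i \<in> {0..n}" "i \<noteq> 0"
    then have "f i W = 0"
      using l[of i] r[of i] euler_no_hom(2)[OF W coord[of i]] euler_no_hom(2)[OF coord[of i] W]
      by (auto simp: f_def perp_def)
    then show "c i = 0 \<or> f i W = 0" ..
  qed (use dim in \<open>auto simp: f_def\<close>)
  have above: "c j = 0" if "k < j" "j \<le> n" for j
    using that
  proof (induction j rule: less_induct)
    case (less j)
    have j: "j \<in> {1..n}" using less.prems by auto
    show ?case
    proof (rule coeff[OF coord[OF j]])
      fix i assume i: "i \<in> {0..n}" "i \<noteq> j"
      consider "i = 0" | "1 \<le> i" "i \<le> k" | "k < i" "i < j" | "j < i" using i by force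
      then show "c i = 0 \<or> f i (F j) = 0"
      proof cases
        case 2
        then show ?thesis using euler_seq(2)[of i j] j less.prems by (auto simp: f_def)
      next
        case 3
        then show ?thesis using less.IH less.prems by auto
      next
        case 4
        then show ?thesis using euler_seq(2)[of j i] i j less.prems by (auto simp: f_def)
      qed (use c0 in auto)
    qed (use j less.prems euler_seq(1)[OF j] in \<open>auto simp: f_def\<close>)
  qed
  have below: "c j = 0" if "1 \<le> j" "j \<le> k" for j
    using that
  proof (induction "k - j" arbitrary: j rule: less_induct)
    case (less j)
    have j: "j \<in> {1..n}" using less.prems k by auto
    show ?case
    proof (rule coeff[OF coord[OF j]])
      fix i assume i: "i \<in> {0..n}" "i \<noteq> j"
      consider "i = 0" | "1 \<le> i" "i < j" | "j < i" "i \<le> k" | "k < i" using i by force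
      then show "c i = 0 \<or> f i (F j) = 0"
      proof cases
        case 2
        then show ?thesis using euler_seq(2)[of i j] j less.prems by (auto simp: f_def)
      next
        case 3
        then show ?thesis using less.hyps[of i] less.prems by auto
      next
        case 4
        then show ?thesis using above i by auto
      qed (use c0 in auto)
    qed (use j less.prems euler_seq(1)[OF j] in \<open>auto simp: f_def\<close>)
  qed
  have "c i = 0" if "i \<in> {0..n}" for i
    using that c0 above[of i] below[of i] by (cases "i = 0"; cases "i \<le> k") auto
  then show False using c(1) by blast
qed

text \<open>
  A module that is left perpendicular to the first \<open>k\<close> terms is left perpendicular to every module
  that is right perpendicular to the last \<open>n - k\<close> terms. By induction on \<open>j\<close> this is shown for the
  class of those \<open>Y\<close> that are in addition right perpendicular to the terms after \<open>F j\<close>; for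
  \<open>j = k\<close> that class is zero.
\<close>

lemma perpendicular_halves:
  assumes X: "coord X" "\<And>i. i \<in> {k<..n} \<Longrightarrow> perp (F i) X" and k: "k \<le> n"
    and Y: "coord Y" "\<And>i. i \<in> {1..k} \<Longrightarrow> perp Y (F i)"
  shows "perp Y X"
proof -
  define cls where "cls j Y \<longleftrightarrow> coord Y \<and> (\<forall>i\<in>{1..k}. perp Y (F i)) \<and> (\<forall>i\<in>{j<..n}. perp (F i) Y)"
    for j Y
  have "\<forall>Y. cls j Y \<longrightarrow> perp Y X" if "k \<le> j" "j \<le> n" for j
    using that
  proof (induction j rule: dec_induct)
    case base
    show ?case
    proof (intro allI impI)
      fix Y assume Y: "cls k Y"
      then have "coord Y" "carr Y = {0}" using perpendicular_zero[of Y k] k by (auto simp: cls_def)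
      moreover from this have "isomorphic Y zmod"
        using zero_in_Hom[OF coordD(1)[OF coord_zmod], of Y] zero_in_Hom[OF coordD(1), of Y zmod]
        by (intro isomorphicI[where f = 0 and g = 0] coordD(1)[OF coord_zmod] coordD(1)) (auto
          simp: zmod_def)
      ultimately obtain f where "ses Y f zmod 0 zmod" using ses_isomorphic[OF _ coord_zmod] by blast
      then show "perp Y X" using perp_ses(3)[OF _ X(1)] perp_zmod(1)[OF X(1)] by blast
    qed
  next
    case (step m)
    let ?E = "F (Suc m)"
    have m: "Suc m \<in> {1..n}" using step.prems by auto
    note E = coord[OF m] div[OF m] rigid[OF m]
    have EX: "perp ?E X" using X(2) step by auto
    have Ecls: "cls (Suc m) ?E" unfolding cls_def using E(1) seq m step by auto
    have ses_cls: "cls (Suc m) B" if S: "ses A i B p C" and AC: "cls (Suc m) A" "cls (Suc m) C"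
      for A i B p C
      unfolding cls_def
    proof (intro conjI ballI)
      show "perp B (F i)" if "i \<in> {1..k}" for i
        using perp_ses(1)[OF S coord] AC that k by (auto simp: cls_def)
      show "perp (F i) B" if "i \<in> {Suc m<..n}" for i
        using perp_ses(2)[OF S coord] AC that by (auto simp: cls_def)
    qed (rule sesD(2)[OF S])
    \<comment> \<open>if \<open>Hom E Y = 0\<close>, form non-split extensions of \<open>E\<close>
    by \<open>Y\<close> until the previous class is reached\<close>
    have no_hom_case: "perp Y X" if "cls (Suc m) Y" "no_hom ?E Y" for Y
      using that
    proof (induction "nat (- euler ?E Y)" arbitrary: Y rule: less_induct)
      case less
      have Y: "coord Y" using less.prems by (simp add: cls_def)
      show ?case
      proof (cases "no_ext ?E Y")
        case True
        have "cls m Y"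
          unfolding cls_def
        proof (intro conjI ballI)
          fix i assume i: "i \<in> {m<..n}"
          show "perp (F i) Y"
            using less.prems True i by (cases "i = Suc m") (auto simp: cls_def perp_def)
        qed (use less.prems in \<open>auto simp: cls_def\<close>)
        then show ?thesis using step.IH step.prems by auto
      next
        case False
        obtain i Z p where Z: "ses Y i Z p ?E" "no_hom ?E Z"
          "nat (- euler ?E Z) < nat (- euler ?E Y)"
          using nonsplit_step[OF E Y less.prems(2) False] by blast
        have "perp Z X" by (rule less.hyps[OF Z(3) ses_cls[OF Z(1) less.prems(1) Ecls] Z(2)])
        then show ?thesis by (rule perp_ses(3)[OF Z(1) X(1) _ EX])
      qed
    qed
    show ?case
    proof (intro allI impI)
      fix Y assume "cls (Suc m) Y"
      then show "perp Y X"
      proof (induction "kv.dim (carr Y)" arbitrary: Y rule: less_induct)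
        case less
        have Y: "coord Y" using less.prems by (simp add: cls_def)
        show ?case
        proof (cases "no_hom ?E Y")
          case True
          then show ?thesis by (rule no_hom_case[OF less.prems])
        next
          case False
          \<comment> \<open>otherwise \<open>Y\<close> is built from \<open>E\<close>, the kernel of some \<open>f : E \<rightarrow> Y\<close>
          and the smaller module \<open>Y / f E\<close>\<close>
          obtain f where f: "f \<in> Hom ?E Y" "f \<noteq> 0" using nonzero_hom[OF E(1) Y False] .
          let ?K = "submod ?E {x\<in>carr ?E. f x = 0}" and ?I = "submod Y (f ` carr ?E)"
          obtain Q p where Q: "ses ?I (id_hom ?I) Y p Q" "kv.dim (carr Q) < kv.dim (carr Y)"
            using image_quotient[OF E(1) Y f] .
          note S = ses_image[OF E(1) Y f(1)]
          note cl = perp_kernel_image_cokernel[OF E(1) Y f(1) coord]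
          have "cls (Suc m) ?K" "cls (Suc m) Q"
            using Ecls less.prems cl(1,4) cl(3,6)[OF _ _ _ Q(1)] sesD(1)[OF S] sesD(3)[OF Q(1)] k
            by (auto simp: cls_def)
          then have "perp ?K X" "perp Q X"
            using no_hom_case kernel_no_hom[OF E(1,2) Y f] less.hyps[OF Q(2)] by auto
          then show ?thesis using perp_ses(1)[OF Q(1) X(1)] perp_ses(4)[OF S X(1) _ EX] by blast
        qed
      qed
    qed
  qed
  from this[OF k order_refl] show ?thesis using Y by (auto simp: cls_def)
qed

text \<open>
  A module \<open>X\<close> in the right perpendicular category of the terms after \<open>F k\<close> that shows that \<open>F k\<close>
  is not relatively projective leads to an object \<open>Z\<close> of the right perpendicular category of
  \<open>F k, \<dots>, F n\<close> that maps onto \<open>F k\<close>.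
\<close>

lemma ex_perpendicular_cover:
  assumes k: "k \<in> {1..n}" and X: "coord X" "\<And>i. i \<in> {k<..n} \<Longrightarrow> perp (F i) X" "\<not> no_ext (F k) X"
  shows "\<exists>A i Z p. ses A i Z p (F k) \<and> (\<forall>i\<in>{k..n}. perp (F i) Z)"
proof -
  note E = coord[OF k] div[OF k] rigid[OF k]
  have Ek: "perp (F i) (F k)" if "i \<in> {k<..n}" for i using seq[OF k, of i] that k by auto
  \<comment> \<open>factor out images of homomorphisms from \<open>F k\<close>; the extension group stays nonzero because the
    one of \<open>F k\<close> by that image is zero\<close>
  have "\<exists>X. coord X \<and> (\<forall>i\<in>{k<..n}. perp (F i) X) \<and> no_hom (F k) X \<and> \<not> no_ext (F k) X"
    using X
  proof (induction "kv.dim (carr X)" arbitrary: X rule: less_induct)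
    case less
    show ?case
    proof (cases "no_hom (F k) X")
      case True
      then show ?thesis using less.prems by blast
    next
      case False
      obtain f where f: "f \<in> Hom (F k) X" "f \<noteq> 0" using nonzero_hom[OF E(1) less.prems(1) False] .
      let ?I = "submod X (f ` carr (F k))"
      obtain Q p where Q: "ses ?I (id_hom ?I) X p Q" "kv.dim (carr Q) < kv.dim (carr X)"
        using image_quotient[OF E(1) less.prems(1) f] .
      have "no_ext (F k) ?I" by (rule co_vanishing(6)[OF ses_image[OF E(1) less.prems(1) f(1)]
        E(1,3)])
      then have "\<not> no_ext (F k) Q" using co_vanishing(5)[OF Q(1) E(1)] less.prems(3) by blast
      moreover have "perp (F i) Q" if "i \<in> {k<..n}" for i
        using perp_kernel_image_cokernel(6)[OF E(1) less.prems(1) f(1) coord Ek less.prems(2)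
          Q(1)] that by auto
      ultimately show ?thesis using less.hyps[OF Q(2) sesD(3)[OF Q(1)]] by blast
    qed
  qed
  then obtain X' where X': "coord X'" "\<forall>i\<in>{k<..n}. perp (F i) X'" "no_hom (F k) X'"
    "\<not> no_ext (F k) X'" by blast
  then show ?thesis
  proof (induction "nat (- euler (F k) X')" arbitrary: X' rule: less_induct)
    case less
    obtain i Z p where Z: "ses X' i Z p (F k)" "no_hom (F k) Z"
      "nat (- euler (F k) Z) < nat (- euler (F k) X')"
      using nonsplit_step[OF E less.prems(1,3,4)] by blast
    have perp: "\<forall>i\<in>{k<..n}. perp (F i) Z" using perp_ses(2)[OF Z(1) coord] less.prems(2) Ek by auto
    show ?case
    proof (cases "no_ext (F k) Z")
      case True
      have "perp (F i) Z" if "i \<in> {k..n}" for i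
        using perp True Z(2) that by (cases "i = k") (auto simp: perp_def)
      then show ?thesis using Z(1) by blast
    next
      case False
      show ?thesis by (rule less.hyps[OF Z(3) sesD(2)[OF Z(1)] perp Z(2) False])
    qed
  qed
qed

lemma projective_or_injective:
  assumes k: "k \<in> {1..n}"
  shows "(\<forall>X. coord X \<longrightarrow> (\<forall>i\<in>{k<..n}. perp (F i) X) \<longrightarrow> no_ext (F k) X) \<or>
    (\<forall>Y. coord Y \<longrightarrow> (\<forall>i\<in>{1..<k}. perp Y (F i)) \<longrightarrow> no_ext Y (F k))"
proof (rule disjCI, intro allI impI, rule ccontr)
  fix X
  assume "\<not> (\<forall>Y. coord Y \<longrightarrow> (\<forall>i\<in>{1..<k}. perp Y (F i)) \<longrightarrow> no_ext Y (F k))"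
  then obtain Y where Y: "coord Y" "\<And>i. i \<in> {1..<k} \<Longrightarrow> perp Y (F i)" "\<not> no_ext Y (F k)" by blast
  assume "coord X" "\<forall>i\<in>{k<..n}. perp (F i) X" "\<not> no_ext (F k) X"
  then obtain A i Z p where Z: "ses A i Z p (F k)" "\<And>i. i \<in> {k..n} \<Longrightarrow> perp (F i) Z"
    using ex_perpendicular_cover[OF k] by blast
  have "perp Y Z"
    by (rule perpendicular_halves[where k = "k - 1"]) (use Y Z sesD(2)[OF Z(1)] k in auto)
  then have "no_ext Y (F k)" using co_vanishing(6)[OF Z(1) Y(1)] by (simp add: perp_def)
  then show False using Y(3) by blast
qed

end

section \<open>The theorem\<close>

lemma end_division_iso:
  assumes M: "is_lmodule M" and N: "is_lmodule N" and iso: "isomorphic M N"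
    and div: "end_division M"
  shows "end_division N"
proof -
  obtain \<mu> \<mu>' where iso: "inverse_homs M N \<mu> \<mu>'" using isomorphicE[OF iso] .
  note \<mu> = inverse_homsD[OF iso]
  have z: "\<mu> 0 = 0" "\<mu>' 0 = 0" using Hom_diff(1)[OF M \<mu>(1)] Hom_diff(1)[OF N \<mu>(2)] .
  note conj' = Hom_transport[OF M N M N iso iso]
    and conj = Hom_transport[OF N M N M inverse_homs_sym[OF iso] inverse_homs_sym[OF iso]]
  have "Hom N N \<noteq> {0}"
  proof
    assume 0: "Hom N N = {0}"
    then have "f = 0" if "f \<in> Hom M M" for f using conj'[OF that] by blast
    then show False using div zero_in_Hom[OF M, of M] unfolding end_division_def by blast
  qed
  moreover have "\<exists>g\<in>Hom N N. g \<circ> f = id_hom N \<and> f \<circ> g = id_hom N" if f: "f \<in> Hom N N" "f \<noteq> 0" for f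
  proof -
    obtain g where g: "g \<in> Hom M M" "g \<circ> (\<mu>' \<circ> (f \<circ> \<mu>)) = id_hom M" "(\<mu>' \<circ> (f \<circ> \<mu>)) \<circ> g = id_hom M"
      using div conj[OF f(1)] f(2) unfolding end_division_def by blast
    have f0: "f 0 = 0" by (rule Hom_diff(1)[OF N f(1)])
    have g0: "g 0 = 0" by (rule Hom_diff(1)[OF M g(1)])
    have 1: "\<mu> (g (\<mu>' (f x))) = x" if "x \<in> carr N" for x
      using fun_cong[OF g(2), of "\<mu>' x"] \<mu>(4)[OF that] HomD(1)[OF \<mu>(2) that]
        by (simp add: id_hom_def)
    have 2: "f (\<mu> (g (\<mu>' x))) = x" if x: "x \<in> carr N" for x
    proof -
      have *: "f (\<mu> (g (\<mu>' x))) \<in> carr N"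
        by (rule HomD(1)[OF f(1) HomD(1)[OF \<mu>(1) HomD(1)[OF g(1) HomD(1)[OF \<mu>(2) x]]]])
      have "\<mu>' (f (\<mu> (g (\<mu>' x)))) = \<mu>' x"
        using fun_cong[OF g(3), of "\<mu>' x"] HomD(1)[OF \<mu>(2) x] by (simp add: id_hom_def)
      then show ?thesis using \<mu>(4)[OF x] \<mu>(4)[OF *] by metis
    qed
    have "\<mu> \<circ> (g \<circ> \<mu>') \<circ> f = id_hom N" "f \<circ> (\<mu> \<circ> (g \<circ> \<mu>')) = id_hom N"
      using 1 2 HomD(2)[OF f(1)] HomD(2)[OF \<mu>(2)] f0 g0 z by (auto simp: id_hom_def fun_eq_iff)
    then show ?thesis using conj'(1)[OF g(1)] by blast
  qed
  ultimately show ?thesis by (simp add: end_division_def)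
qed

context hereditary_algebra
begin

text \<open>
  In a right perpendicular category, an object without extensions by its objects is projective,
  and dually in the next lemma.
\<close>

lemma projective_wrt_right_perp:
  fixes E :: "nat \<Rightarrow> ('a, 'v::ab_group_add) lmodule" and P :: "('a, 'w::ab_group_add) lmodule"
  assumes I: "finite I" and E: "\<And>i. i \<in> I \<Longrightarrow> is_lmodule (E i) \<and> coord (F i) \<and> isomorphic (E i) (F i)"
    and P: "is_lmodule P" "coord P'" "isomorphic P P'"
    and ext: "\<And>X. coord X \<Longrightarrow> (\<forall>i\<in>I. perp (F i) X) \<Longrightarrow> no_ext P' X"
  shows "projective_wrt (right_perp sc (dsum I E) :: ('a, 'k) std_module set) P"
proof -
  let ?A = "right_perp sc (dsum I E) :: ('a, 'k) std_module set"
  have fd: "fd_module sc X" if "X \<in> ?A" for X using that by (simp add: right_perp_def mod_cat_def)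
  have refl: "isomorphic X X" if "coord X" for X
    by (rule isomorphicI[OF coordD(1)[OF that] coordD(1)[OF that] id_hom_in_Hom id_hom_in_Hom])
      (auto simp: id_hom_def coordD(1)[OF that])
  have mem: "X \<in> ?A \<longleftrightarrow> (\<forall>i\<in>I. perp (F i) X')" if "fd_module sc X" "coord X'" "isomorphic X X'"
    for X X'
    by (rule perp_dsum_iff(1)[OF I E that])
  have mem': "X \<in> ?A \<longleftrightarrow> (\<forall>i\<in>I. perp (F i) X)" if "coord X" for X
    by (rule mem[OF coord_fd[OF that] that refl[OF that]])
  obtain \<mu> \<mu>' where "inverse_homs P P' \<mu> \<mu>'" using isomorphicE[OF P(3)] .
  note \<mu> = inverse_homsD[OF this]
  have nF: "coord (F i)" if "i \<in> I" for i using E[OF that] by blast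
  show ?thesis
  proof (rule projective_wrtI[OF P(1) fd])
    show "Y \<in> ?A" if "X \<in> ?A" "coord Y" "isomorphic X Y" for X Y
      using mem[OF fd[OF that(1)] that(2,3)] mem'[OF that(2)] that(1) by simp
    show "Q \<in> ?A" if "X \<in> ?A" "Y \<in> ?A" "coord X" "coord Y" "f \<in> Hom X Y"
      "ses (submod Y (f ` carr X)) (id_hom (submod Y (f ` carr X))) Y p Q" for X Y f p Q
      using that(1,2) perp_kernel_image_cokernel(6)[OF that(3-5) nF _ _ that(6)]
      unfolding mem'[OF that(3)] mem'[OF that(4)] mem'[OF sesD(3)[OF that(6)]] by blast
    fix X Y g f assume X: "X \<in> ?A" "coord X" and Y: "Y \<in> ?A" "coord Y"
      and g: "g \<in> Hom X Y" "\<forall>y\<in>carr Y. \<exists>x\<in>carr X. g x = y" and f: "f \<in> Hom P Y"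
    let ?K = "submod X {x\<in>carr X. g x = 0}"
    note S = ses_kernel[OF X(2) Y(2) g]
    have "\<forall>i\<in>I. perp (F i) ?K"
      using X(1) Y(1) perp_kernel_image_cokernel(4)[OF X(2) Y(2) g(1) nF]
      unfolding mem'[OF X(2)] mem'[OF Y(2)] by blast
    then have "no_ext P' ?K" by (rule ext[OF sesD(1)[OF S]])
    then obtain h where h: "h \<in> Hom P' X" "g \<circ> h = f \<circ> \<mu>'"
      using Hom_lift[OF S P(2)] Hom_comp[OF coordD(1)[OF P(2)] P(1) coordD(1)[OF Y(2)] \<mu>(2) f]
        by blast
    have "g \<circ> (h \<circ> \<mu>) = f"
    proof
      fix x show "(g \<circ> (h \<circ> \<mu>)) x = f x"
      proof (cases "x \<in> carr P")
        case True
        then show ?thesis using fun_cong[OF h(2), of "\<mu> x"] \<mu>(3) by simp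
      next
        case False
        then show ?thesis
          using HomD(2)[OF \<mu>(1)] HomD(2)[OF f] coord_Hom_diff(1)[OF P(2) h(1)]
            coord_Hom_diff(1)[OF X(2) g(1)]
          by simp
      qed
    qed
    then show "\<exists>h\<in>Hom P X. g \<circ> h = f"
      using Hom_comp[OF P(1) coordD(1)[OF P(2)] coordD(1)[OF X(2)] \<mu>(1) h(1)] by blast
  qed
qed

lemma injective_wrt_left_perp:
  fixes E :: "nat \<Rightarrow> ('a, 'v::ab_group_add) lmodule" and P :: "('a, 'w::ab_group_add) lmodule"
  assumes I: "finite I" and E: "\<And>i. i \<in> I \<Longrightarrow> is_lmodule (E i) \<and> coord (F i) \<and> isomorphic (E i) (F i)"
    and P: "is_lmodule P" "coord P'" "isomorphic P P'"
    and ext: "\<And>X. coord X \<Longrightarrow> (\<forall>i\<in>I. perp X (F i)) \<Longrightarrow> no_ext X P'"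
  shows "injective_wrt (left_perp sc (dsum I E) :: ('a, 'k) std_module set) P"
proof -
  let ?A = "left_perp sc (dsum I E) :: ('a, 'k) std_module set"
  have fd: "fd_module sc X" if "X \<in> ?A" for X using that by (simp add: left_perp_def mod_cat_def)
  have refl: "isomorphic X X" if "coord X" for X
    by (rule isomorphicI[OF coordD(1)[OF that] coordD(1)[OF that] id_hom_in_Hom id_hom_in_Hom])
      (auto simp: id_hom_def coordD(1)[OF that])
  have mem: "X \<in> ?A \<longleftrightarrow> (\<forall>i\<in>I. perp X' (F i))" if "fd_module sc X" "coord X'" "isomorphic X X'"
    for X X'
    by (rule perp_dsum_iff(2)[OF I E that])
  have mem': "X \<in> ?A \<longleftrightarrow> (\<forall>i\<in>I. perp X (F i))" if "coord X" for X
    by (rule mem[OF coord_fd[OF that] that refl[OF that]])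
  obtain \<mu> \<mu>' where "inverse_homs P P' \<mu> \<mu>'" using isomorphicE[OF P(3)] .
  note \<mu> = inverse_homsD[OF this]
  have nF: "coord (F i)" if "i \<in> I" for i using E[OF that] by blast
  show ?thesis
  proof (rule injective_wrtI[OF P(1) fd])
    show "Y \<in> ?A" if "X \<in> ?A" "coord Y" "isomorphic X Y" for X Y
      using mem[OF fd[OF that(1)] that(2,3)] mem'[OF that(2)] that(1) by simp
    show "submod X {x\<in>carr X. f x = 0} \<in> ?A" if "X \<in> ?A" "Y \<in> ?A" "coord X" "coord Y"
      "f \<in> Hom X Y" for X Y f
      using that(1,2) perp_kernel_image_cokernel(1)[OF that(3-5) nF]
      unfolding mem'[OF that(3)] mem'[OF that(4)] mem'[OF sesD(1)[OF ses_image[OF that(3-5)]]]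
        by blast
    fix X Y g f assume X: "X \<in> ?A" "coord X" and Y: "Y \<in> ?A" "coord Y"
      and g: "g \<in> Hom X Y" "\<forall>x\<in>carr X. g x = 0 \<longrightarrow> x = 0" and f: "f \<in> Hom X P"
    note mX = coordD(1)[OF X(2)] and mY = coordD(1)[OF Y(2)]
    let ?I = "submod Y (g ` carr X)"
    obtain Q p where S: "ses ?I (id_hom ?I) Y p Q"
      using ses_quotient[OF Y(2) image_submodule[OF mX mY g(1)]] by blast
    note S' = sesD[OF S]
    have S1: "ses X g Y p Q"
      unfolding ses_def
    proof (intro conjI ballI impI)
      show "p (g x) = 0" if "x \<in> carr X" for x using S'(7)[of "g x"] that by (simp add: id_hom_def)
      show "\<exists>x\<in>carr X. g x = y" if "y \<in> carr Y" "p y = 0" for y using S'(8)[OF that]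
        by (auto simp: id_hom_def)
    qed (use X Y S' g in auto)
    have "\<forall>i\<in>I. perp Q (F i)"
      using X(1) Y(1) perp_kernel_image_cokernel(3)[OF X(2) Y(2) g(1) nF _ _ S]
      unfolding mem'[OF X(2)] mem'[OF Y(2)] by blast
    then have "no_ext Q P'" by (rule ext[OF S'(3)])
    then obtain h where h: "h \<in> Hom Y P'" "h \<circ> g = \<mu> \<circ> f"
      using Hom_extend[OF S1 P(2)] Hom_comp[OF mX P(1) coordD(1)[OF P(2)] f \<mu>(1)] by blast
    have "\<mu>' \<circ> h \<circ> g = f"
    proof
      fix x show "(\<mu>' \<circ> h \<circ> g) x = f x"
      proof (cases "x \<in> carr X")
        case True
        then show ?thesis using fun_cong[OF h(2), of x] \<mu>(3)[OF HomD(1)[OF f True]] by simp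
      next
        case False
        then show ?thesis
          using HomD(2)[OF g(1)] HomD(2)[OF f] Hom_diff(1)[OF mY h(1)] coord_Hom_diff(1)[OF
            P(2) \<mu>(2)] by simp
      qed
    qed
    then show "\<exists>h\<in>Hom Y P. h \<circ> g = f"
      using Hom_comp[OF mY coordD(1)[OF P(2)] P(1) h(1) \<mu>(2)] by blast
  qed
qed

end

theorem theorem0p1:
  fixes sc :: "'k::field \<Rightarrow> 'a::ring_1 \<Rightarrow> 'a"
    and E :: "nat \<Rightarrow> ('a, 'v::ab_group_add) lmodule"
    and n k :: nat
  assumes "fd_algebra sc"
    and "hereditary sc"
    and "complete_exceptional_seq sc n E"
    and "1 \<le> k" and "k \<le> n"
  shows "relatively_projective sc n E k \<or> relatively_injective sc E k"
proof -
  interpret hereditary_algebra sc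
    using assms(1,2) by (simp add: hereditary_algebra_def hereditary_algebra_axioms_def)
  have n: "n = num_simples sc" and exc: "\<And>i. i \<in> {1..n} \<Longrightarrow> exceptional sc (E i)"
    and right: "\<And>i j. i \<in> {1..n} \<Longrightarrow> j \<in> {1..n} \<Longrightarrow> i < j \<Longrightarrow> E i \<in> right_perp sc (E j)"
    using assms(3) by (auto simp: complete_exceptional_seq_def exceptional_seq_def)
  have fd: "fd_module sc (E i)" if "i \<in> {1..n}" for i using exc[OF that]
    by (simp add: exceptional_def)
  have "\<forall>i\<in>{1..n}. \<exists>N. coord N \<and> isomorphic (E i) N" using ex_coord fd by blast
  from bchoice[OF this] obtain F where "\<forall>i\<in>{1..n}. coord (F i) \<and> isomorphic (E i) (F i)" ..
  then have F: "is_lmodule (E i)" "coord (F i)" "isomorphic (E i) (F i)" if "i \<in> {1..n}" for i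
    using that fd_lmodule[OF fd[OF that]] by auto
  interpret complete_models sc n F
  proof unfold_locales
    show "n = num_simples sc" by (rule n)
    show "n > 0" using assms(4,5) by simp
    fix i assume i: "i \<in> {1..n}"
    show "coord (F i)" by (rule F(2)[OF i])
    show "no_ext (F i) (F i)"
      using exc[OF i] Ext_trivial_iff[OF F(1)[OF i] F(1)[OF i] F(2,3)[OF i] F(2,3)[OF i]]
        by (simp add: exceptional_def)
    show "end_division (F i)"
      using end_division_iso[OF F(1)[OF i] coordD(1)[OF F(2)[OF i]] F(3)[OF i]] exc[OF i]
        by (simp add: exceptional_def)
    fix j assume j: "j \<in> {1..n}" "i < j"
    show "perp (F j) (F i)"
      using right[OF i j] Ext_trivial_iff[OF F(1)[OF j(1)] F(1)[OF i] F(2,3)[OF j(1)] F(2,3)[OF i]]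
        Hom_trivial_iff[OF F(1)[OF j(1)] F(1)[OF i] F(2,3)[OF j(1)] F(2,3)[OF i]]
      by (simp add: right_perp_def perp_def)
  qed
  have k: "k \<in> {1..n}" using assms(4,5) by simp
  have EF: "is_lmodule (E i) \<and> coord (F i) \<and> isomorphic (E i) (F i)" if "i \<in> {1..n}" for i
    using F[OF that] by blast
  have hi: "is_lmodule (E i) \<and> coord (F i) \<and> isomorphic (E i) (F i)" if "i \<in> {k+1..n}" for i
    using EF[of i] that by auto
  have lo: "is_lmodule (E i) \<and> coord (F i) \<and> isomorphic (E i) (F i)" if "i \<in> {1..<k}" for i
    using EF[of i] that k by auto
  from projective_or_injective[OF k] show ?thesis
  proof
    assume p: "\<forall>X. coord X \<longrightarrow> (\<forall>i\<in>{k<..n}. perp (F i) X) \<longrightarrow> no_ext (F k) X"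
    have "E k \<in> A_cat sc n E k"
      unfolding A_cat_def
      by (subst perp_dsum_iff(1)[OF _ hi fd[OF k] F(2,3)[OF k]]) (use seq k in auto)
    moreover have "projective_wrt (A_cat sc n E k :: ('a, 'k) std_module set) (E k)"
      unfolding A_cat_def
    proof (rule projective_wrt_right_perp[OF _ hi F(1,2,3)[OF k]])
      fix X assume "coord X" "\<forall>i\<in>{k+1..n}. perp (F i) X"
      then show "no_ext (F k) X" using p by auto
    qed auto
    ultimately show ?thesis by (simp add: relatively_projective_def)
  next
    assume i: "\<forall>Y. coord Y \<longrightarrow> (\<forall>i\<in>{1..<k}. perp Y (F i)) \<longrightarrow> no_ext Y (F k)"
    have "E k \<in> B_cat sc E k"
      unfolding B_cat_def
      by (subst perp_dsum_iff(2)[OF _ lo fd[OF k] F(2,3)[OF k]]) (use seq k in auto)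
    moreover have "injective_wrt (B_cat sc E k :: ('a, 'k) std_module set) (E k)"
      unfolding B_cat_def
      by (rule injective_wrt_left_perp[OF _ lo F(1,2,3)[OF k]]) (use i in auto)
    ultimately show ?thesis by (simp add: relatively_injective_def)
  qed
qed

end
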